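(* Let $\beta$ be a quadratic Pisot unit with Galois conjugate $\beta'$, and let $\mathcal{A}$ be a finite set of consecutive integers with $0\in\mathcal{A}$ and $\#\mathcal{A}>\beta$. Let $\alpha\in\{\beta,-\beta\}$. If $$\beta^{l-1}(\beta-1)\cdot\max\{\beta-j,1\}<\#\mathcal{A}-1\leq\beta^{l-1}(\beta-1)(\beta-j+1)$$ for some integer $l\geq 0$ and some $j\in\{1,\dots,\lfloor\beta\rfloor\}$, then, up to finitely many exceptions, the distances between consecutive points in $X^{\mathcal{A}}(\alpha)$ take values $$\frac1{\beta^l},\qquad \frac1{\beta^l}(j-\beta'),\qquad \frac1{\beta^l}(j+1-\beta')$$ with frequencies $$1-\frac{\beta^{l-1}(\beta-1)}{\#\mathcal{A}-1},\qquad 1-\frac{\beta^{l-1}(\beta-j)(\beta-1)}{\#\mathcal{A}-1},\qquad -1+\frac{\beta^{l-1}(\beta-j+1)(\beta-1)}{\#\mathcal{A}-1},$$ respectively.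
   Context: A quadratic Pisot unit is a real number $\beta>1$ which is the larger root of $x^2-px-1$ with an integer $p\geq 1$, or of $x^2-px+1$ with an integer $p\geq 3$; $\beta'$ is the other root. For a real $\alpha$ with $|\alpha|>1$ and a finite set $\mathcal{A}\ni 0$ of consecutive integers, $$X^{\mathcal{A}}(\alpha) = \Big\{\sum_{j=0}^n a_j \alpha^j : n\in\mathbb{N},\ a_j\in\mathcal{A}\Big\},$$ where $\mathbb{N}=\{0,1,2,\dots\}$. The set $X^{\mathcal{A}}(\alpha)$ is a discrete closed subset of $\mathbb{R}$, and its distances (gaps) are the differences of consecutive elements. If the gap sequence is coded by an infinite word $u=u_0u_1u_2\cdots$ over a finite alphabet whose symbols correspond to the different values of the distances, then the frequency of a symbol $X$ is $$\rho_X=\lim_{n\to\infty}\frac{\#\{0\leq i<n : u_i=X\}}{n}.$$ The gap sequence is listed starting from an element of $X^{\mathcal{A}}(\alpha)$ and going to the right (to the left if $X^{\mathcal{A}}(\alpha)$ is bounded from above). A frequency equal to $0$ means that the corresponding symbol $X$ satisfies $\rho_X=\lim_{n\to\infty}\frac{\#\{0\leq i<n : u_i=X\}}{n}=0$ (the value need not occur). *)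

theory Defs
  imports Complex_Main
begin

definition quadratic_Pisot_unit_with_conjugate :: "real \<Rightarrow> real \<Rightarrow> bool" where
  "quadratic_Pisot_unit_with_conjugate \<beta> \<beta>' \<longleftrightarrow>
     1 < \<beta> \<and> \<beta>' < \<beta> \<and>
     (\<exists>p :: int.
        (p \<ge> 1 \<and> {x :: real. x\<^sup>2 - of_int p * x - 1 = 0} = {\<beta>, \<beta>'}) \<or>
        (p \<ge> 3 \<and> {x :: real. x\<^sup>2 - of_int p * x + 1 = 0} = {\<beta>, \<beta>'}))"

definition spectrum :: "int set \<Rightarrow> real \<Rightarrow> real set" where
  "spectrum A \<alpha> = {(\<Sum>j\<le>n. of_int (a j) * \<alpha> ^ j) | n a. \<forall>j\<le>n. a j \<in> A}"

definition consecutive :: "real set \<Rightarrow> real \<Rightarrow> real \<Rightarrow> bool" where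
  "consecutive X x y \<longleftrightarrow> x \<in> X \<and> y \<in> X \<and> x < y \<and> X \<inter> {x<..<y} = {}"

text \<open>The neighbours of a point \<open>x\<close> in \<open>X\<close>.  They are meaningful only where the least (greatest)
  element exists: for closed discrete \<open>X\<close>, whenever \<open>x\<close> is not the last (first) point of \<open>X\<close>.\<close>

definition right_neighbour :: "real set \<Rightarrow> real \<Rightarrow> real" where
  "right_neighbour X x = (LEAST y. y \<in> X \<and> x < y)"

definition left_neighbour :: "real set \<Rightarrow> real \<Rightarrow> real" where
  "left_neighbour X x = (GREATEST y. y \<in> X \<and> y < x)"

text \<open>The gaps of \<open>X\<close> listed from the point \<open>x\<^sub>0\<close> to the right, or to the left if \<open>X\<close> is bounded
  from above.  The letters of the word are the gap lengths themselves.\<close>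

definition gap_word :: "real set \<Rightarrow> real \<Rightarrow> nat \<Rightarrow> real" where
  "gap_word X x\<^sub>0 i =
     (if bdd_above X
      then (left_neighbour X ^^ i) x\<^sub>0 - (left_neighbour X ^^ Suc i) x\<^sub>0
      else (right_neighbour X ^^ Suc i) x\<^sub>0 - (right_neighbour X ^^ i) x\<^sub>0)"

definition has_frequency :: "(nat \<Rightarrow> 'a) \<Rightarrow> 'a \<Rightarrow> real \<Rightarrow> bool" where
  "has_frequency u c \<rho> \<longleftrightarrow> (\<lambda>n. real (card {i. i < n \<and> u i = c}) / real n) \<longlonglongrightarrow> \<rho>"

end

theory Submission
  imports Defs
begin

text \<open>Write x' for the conjugate of x \<in> \<int>[\<beta>] and X for the spectrum.  Conjugation turns
\<Sum> a_j \<alpha> ^ j into \<Sum> a_j \<alpha>' ^ j, and \<bar>\<alpha>'\<bar> = 1/\<beta> < 1, so all conjugates of points of X lie in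
one compact interval \<Omega>, the window, of length (#A - 1)\<beta>/(\<beta> - 1).  The theorem follows from three facts.

(1) X almost exhausts the points of \<int>[\<beta>] with conjugate in \<Omega>: for every \<epsilon> > 0, on each
side on which X is unbounded, all but finitely many x \<in> \<int>[\<beta>] whose conjugate is at distance at
least \<epsilon> from the complement of \<Omega> belong to X (spectrum_fills).  To see that x has an expansion, split off
its digits from the lowest one, y = (x - a)/\<alpha> with a chosen so that y' \<in> \<Omega> again.  Since \<bar>\<alpha>\<bar> > 1
the points approach the attractor of these maps, so if some point had no expansion, then some point of
\<int>[\<beta>] in the product of attractor and window would have none.  For the shortest alphabets this product
contains almost nothing but 0 (the attractor_points lemmas); one alphabet with a bad point there needs greedy digits
(core_interval).  Longer alphabets reduce to these in a number of steps that depends only on \<epsilon> (filled_interval_grows).  The \<epsilon> is essential: for \<beta>^2 = 3\<beta> - 1,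
\<alpha> = \<beta> and A = {0,1,2} the points 2(1 + \<beta> + ... + \<beta>^(k-1)) + 3\<beta>^k are missing from X
for every k, although their conjugates are interior to \<Omega>.

(2) Put \<Delta>_1 = \<beta>^(-l) and \<Delta>_2 = \<beta>^(-l)(j - \<beta>').  They generate \<int>[\<beta>], and up to a
common sign their conjugates are a = \<beta>^l and -b = -\<beta>^l(\<beta> - j).  The hypothesis on #A says exactly that
max(a,b) < \<bar>\<Omega>\<bar> \<le> a + b.  Hence a point of \<int>[\<beta>] with conjugate in the interior of \<Omega> is followed
at distance \<Delta>_1, \<Delta>_2 or \<Delta>_1 + \<Delta>_2.  The points missing from X far out have conjugates close
to the end points of \<Omega>; such a point sits between a gap \<Delta>_1 and a gap \<Delta>_2, and its removal
produces the gap \<Delta>_1 + \<Delta>_2 (gap_values).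

(3) The points of \<int>[\<beta>] with conjugate in an interval of length w have density w/(\<beta> - \<beta>')
(card_strip).  Far out, the gap to the right of x \<in> X is \<Delta>_i if and only if x + \<Delta>_i \<in> X, which confines
x' to an interval of length \<bar>\<Omega>\<bar> - a or \<bar>\<Omega>\<bar> - b.  Dividing by the density of X gives the frequencies
1 - a/\<bar>\<Omega>\<bar> and 1 - b/\<bar>\<Omega>\<bar>; the third one is what is left (gap_frequencies).

If X is bounded above, all this is applied to -X, the spectrum of the alphabet -A.\<close>

section \<open>Arithmetic of a quadratic unit\<close>

text \<open>Both families of polynomials are treated together as x^2 - px - e, so the norm of \<beta> is -e:
e = 1 is the case of norm -1 and e = -1 the case of norm 1.\<close>

locale quadratic_unit =
  fixes \<beta> \<beta>' :: real and p e :: int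
  assumes beta_gt_1: "1 < \<beta>"
    and trace: "\<beta> + \<beta>' = of_int p"
    and norm: "\<beta> * \<beta>' = - of_int e"
    and cases_e: "(e = 1 \<and> p \<ge> 1) \<or> (e = -1 \<and> p \<ge> 3)"
begin

lemma beta'_eq: "\<beta>' = - of_int e / \<beta>"
  using norm beta_gt_1 by (simp add: field_simps)

lemma beta_sq: "\<beta> * \<beta> = of_int p * \<beta> + of_int e"
proof -
  have "\<beta> * (\<beta> + \<beta>') = of_int p * \<beta>" using trace by simp
  then show ?thesis using norm by (simp add: algebra_simps)
qed

lemma beta'_sq: "\<beta>' * \<beta>' = of_int p * \<beta>' + of_int e"
proof -
  have "\<beta>' * (\<beta> + \<beta>') = of_int p * \<beta>'" using trace by simp
  then show ?thesis using norm by (simp add: algebra_simps)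
qed

lemma abs_beta': "\<bar>\<beta>'\<bar> = 1 / \<beta>"
  using beta'_eq beta_gt_1 cases_e by auto

lemma abs_beta'_less_1: "\<bar>\<beta>'\<bar> < 1"
  using abs_beta' beta_gt_1 by simp

text \<open>The covolume of \<int>[\<beta>] embedded in the plane by x \<mapsto> (x, x').\<close>

definition \<kappa> :: real where "\<kappa> = \<beta> - \<beta>'"

lemma kappa_pos: "\<kappa> > 0"
  using abs_beta'_less_1 beta_gt_1 unfolding \<kappa>_def by simp

text \<open>A rational \<beta> would make the discriminant p^2 + 4e a perfect square, but it lies strictly between
consecutive squares, or between p^2 and (p+2)^2 with the parity of p.\<close>

lemma beta_irrational:
  fixes u v :: int
  assumes "of_int u + of_int v * \<beta> = 0"
  shows "u = 0 \<and> v = 0"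
proof (rule ccontr)
  assume "\<not> (u = 0 \<and> v = 0)"
  then have v: "v \<noteq> 0" using assms by auto
  define w where "w = 2 * u + p * v"
  have ub: "real_of_int u = - of_int v * \<beta>" using assms by simp
  have "real_of_int (w * w) = of_int ((p * p + 4 * e) * (v * v))"
  proof -
    have "real_of_int (w * w) = (of_int p * of_int v - 2 * of_int v * \<beta>) ^ 2"
      by (simp add: w_def ub power2_eq_square mult.assoc)
    also have "\<dots> = of_int v * of_int v * (of_int p * of_int p + 4 * (\<beta> * \<beta> - of_int p * \<beta>))"
      by (simp add: power2_eq_square algebra_simps)
    also have "\<dots> = of_int ((p * p + 4 * e) * (v * v))"
      by (simp add: beta_sq)
    finally show ?thesis .
  qed
  then have eq: "w\<^sup>2 = (p * p + 4 * e) * v\<^sup>2" by (simp only: of_int_eq_iff power2_eq_square)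
  then have "v\<^sup>2 dvd w\<^sup>2" by simp
  then have "v dvd w" by (simp add: pow_divides_pow_iff)
  then obtain k where k: "w = v * k" by blast
  have "k\<^sup>2 = p * p + 4 * e" using eq v by (simp add: k power_mult_distrib)
  then have kk: "\<bar>k\<bar> * \<bar>k\<bar> = p * p + 4 * e" by (simp add: power2_eq_square flip: abs_mult)
  have sq: "x < y \<longleftrightarrow> x * x < y * y" if "x \<ge> 0" "y \<ge> 0" for x y :: int
    using that by (meson linorder_not_less mult_mono mult_strict_mono')
  show False using cases_e
  proof
    assume h: "e = 1 \<and> p \<ge> 1"
    then have "p < \<bar>k\<bar>" using sq[of p "\<bar>k\<bar>"] kk by simp
    moreover have "\<bar>k\<bar> < p + 2" using sq[of "\<bar>k\<bar>" "p+2"] kk h by (simp add: algebra_simps)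
    ultimately have "\<bar>k\<bar> = p + 1" by simp
    then have "2 * p = 3" using kk h by (simp add: algebra_simps)
    then show False by presburger
  next
    assume h: "e = -1 \<and> p \<ge> 3"
    then have "\<bar>k\<bar> < p" using sq[of "\<bar>k\<bar>" p] kk by simp
    moreover have "p - 1 < \<bar>k\<bar>" using sq[of "p-1" "\<bar>k\<bar>"] kk h by (simp add: algebra_simps)
    ultimately show False by simp
  qed
qed

text \<open>The ring \<int>[\<beta>] and its conjugation.  Both are taken inside the reals, so that spectra are subsets
of the ring; the description in gal_def is meaningful because \<beta> is irrational.\<close>

definition L :: "real set" where
  "L = {of_int u + of_int v * \<beta> | u v :: int. True}"

definition gal :: "real \<Rightarrow> real" where
  "gal x = (THE t. \<exists>u v :: int. x = of_int u + of_int v * \<beta> \<and> t = of_int u + of_int v * \<beta>')"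

lemma coords_unique:
  fixes u v u' v' :: int
  assumes "of_int u + of_int v * \<beta> = of_int u' + of_int v' * \<beta>"
  shows "u = u' \<and> v = v'"
  using beta_irrational[of "u - u'" "v - v'"] assms by (simp add: algebra_simps)

lemma gal_coords [simp]: "gal (of_int u + of_int v * \<beta>) = of_int u + of_int v * \<beta>'"
  unfolding gal_def by (rule the_equality) (auto dest: coords_unique)

lemma L_I: "of_int u + of_int v * \<beta> \<in> L" by (auto simp: L_def)

text \<open>The difference x - x' depends on the second coordinate only.  All enumerations of lattice points below use this.\<close>

lemma L_E:
  assumes "x \<in> L"
  obtains u v :: int where "x = of_int u + of_int v * \<beta>" "gal x = of_int u + of_int v * \<beta>'"
    "x - gal x = of_int v * \<kappa>"
proof -
  obtain u v :: int where x: "x = of_int u + of_int v * \<beta>" using assms by (auto simp: L_def)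
  moreover from this have gx: "gal x = of_int u + of_int v * \<beta>'" by (simp only: gal_coords)
  moreover have "x - gal x = of_int v * \<kappa>"
    by (subst gx) (simp only: x, simp add: \<kappa>_def algebra_simps)
  ultimately show ?thesis by (rule that)
qed

lemma L_of_int: "of_int u \<in> L" and gal_of_int: "gal (of_int u) = of_int u"
  using L_I[of u 0] gal_coords[of u 0] by simp_all

lemma L_beta: "\<beta> \<in> L" and gal_beta: "gal \<beta> = \<beta>'"
  using L_I[of 0 1] gal_coords[of 0 1] by simp_all

lemma L_beta': "\<beta>' \<in> L" and gal_beta': "gal \<beta>' = \<beta>"
proof -
  have 1: "\<beta>' = of_int p + of_int (-1) * \<beta>" using trace by simp
  show "\<beta>' \<in> L" using L_I[of p "-1"] 1 by simp
  show "gal \<beta>' = \<beta>" using gal_coords[of p "-1"] 1 by simp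
qed

lemma
  assumes "x \<in> L" "y \<in> L"
  shows L_add: "x + y \<in> L" and gal_add: "gal (x + y) = gal x + gal y"
    and L_diff: "x - y \<in> L" and gal_diff: "gal (x - y) = gal x - gal y"
    and L_mult: "x * y \<in> L" and gal_mult: "gal (x * y) = gal x * gal y"
proof -
  obtain u v where x: "x = of_int u + of_int v * \<beta>" "gal x = of_int u + of_int v * \<beta>'"
    using L_E[OF assms(1)] by metis
  obtain u' v' where y: "y = of_int u' + of_int v' * \<beta>" "gal y = of_int u' + of_int v' * \<beta>'"
    using L_E[OF assms(2)] by metis
  have 1: "x + y = of_int (u + u') + of_int (v + v') * \<beta>" by (simp add: x y algebra_simps)
  have 2: "x - y = of_int (u - u') + of_int (v - v') * \<beta>" by (simp add: x y algebra_simps)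
  have "x * y = of_int u * of_int u' + (of_int u * of_int v' + of_int v * of_int u') * \<beta>
      + of_int v * of_int v' * (\<beta> * \<beta>)" by (simp add: x y algebra_simps)
  then have 3: "x * y = of_int (u * u' + e * v * v') + of_int (u * v' + v * u' + p * v * v') * \<beta>"
    by (simp add: beta_sq algebra_simps)
  have "gal x * gal y = of_int u * of_int u' + (of_int u * of_int v' + of_int v * of_int u') * \<beta>'
      + of_int v * of_int v' * (\<beta>' * \<beta>')" by (simp only: x(2) y(2)) (simp add: algebra_simps)
  then have 4: "gal x * gal y = of_int (u * u' + e * v * v') + of_int (u * v' + v * u' + p * v * v') * \<beta>'"
    by (simp add: beta'_sq algebra_simps)
  show "x + y \<in> L" "x - y \<in> L" "x * y \<in> L" by (simp_all only: 1 2 3 L_I)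
  show "gal (x + y) = gal x + gal y" by (simp only: 1 gal_coords x(2) y(2)) (simp add: algebra_simps)
  show "gal (x - y) = gal x - gal y" by (simp only: 2 gal_coords x(2) y(2)) (simp add: algebra_simps)
  show "gal (x * y) = gal x * gal y" by (simp only: 3 4 gal_coords)
qed

lemma gal_inj: assumes "x \<in> L" "y \<in> L" "gal x = gal y" shows "x = y"
proof -
  obtain u v where x: "x - y = of_int u + of_int v * \<beta>" "gal (x - y) = of_int u + of_int v * \<beta>'"
    using L_E[OF L_diff[OF assms(1,2)]] by metis
  have "gal (x - y) = 0" using gal_diff assms by simp
  then have "of_int (u + p * v) + of_int (- v) * \<beta> = 0"
  proof -
    have beta': "\<beta>' = of_int p - \<beta>" using trace by simp
    have "of_int (u + p * v) + of_int (- v) * \<beta> = of_int u + of_int v * \<beta>'"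
      by (simp add: beta' algebra_simps)
    then show ?thesis using \<open>gal (x - y) = 0\<close> x(2) by simp
  qed
  then have "u + p * v = 0 \<and> - v = 0" by (rule beta_irrational)
  then have "u = 0" "v = 0" by auto
  then show ?thesis using x(1) by simp
qed

lemma
  assumes "x \<in> L"
  shows L_uminus: "- x \<in> L" and gal_uminus: "gal (- x) = - gal x"
  using L_diff[OF L_of_int[of 0] assms] gal_diff[OF L_of_int[of 0] assms] gal_of_int[of 0] by simp_all

lemma
  assumes "x \<in> L"
  shows L_power: "x ^ n \<in> L" and gal_power: "gal (x ^ n) = gal x ^ n"
proof -
  have "x ^ n \<in> L \<and> gal (x ^ n) = gal x ^ n"
    using L_of_int[of 1] gal_of_int[of 1] by (induction n) (simp_all add: L_mult gal_mult assms)
  then show "x ^ n \<in> L" "gal (x ^ n) = gal x ^ n" by auto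
qed

lemma inverse_beta: "1 / \<beta> = - of_int e * \<beta>'" "1 / \<beta>' = - of_int e * \<beta>"
proof -
  have e: "real_of_int e * of_int e = 1" using cases_e by auto
  have "\<beta> * (- of_int e * \<beta>') = - of_int e * (\<beta> * \<beta>')" by simp
  then have "\<beta> * (- of_int e * \<beta>') = 1" using norm e by simp
  moreover have "\<beta>' \<noteq> 0" using norm cases_e by auto
  ultimately show "1 / \<beta> = - of_int e * \<beta>'" "1 / \<beta>' = - of_int e * \<beta>"
    using beta_gt_1 by (auto simp: field_simps)
qed

lemma
  shows L_inverse_beta: "1 / \<beta> \<in> L" and gal_inverse_beta: "gal (1 / \<beta>) = 1 / \<beta>'"
proof -
  have "of_int (- e) * \<beta>' \<in> L" by (intro L_mult L_of_int L_beta')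
  then show "1 / \<beta> \<in> L" by (simp add: inverse_beta)
  have "gal (of_int (- e) * \<beta>') = of_int (- e) * \<beta>"
    by (simp only: gal_mult L_of_int L_beta' gal_of_int gal_beta')
  then show "gal (1 / \<beta>) = 1 / \<beta>'" by (simp add: inverse_beta)
qed

lemma finite_box: "finite {x \<in> L. \<bar>x\<bar> \<le> C \<and> \<bar>gal x\<bar> \<le> C}"
proof -
  define V where "V = \<lceil>2 * C / \<kappa>\<rceil>"
  define U where "U = \<lceil>C + of_int V * \<beta>\<rceil>"
  have "{x \<in> L. \<bar>x\<bar> \<le> C \<and> \<bar>gal x\<bar> \<le> C}
     \<subseteq> (\<lambda>(u,v). of_int u + of_int v * \<beta>) ` ({-U..U} \<times> {-V..V})"
  proof clarify
    fix x assume x: "x \<in> L" "\<bar>x\<bar> \<le> C" "\<bar>gal x\<bar> \<le> C"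
    obtain u v where uv: "x = of_int u + of_int v * \<beta>" "x - gal x = of_int v * \<kappa>"
      using L_E[OF x(1)] by metis
    have "of_int \<bar>v\<bar> * \<kappa> = \<bar>x - gal x\<bar>" using uv(2) kappa_pos by (simp add: abs_mult)
    then have "of_int \<bar>v\<bar> * \<kappa> \<le> 2 * C" using x by linarith
    then have "of_int \<bar>v\<bar> \<le> 2 * C / \<kappa>" using kappa_pos by (simp add: field_simps)
    then have v: "\<bar>v\<bar> \<le> V" unfolding V_def by linarith
    have "\<bar>of_int v * \<beta>\<bar> \<le> of_int V * \<beta>"
      using v beta_gt_1 by (simp add: abs_mult flip: of_int_abs)
    moreover have "real_of_int u = x - of_int v * \<beta>" using uv by simp
    ultimately have "of_int \<bar>u\<bar> \<le> C + of_int V * \<beta>" using x by simp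
    then have "\<bar>u\<bar> \<le> U" unfolding U_def by linarith
    then show "x \<in> (\<lambda>(u,v). of_int u + of_int v * \<beta>) ` ({-U..U} \<times> {-V..V})"
      using v uv by (intro image_eqI[of _ _ "(u,v)"]) (auto simp: abs_le_iff)
  qed
  then show ?thesis by (rule finite_subset) simp
qed

end

section \<open>Counting lattice points in a strip\<close>

lemma card_int_Icc_bounds:
  fixes a b :: real
  assumes "a \<le> b"
  shows "finite {u :: int. a \<le> of_int u \<and> of_int u \<le> b}"
    and "b - a - 1 \<le> real (card {u :: int. a \<le> of_int u \<and> of_int u \<le> b})"
    and "real (card {u :: int. a \<le> of_int u \<and> of_int u \<le> b}) \<le> b - a + 1"
proof -
  have eq: "{u :: int. a \<le> of_int u \<and> of_int u \<le> b} = {\<lceil>a\<rceil>..\<lfloor>b\<rfloor>}"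
    by (auto simp: ceiling_le_iff le_floor_iff)
  have "\<lfloor>b\<rfloor> - \<lceil>a\<rceil> + 1 \<ge> 0" using assms by linarith
  then have "real (card {u :: int. a \<le> of_int u \<and> of_int u \<le> b}) = of_int \<lfloor>b\<rfloor> - of_int \<lceil>a\<rceil> + 1"
    by (simp add: eq)
  then show "b - a - 1 \<le> real (card {u :: int. a \<le> of_int u \<and> of_int u \<le> b})"
    "real (card {u :: int. a \<le> of_int u \<and> of_int u \<le> b}) \<le> b - a + 1" by linarith+
  show "finite {u :: int. a \<le> of_int u \<and> of_int u \<le> b}" by (simp add: eq)
qed

lemma card_int_Ioc_bounds:
  fixes a b k :: real
  assumes "k > 0"
  shows "finite {v :: int. a < of_int v * k \<and> of_int v * k \<le> b}"
    and "(b - a) / k - 1 \<le> real (card {v :: int. a < of_int v * k \<and> of_int v * k \<le> b})"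
    and "a \<le> b \<Longrightarrow> real (card {v :: int. a < of_int v * k \<and> of_int v * k \<le> b}) \<le> (b - a) / k + 1"
proof -
  have eq: "{v :: int. a < of_int v * k \<and> of_int v * k \<le> b} = {\<lfloor>a / k\<rfloor><..\<lfloor>b / k\<rfloor>}"
    using assms by (auto simp: le_floor_iff floor_less_iff field_simps)
  show "finite {v :: int. a < of_int v * k \<and> of_int v * k \<le> b}" by (simp add: eq)
  have c: "real (card {v :: int. a < of_int v * k \<and> of_int v * k \<le> b}) = real (nat (\<lfloor>b / k\<rfloor> - \<lfloor>a / k\<rfloor>))"
    by (simp add: eq)
  show "(b - a) / k - 1 \<le> real (card {v :: int. a < of_int v * k \<and> of_int v * k \<le> b})"
    unfolding c diff_divide_distrib by linarith
  assume "a \<le> b"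
  then have "a / k \<le> b / k" using assms by (simp add: divide_right_mono)
  then show "real (card {v :: int. a < of_int v * k \<and> of_int v * k \<le> b}) \<le> (b - a) / k + 1"
    unfolding c diff_divide_distrib by linarith
qed

context quadratic_unit begin

definition strip :: "real \<Rightarrow> real \<Rightarrow> real set" where
  "strip s t = {z \<in> L. s \<le> gal z \<and> gal z \<le> t}"

lemma finite_strip: "finite (strip s t \<inter> {a..b})"
proof (rule finite_subset[OF _ finite_box])
  show "strip s t \<inter> {a..b} \<subseteq>
      {x \<in> L. \<bar>x\<bar> \<le> \<bar>a\<bar> + \<bar>b\<bar> + \<bar>s\<bar> + \<bar>t\<bar> \<and> \<bar>gal x\<bar> \<le> \<bar>a\<bar> + \<bar>b\<bar> + \<bar>s\<bar> + \<bar>t\<bar>}"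
    unfolding strip_def by auto
qed

text \<open>For each v the number of admissible u is the number of integers in an interval of length t - s, hence
t - s up to an error 1; and as x' is bounded, x = x' + v\<kappa> confines v to an interval of length
R/\<kappa> up to a constant.\<close>

lemma card_strip_crude:
  assumes st: "s \<le> t"
  shows "\<exists>C. \<forall>R\<ge>0. \<bar>real (card (strip s t \<inter> {0<..R})) - (t - s) / \<kappa> * R\<bar> \<le> R / \<kappa> + C"
proof -
  define C where "C = (t - s + 1) * ((t - s) / \<kappa> + 1)"
  have C0: "C \<ge> 0" using st kappa_pos unfolding C_def by simp
  have "\<bar>real (card (strip s t \<inter> {0<..R})) - (t - s) / \<kappa> * R\<bar> \<le> R / \<kappa> + C" if R: "R \<ge> 0" for R
  proof -
    define f where "f = (\<lambda>(v :: int, u :: int). of_int u + of_int v * \<beta>)"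
    have inj: "inj_on f Z" for Z
      unfolding f_def inj_on_def by (auto dest: coords_unique)
    define U where "U v = {u :: int. s - of_int v * \<beta>' \<le> of_int u \<and> of_int u \<le> t - of_int v * \<beta>'}" for v :: int
    have U: "finite (U v)" "t - s - 1 \<le> real (card (U v))" "real (card (U v)) \<le> t - s + 1" for v
      using card_int_Icc_bounds[of "s - of_int v * \<beta>'" "t - of_int v * \<beta>'"] st
      unfolding U_def by auto
    \<comment> \<open>For \<open>v\<close> in \<open>Vin\<close> every admissible \<open>u\<close> gives a point of \<open>{0<..R}\<close>; only \<open>v\<close> in \<open>Vout\<close> give any.\<close>
    define Vin where "Vin = {v :: int. - s < of_int v * \<kappa> \<and> of_int v * \<kappa> \<le> R - t}"
    define Vout where "Vout = {v :: int. - t < of_int v * \<kappa> \<and> of_int v * \<kappa> \<le> R - s}"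
    have Vin: "finite Vin" "(R - t + s) / \<kappa> - 1 \<le> real (card Vin)"
      using card_int_Ioc_bounds[OF kappa_pos, where a = "-s" and b = "R - t"] unfolding Vin_def by auto
    have Vout: "finite Vout" "real (card Vout) \<le> (R - s + t) / \<kappa> + 1"
      using card_int_Ioc_bounds[OF kappa_pos, where a = "-t" and b = "R - s"] st R unfolding Vout_def by auto
    have fin: "finite (strip s t \<inter> {0<..R})"
      by (rule finite_subset[OF _ finite_strip[of s t 0 R]]) auto
    have upper: "strip s t \<inter> {0<..R} \<subseteq> f ` Sigma Vout U"
    proof
      fix z assume z: "z \<in> strip s t \<inter> {0<..R}"
      then have "z \<in> L" by (simp add: strip_def)
      then obtain u v where uv: "z = of_int u + of_int v * \<beta>" "gal z = of_int u + of_int v * \<beta>'"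
        "z - gal z = of_int v * \<kappa>" by (rule L_E)
      have "v \<in> Vout" "u \<in> U v" using z uv unfolding Vout_def U_def strip_def by auto
      then show "z \<in> f ` Sigma Vout U" using uv(1) unfolding f_def by (intro image_eqI[of _ _ "(v,u)"]) auto
    qed
    have lower: "f ` Sigma Vin U \<subseteq> strip s t \<inter> {0<..R}"
    proof clarify
      fix v u assume v: "v \<in> Vin" and u: "u \<in> U v"
      have g: "gal (f (v,u)) = of_int u + of_int v * \<beta>'" unfolding f_def by simp
      have "f (v,u) - gal (f (v,u)) = of_int v * \<kappa>"
        unfolding g by (simp add: f_def \<kappa>_def algebra_simps)
      then show "f (v,u) \<in> strip s t \<inter> {0<..R}"
        using v u L_I[of u v] unfolding Vin_def U_def strip_def g by (auto simp: g) (auto simp: f_def)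
    qed
    have "real (card (strip s t \<inter> {0<..R})) \<le> real (card (Sigma Vout U))"
      using card_mono[OF _ upper] Vout(1) U(1) by (simp add: card_image[OF inj] del: card_SigmaI)
    also have "\<dots> = (\<Sum>v\<in>Vout. real (card (U v)))" using Vout(1) U(1) by simp
    also have "\<dots> \<le> real (card Vout) * (t - s + 1)" using sum_bounded_above[of Vout "\<lambda>v. real (card (U v))"] U(3) by simp
    also have "\<dots> \<le> ((R - s + t) / \<kappa> + 1) * (t - s + 1)" using Vout(2) st by (intro mult_right_mono) auto
    also have "\<dots> = (t - s) / \<kappa> * R + R / \<kappa> + C" unfolding C_def using kappa_pos by (simp add: field_simps)
    finally have up: "real (card (strip s t \<inter> {0<..R})) \<le> (t - s) / \<kappa> * R + R / \<kappa> + C" .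
    have lo: "(t - s) / \<kappa> * R - R / \<kappa> - C \<le> real (card (strip s t \<inter> {0<..R}))"
    proof (cases "t - s \<le> 1")
      case True
      then have "(t - s) * (R / \<kappa>) \<le> 1 * (R / \<kappa>)" using R kappa_pos by (intro mult_right_mono) auto
      then show ?thesis using C0 by simp
    next
      case False
      have "(t - s) / \<kappa> * R - R / \<kappa> - C \<le> ((R - t + s) / \<kappa> - 1) * (t - s - 1)"
      proof -
        define q where "q = (t - s) / \<kappa> + 1"
        have "q \<ge> 0" using st kappa_pos unfolding q_def by simp
        have "(R - t + s) / \<kappa> - 1 = R / \<kappa> - q" unfolding q_def by (simp add: diff_divide_distrib add_divide_distrib)
        moreover have "(t - s) / \<kappa> * R - R / \<kappa> = (R / \<kappa>) * (t - s - 1)" using kappa_pos by (simp add: field_simps)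
        moreover have "C = (t - s + 1) * q" by (simp add: C_def q_def)
        moreover have "r * (w - 1) - (w + 1) * q \<le> (r - q) * (w - 1)" for r w :: real
          using \<open>q \<ge> 0\<close> by (simp add: algebra_simps)
        from this[of "R / \<kappa>" "t - s"]
        have "(R / \<kappa>) * (t - s - 1) - (t - s + 1) * q \<le> (R / \<kappa> - q) * (t - s - 1)" .
        ultimately show ?thesis by (simp only:)
      qed
      also have "\<dots> \<le> real (card Vin) * (t - s - 1)" using Vin(2) False by (intro mult_right_mono) auto
      also have "\<dots> \<le> (\<Sum>v\<in>Vin. real (card (U v)))" using sum_bounded_below[of Vin "t - s - 1" "\<lambda>v. real (card (U v))"] U(2) by simp
      also have "\<dots> = real (card (Sigma Vin U))" using Vin(1) U(1) by simp
      also have "\<dots> \<le> real (card (strip s t \<inter> {0<..R}))"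
        using card_mono[OF fin lower] by (simp add: card_image[OF inj] del: card_SigmaI)
      finally show ?thesis .
    qed
    show ?thesis using up lo by (simp add: abs_le_iff)
  qed
  then show ?thesis by blast
qed

text \<open>Multiplication by a unit permutes \<int>[\<beta>] and acts hyperbolically on the plane.  An even power is
used because its conjugate is positive whatever the norm.\<close>

lemma card_strip_scale:
  "card (strip s t \<inter> {0<..R}) =
   card (strip (\<beta> ^ (2 * k) * s) (\<beta> ^ (2 * k) * t) \<inter> {0<..R / \<beta> ^ (2 * k)})"
proof (rule bij_betw_same_card)
  let ?b = "\<beta> ^ (2 * k)"
  have pos: "?b > 0" using beta_gt_1 by simp
  have bb: "?b * \<beta>' ^ (2 * k) = 1"
  proof -
    have "\<bar>\<beta> * \<beta>'\<bar> = 1" using abs_beta' beta_gt_1 by (simp add: abs_mult)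
    then have "(\<beta> * \<beta>')\<^sup>2 = 1" by (metis one_power2 power2_abs)
    then show ?thesis by (simp add: power_mult power_mult_distrib flip: power_mult_distrib)
  qed
  have b'pos: "\<beta>' ^ (2 * k) > 0" using bb pos by (metis mult_zero_right zero_less_mult_pos zero_less_one)
  have down: "z / ?b \<in> L \<and> gal (z / ?b) = ?b * gal z" if "z \<in> L" for z
  proof -
    have b': "gal ((1 / \<beta>) ^ (2 * k)) = ?b"
    proof -
      have "gal ((1 / \<beta>) ^ (2 * k)) = (1 / \<beta>') ^ (2 * k)"
        by (simp only: gal_power[OF L_inverse_beta] gal_inverse_beta)
      also have "\<dots> = 1 / \<beta>' ^ (2 * k)" by (simp add: power_divide)
      also have "\<dots> = ?b" by (rule eq_divide_imp[OF less_imp_neq[OF b'pos, symmetric] bb, symmetric])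
      finally show ?thesis .
    qed
    have "z / ?b = (1 / \<beta>) ^ (2 * k) * z" by (simp add: power_divide)
    then show ?thesis
      using L_mult[OF L_power[OF L_inverse_beta] that] gal_mult[OF L_power[OF L_inverse_beta] that] b' by metis
  qed
  have up: "z * ?b \<in> L \<and> gal z = ?b * gal (z * ?b)" if "z \<in> L" for z
    using L_mult[OF that L_power[OF L_beta]] gal_mult[OF that L_power[OF L_beta]]
      gal_power[OF L_beta, of "2 * k"] bb by (simp add: gal_beta)
  show "bij_betw (\<lambda>z. z / ?b) (strip s t \<inter> {0<..R}) (strip (?b * s) (?b * t) \<inter> {0<..R / ?b})"
  proof (rule bij_betw_byWitness[where f' = "\<lambda>z. z * ?b"])
    show "(\<lambda>z. z / ?b) ` (strip s t \<inter> {0<..R}) \<subseteq> strip (?b * s) (?b * t) \<inter> {0<..R / ?b}"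
      using pos down by (auto simp: strip_def divide_right_mono)
    show "(\<lambda>z. z * ?b) ` (strip (?b * s) (?b * t) \<inter> {0<..R / ?b}) \<subseteq> strip s t \<inter> {0<..R}"
    proof clarify
      fix z assume z: "z \<in> strip (?b * s) (?b * t)" "z \<in> {0<..R / ?b}"
      then have "z \<in> L" by (simp add: strip_def)
      then have "z * ?b \<in> L" "gal z = ?b * gal (z * ?b)" using up by auto
      moreover have "?b * s \<le> gal z" "gal z \<le> ?b * t" using z by (auto simp: strip_def)
      ultimately show "z * ?b \<in> strip s t \<inter> {0<..R}"
        using z pos by (simp add: strip_def field_simps)
    qed
  qed (use beta_gt_1 in auto)
qed

text \<open>The error R/\<kappa> of the crude count shrinks to R/(\<beta>^(2k)\<kappa>) when the strip is first widened by
the factor \<beta>^(2k) and thereby shortened by the same factor.\<close>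

lemma card_strip:
  assumes st: "s \<le> t" and "\<delta> > 0"
  shows "\<exists>C. \<forall>R\<ge>0. \<bar>real (card (strip s t \<inter> {0<..R})) - (t - s) / \<kappa> * R\<bar> \<le> \<delta> * R + C"
proof -
  from \<open>\<delta> > 0\<close> have dk: "\<delta> * \<kappa> > 0" using kappa_pos by simp
  have "1 / \<beta> < 1" using beta_gt_1 by simp
  then obtain k where k: "(1 / \<beta>) ^ k < \<delta> * \<kappa>" using real_arch_pow_inv[OF dk] by blast
  let ?b = "\<beta> ^ (2 * k)"
  have pos: "?b > 0" using beta_gt_1 by simp
  have "(1 / \<beta>) ^ (2 * k) \<le> (1 / \<beta>) ^ k" using beta_gt_1 by (intro power_decreasing) auto
  then have "1 / ?b \<le> \<delta> * \<kappa>" using k by (simp add: power_divide)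
  then have small: "1 / ?b / \<kappa> \<le> \<delta>" using pos_divide_le_eq[OF kappa_pos] by blast
  have "?b * s \<le> ?b * t" using st pos by simp
  then obtain C where C: "\<And>R. R \<ge> 0 \<Longrightarrow>
      \<bar>real (card (strip (?b * s) (?b * t) \<inter> {0<..R})) - (?b * t - ?b * s) / \<kappa> * R\<bar> \<le> R / \<kappa> + C"
    using card_strip_crude by blast
  show "\<exists>C. \<forall>R\<ge>0. \<bar>real (card (strip s t \<inter> {0<..R})) - (t - s) / \<kappa> * R\<bar> \<le> \<delta> * R + C"
  proof (intro exI allI impI)
    fix R :: real assume R: "R \<ge> 0"
    have "(?b * t - ?b * s) / \<kappa> * (R / ?b) = (t - s) / \<kappa> * R"
      using beta_gt_1 by (simp flip: right_diff_distrib)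
    then have "\<bar>real (card (strip s t \<inter> {0<..R})) - (t - s) / \<kappa> * R\<bar> \<le> R / ?b / \<kappa> + C"
      using C[of "R / ?b"] R pos by (simp add: card_strip_scale[of s t R k])
    also have "R / ?b / \<kappa> = (1 / ?b / \<kappa>) * R" by simp
    also have "(1 / ?b / \<kappa>) * R + C \<le> \<delta> * R + C" using small R by (intro add_right_mono mult_right_mono)
    finally show "\<bar>real (card (strip s t \<inter> {0<..R})) - (t - s) / \<kappa> * R\<bar> \<le> \<delta> * R + C" .
  qed
qed

end

section \<open>Digit expansions, windows and attractors\<close>

lemma spectrum_of_digit: assumes "a \<in> A" shows "of_int a \<in> spectrum A \<alpha>"
  unfolding spectrum_def using assms by (intro CollectI exI[of _ 0] exI[of _ "\<lambda>_. a"]) auto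

lemma spectrum_shift:
  assumes "a \<in> A" "y \<in> spectrum A \<alpha>"
  shows "of_int a + \<alpha> * y \<in> spectrum A \<alpha>"
proof -
  obtain n b where y: "y = (\<Sum>j\<le>n. of_int (b j) * \<alpha> ^ j)" and b: "\<forall>j\<le>n. b j \<in> A"
    using assms(2) unfolding spectrum_def by blast
  define b' where "b' j = (case j of 0 \<Rightarrow> a | Suc i \<Rightarrow> b i)" for j
  have "of_int a + \<alpha> * y = (\<Sum>j\<le>Suc n. of_int (b' j) * \<alpha> ^ j)"
    by (simp add: sum.atMost_Suc_shift b'_def y sum_distrib_left mult_ac del: sum.atMost_Suc)
  moreover have "\<forall>j\<le>Suc n. b' j \<in> A" using b assms(1) by (auto simp: b'_def split: nat.split)
  ultimately show ?thesis unfolding spectrum_def by blast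
qed

text \<open>Induction that reads an expansion from its highest digit down, so that the spectrum is
the least set that contains the digits and is closed under y \<mapsto> a + \<alpha> y.\<close>

lemma spectrum_induct [consumes 1, case_names digit shift]:
  assumes "x \<in> spectrum A \<alpha>"
    and digit: "\<And>a. a \<in> A \<Longrightarrow> P (of_int a)"
    and shift: "\<And>a y. a \<in> A \<Longrightarrow> P y \<Longrightarrow> P (of_int a + \<alpha> * y)"
  shows "P x"
proof -
  have "P (\<Sum>j\<le>n. of_int (b j) * \<alpha> ^ j)" if "\<forall>j\<le>n. b j \<in> A" for n b
    using that
  proof (induction n arbitrary: b)
    case 0
    then show ?case using digit by simp
  next
    case (Suc n)
    have "P (\<Sum>j\<le>n. of_int (b (Suc j)) * \<alpha> ^ j)" by (rule Suc.IH) (use Suc.prems in auto)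
    then have "P (of_int (b 0) + \<alpha> * (\<Sum>j\<le>n. of_int (b (Suc j)) * \<alpha> ^ j))"
      using shift Suc.prems by blast
    then show ?case
      by (simp add: sum.atMost_Suc_shift sum_distrib_left mult_ac del: sum.atMost_Suc)
  qed
  then show ?thesis using assms(1) unfolding spectrum_def by blast
qed

lemma spectrum_mono: "A \<subseteq> B \<Longrightarrow> spectrum A \<alpha> \<subseteq> spectrum B \<alpha>"
  unfolding spectrum_def by blast

lemma spectrum_uminus: "spectrum (uminus ` A) \<alpha> = uminus ` spectrum A \<alpha>"
proof -
  have sub: "uminus ` spectrum B \<alpha> \<subseteq> spectrum (uminus ` B) \<alpha>" for B
  proof clarify
    fix x assume "x \<in> spectrum B \<alpha>"
    then show "- x \<in> spectrum (uminus ` B) \<alpha>"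
    proof (induction rule: spectrum_induct)
      case (digit a)
      then show ?case using spectrum_of_digit[of "-a" "uminus ` B"] by simp
    next
      case (shift a y)
      then show ?case using spectrum_shift[of "-a" "uminus ` B" "-y"] by simp
    qed
  qed
  have "spectrum (uminus ` A) \<alpha> \<subseteq> uminus ` spectrum A \<alpha>"
  proof
    fix x assume "x \<in> spectrum (uminus ` A) \<alpha>"
    then have "- x \<in> spectrum A \<alpha>" using sub[of "uminus ` A"] by (auto simp: image_image)
    then show "x \<in> uminus ` spectrum A \<alpha>" by (intro image_eqI[of _ _ "- x"]) auto
  qed
  then show ?thesis using sub[of A] by blast
qed

text \<open>Intervals of length w placed at the integers of {m,...,M} cover without gaps once w > 1 (open) or
w \<ge> 1 (closed).\<close>

lemma exists_digit_open:
  fixes t e w :: real and m M :: int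
  assumes "m \<le> M" "w > 1" "of_int m + e < t" "t < of_int M + e + w"
  shows "\<exists>a\<in>{m..M}. e < t - of_int a \<and> t - of_int a < e + w"
proof (rule bexI[of _ "max m (\<lfloor>t - e - w\<rfloor> + 1)"])
  show "e < t - of_int (max m (\<lfloor>t - e - w\<rfloor> + 1)) \<and> t - of_int (max m (\<lfloor>t - e - w\<rfloor> + 1)) < e + w"
    using assms unfolding max_def by (auto; linarith)
  have "\<lfloor>t - e - w\<rfloor> < M" using assms by (simp add: floor_less_iff)
  then show "max m (\<lfloor>t - e - w\<rfloor> + 1) \<in> {m..M}" using assms by simp
qed

lemma exists_digit_closed:
  fixes t e w :: real and m M :: int
  assumes "m \<le> M" "w \<ge> 1" "of_int m + e \<le> t" "t \<le> of_int M + e + w"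
  shows "\<exists>a\<in>{m..M}. e \<le> t - of_int a \<and> t - of_int a \<le> e + w"
proof (rule bexI[of _ "max m \<lceil>t - e - w\<rceil>"])
  show "e \<le> t - of_int (max m \<lceil>t - e - w\<rceil>) \<and> t - of_int (max m \<lceil>t - e - w\<rceil>) \<le> e + w"
    using assms unfolding max_def by (auto; linarith)
  have "\<lceil>t - e - w\<rceil> \<le> M" using assms by (simp add: ceiling_le_iff)
  then show "max m \<lceil>t - e - w\<rceil> \<in> {m..M}" using assms by simp
qed

context quadratic_unit begin

lemma
  assumes "\<alpha> \<in> {\<beta>, -\<beta>}"
  shows L_base: "\<alpha> \<in> L" and abs_gal_base: "gal \<alpha> \<in> {1 / \<beta>, - 1 / \<beta>}"
proof -
  show "\<alpha> \<in> L" using assms L_beta L_uminus by auto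
  have "gal \<alpha> \<in> {\<beta>', - \<beta>'}" using assms gal_beta gal_uminus[OF L_beta] by auto
  then show "gal \<alpha> \<in> {1 / \<beta>, - 1 / \<beta>}" using beta'_eq cases_e by auto
qed

lemma
  assumes "\<alpha> \<in> {\<beta>, -\<beta>}" "x \<in> L"
  shows L_unshift: "(x - of_int a) / \<alpha> \<in> L"
    and gal_unshift: "gal ((x - of_int a) / \<alpha>) = (gal x - of_int a) / gal \<alpha>"
proof -
  have inv: "1 / \<alpha> \<in> L \<and> gal (1 / \<alpha>) = 1 / gal \<alpha>"
    using assms(1) L_inverse_beta gal_inverse_beta L_uminus[OF L_inverse_beta]
      gal_uminus[OF L_inverse_beta] gal_beta gal_uminus[OF L_beta] by auto
  have eq: "(x - of_int a) / \<alpha> = (x - of_int a) * (1 / \<alpha>)" by simp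
  have x: "x - of_int a \<in> L" "gal (x - of_int a) = gal x - of_int a"
    using L_diff[OF assms(2) L_of_int] gal_diff[OF assms(2) L_of_int] gal_of_int by auto
  show "(x - of_int a) / \<alpha> \<in> L" unfolding eq using L_mult x inv by blast
  show "gal ((x - of_int a) / \<alpha>) = (gal x - of_int a) / gal \<alpha>"
    using gal_mult[OF x(1), of "1 / \<alpha>"] x(2) inv by simp
qed

lemma spectrum_subset_L:
  assumes "\<alpha> \<in> {\<beta>, -\<beta>}"
  shows "spectrum A \<alpha> \<subseteq> L"
proof
  fix x assume "x \<in> spectrum A \<alpha>"
  then show "x \<in> L"
    by (induction rule: spectrum_induct) (auto intro: L_of_int L_add L_mult L_base[OF assms])
qed

text \<open>In a nonempty set with bounded conjugates the distance to [c,d] attains its minimum, by discreteness;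
a step that divides the distance by \<beta> forces the minimum to be 0.\<close>

lemma descent_to_attractor:
  assumes "x\<^sub>0 \<in> B" "B \<subseteq> L" "\<And>x. x \<in> B \<Longrightarrow> \<bar>gal x\<bar> \<le> K"
    and step: "\<And>x. x \<in> B \<Longrightarrow> \<exists>y\<in>B. defect y \<le> defect x / \<beta>"
    and defect: "\<And>z. defect z = max 0 (max (c - z) (z - d))"
  shows "\<exists>x\<in>B. c \<le> x \<and> x \<le> d"
proof -
  define S where "S = {z \<in> B. defect z \<le> defect x\<^sub>0}"
  have "S \<subseteq> {x \<in> L. \<bar>x\<bar> \<le> \<bar>c\<bar> + \<bar>d\<bar> + defect x\<^sub>0 + \<bar>K\<bar> \<and> \<bar>gal x\<bar> \<le> \<bar>c\<bar> + \<bar>d\<bar> + defect x\<^sub>0 + \<bar>K\<bar>}"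
  proof
    fix z assume z: "z \<in> S"
    then have "z \<in> L" "\<bar>gal z\<bar> \<le> K" "defect z \<le> defect x\<^sub>0" using assms(2,3) by (auto simp: S_def)
    moreover have "defect x\<^sub>0 \<ge> 0" "c - z \<le> defect z" "z - d \<le> defect z" by (auto simp: defect)
    ultimately show "z \<in> {x \<in> L. \<bar>x\<bar> \<le> \<bar>c\<bar> + \<bar>d\<bar> + defect x\<^sub>0 + \<bar>K\<bar> \<and> \<bar>gal x\<bar> \<le> \<bar>c\<bar> + \<bar>d\<bar> + defect x\<^sub>0 + \<bar>K\<bar>}"
      by auto
  qed
  then have "finite S" by (rule finite_subset) (rule finite_box)
  moreover have "S \<noteq> {}" using assms(1) by (auto simp: S_def)
  ultimately have "arg_min_on defect S \<in> S" "\<not> (\<exists>y\<in>S. defect y < defect (arg_min_on defect S))"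
    by (auto intro: arg_min_if_finite dest: arg_min_if_finite(2))
  then obtain z where z: "z \<in> S" "\<And>y. y \<in> S \<Longrightarrow> defect z \<le> defect y"
    by (meson linorder_not_less)
  obtain y where y: "y \<in> B" "defect y \<le> defect z / \<beta>" using step z(1) by (auto simp: S_def)
  have nn: "defect z \<ge> 0" by (simp add: defect)
  then have "defect z / \<beta> \<le> defect z" using beta_gt_1 mult_right_mono[of 1 \<beta> "defect z"]
    by (simp add: pos_divide_le_eq mult.commute)
  then have "y \<in> S" using y z(1) by (auto simp: S_def)
  then have "defect z \<le> defect z / \<beta>" using z(2)[of y] y(2) by linarith
  then have "defect z * \<beta> \<le> defect z" using beta_gt_1 by (simp add: field_simps)
  then have "defect z * (\<beta> - 1) \<le> 0" by (simp add: algebra_simps)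
  then have "defect z \<le> 0" using beta_gt_1 nn by (simp add: mult_le_0_iff)
  then have "c \<le> z \<and> z \<le> d" by (simp add: defect)
  then show ?thesis using z(1) by (auto simp: S_def)
qed

text \<open>The interval [c,d] is the convex hull of the attractor of the maps x \<mapsto> (x - a)/\<alpha> with a \<in> {m,...,M}, and
[s,t] that of the maps y \<mapsto> a + \<alpha>' y, the closed window.  They are given by the equations of their end
points, which maps of negative slope exchange.\<close>

definition is_attractor :: "real \<Rightarrow> int \<Rightarrow> int \<Rightarrow> real \<Rightarrow> real \<Rightarrow> bool" where
  "is_attractor \<alpha> m M c d \<longleftrightarrow>
     (\<alpha> = \<beta> \<and> d * \<beta> = d - of_int m \<and> c * \<beta> = c - of_int M) \<or>
     (\<alpha> = -\<beta> \<and> d * \<beta> = of_int M - c \<and> c * \<beta> = of_int m - d)"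

definition is_window :: "real \<Rightarrow> int \<Rightarrow> int \<Rightarrow> real \<Rightarrow> real \<Rightarrow> bool" where
  "is_window \<alpha> m M s t \<longleftrightarrow>
     (gal \<alpha> = 1 / \<beta> \<and> s = of_int m + s / \<beta> \<and> t = of_int M + t / \<beta>) \<or>
     (gal \<alpha> = - 1 / \<beta> \<and> s = of_int m - t / \<beta> \<and> t = of_int M - s / \<beta>)"

lemma beta_sq_gt_1: "\<beta> * \<beta> > 1"
  using beta_gt_1 less_1_mult[of \<beta> \<beta>] by simp

lemma attractor_exists:
  assumes "\<alpha> \<in> {\<beta>, -\<beta>}"
  shows "\<exists>c d. is_attractor \<alpha> m M c d"
proof (cases "\<alpha> = \<beta>")
  case True
  define c where "c = - of_int M / (\<beta> - 1)"
  define d where "d = - of_int m / (\<beta> - 1)"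
  have "c * (\<beta> - 1) = - of_int M" "d * (\<beta> - 1) = - of_int m" using beta_gt_1 by (simp_all add: c_def d_def)
  then have "d * \<beta> = d - of_int m" "c * \<beta> = c - of_int M" by (simp_all add: algebra_simps)
  then show ?thesis using True unfolding is_attractor_def by blast
next
  case False
  define c where "c = (of_int m * \<beta> - of_int M) / (\<beta> * \<beta> - 1)"
  define d where "d = (of_int M * \<beta> - of_int m) / (\<beta> * \<beta> - 1)"
  define Q where "Q = \<beta> * \<beta> - 1"
  have q: "Q \<noteq> 0" using beta_sq_gt_1 by (simp add: Q_def)
  have cd: "c * Q = of_int m * \<beta> - of_int M" "d * Q = of_int M * \<beta> - of_int m"
    using q by (simp_all add: c_def d_def flip: Q_def)
  have "(d * \<beta> - (of_int M - c)) * Q = (d * Q) * \<beta> - of_int M * Q + c * Q" by (simp add: algebra_simps)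
  also have "\<dots> = 0" unfolding cd by (simp add: Q_def algebra_simps)
  finally have "d * \<beta> = of_int M - c" using q by simp
  moreover have "(c * \<beta> - (of_int m - d)) * Q = (c * Q) * \<beta> - of_int m * Q + d * Q" by (simp add: algebra_simps)
  then have "(c * \<beta> - (of_int m - d)) * Q = 0" unfolding cd by (simp add: Q_def algebra_simps)
  then have "c * \<beta> = of_int m - d" using q by simp
  ultimately have "d * \<beta> = of_int M - c" "c * \<beta> = of_int m - d" by auto
  then show ?thesis using False assms unfolding is_attractor_def by blast
qed

text \<open>The equations of the window are those of the attractor for the base 1/\<alpha>', up to a factor.\<close>

lemma window_exists:
  assumes "\<alpha> \<in> {\<beta>, -\<beta>}"
  shows "\<exists>s t. is_window \<alpha> m M s t"
proof -
  have b: "\<beta> \<noteq> 0" using beta_gt_1 by simp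
  show ?thesis
  proof (cases "gal \<alpha> = 1 / \<beta>")
    case True
    have "\<exists>c d. is_attractor \<beta> m M c d" by (rule attractor_exists) simp
    then obtain c d where cd: "is_attractor \<beta> m M c d" by blast
    have "d * \<beta> = d - of_int m" "c * \<beta> = c - of_int M" using cd beta_gt_1 unfolding is_attractor_def by auto
    then have "- (d * \<beta>) = of_int m + - (d * \<beta>) / \<beta>" "- (c * \<beta>) = of_int M + - (c * \<beta>) / \<beta>"
      using nonzero_mult_div_cancel_right[OF b, of "- d"] nonzero_mult_div_cancel_right[OF b, of "- c"] by simp_all
    then show ?thesis using True unfolding is_window_def by blast
  next
    case False
    then have g: "gal \<alpha> = - 1 / \<beta>" using abs_gal_base[OF assms] by auto
    have "\<exists>c d. is_attractor (-\<beta>) m M c d" by (rule attractor_exists) simp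
    then obtain c d where cd: "is_attractor (-\<beta>) m M c d" by blast
    have "d * \<beta> = of_int M - c" "c * \<beta> = of_int m - d" using cd beta_gt_1 unfolding is_attractor_def by auto
    then have "c * \<beta> = of_int m - (d * \<beta>) / \<beta>" "d * \<beta> = of_int M - (c * \<beta>) / \<beta>"
      using nonzero_mult_div_cancel_right[OF b, of d] nonzero_mult_div_cancel_right[OF b, of c] by simp_all
    then show ?thesis using g unfolding is_window_def by blast
  qed
qed

lemma window_length:
  assumes "is_window \<alpha> m M s t"
  shows "(t - s) * (\<beta> - 1) = of_int (M - m) * \<beta>"
proof -
  have "t - s = of_int (M - m) + (t - s) / \<beta>"
    using assms unfolding is_window_def diff_divide_distrib of_int_diff by linarith
  then have "(t - s) * \<beta> = (of_int (M - m) + (t - s) / \<beta>) * \<beta>" by simp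
  also have "\<dots> = of_int (M - m) * \<beta> + (t - s)" using beta_gt_1 by (simp add: distrib_right)
  finally show ?thesis by (simp add: algebra_simps)
qed

lemma gal_spectrum_in_window:
  assumes \<alpha>: "\<alpha> \<in> {\<beta>, -\<beta>}" and win: "is_window \<alpha> m M s t" and zero: "0 \<in> {m..M}"
    and x: "x \<in> spectrum {m..M} \<alpha>"
  shows "s \<le> gal x \<and> gal x \<le> t"
proof -
  have len: "s \<le> t"
  proof -
    have "(t - s) * (\<beta> - 1) \<ge> 0" using window_length[OF win] zero beta_gt_1 by simp
    then show ?thesis using beta_gt_1 by (simp add: zero_le_mult_iff)
  qed
  have st: "s \<le> 0 \<and> 0 \<le> t"
  proof (cases "gal \<alpha> = 1 / \<beta>")
    case True
    then have "s * (\<beta> - 1) = of_int m * \<beta>" "t * (\<beta> - 1) = of_int M * \<beta>"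
      using win beta_gt_1 unfolding is_window_def by (auto simp: field_simps)
    moreover have "of_int m * \<beta> \<le> 0" "of_int M * \<beta> \<ge> 0" using zero beta_gt_1 by (auto simp: mult_nonpos_nonneg)
    ultimately have "s * (\<beta> - 1) \<le> 0 * (\<beta> - 1)" "0 * (\<beta> - 1) \<le> t * (\<beta> - 1)" by linarith+
    moreover have "0 < \<beta> - 1" using beta_gt_1 by simp
    ultimately show ?thesis using mult_right_le_imp_le by blast
  next
    case False
    then have e: "s = of_int m - t / \<beta>" "t = of_int M - s / \<beta>"
      using win unfolding is_window_def by blast+
    have mM: "of_int m \<le> (0::real)" "of_int M \<ge> (0::real)" using zero by auto
    show ?thesis
    proof (cases "t \<ge> 0")
      case True
      then have "t / \<beta> \<ge> 0" using beta_gt_1 by simp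
      then show ?thesis using True e mM by linarith
    next
      case False
      then have "s < 0" using len by simp
      then have "s / \<beta> < 0" using beta_gt_1 by (simp add: divide_neg_pos)
      then show ?thesis using False e mM by linarith
    qed
  qed
  have digit_step: "s \<le> of_int a + gal \<alpha> * y \<and> of_int a + gal \<alpha> * y \<le> t"
    if "a \<in> {m..M}" "s \<le> y \<and> y \<le> t" for a y
  proof -
    have "s / \<beta> \<le> y / \<beta>" "y / \<beta> \<le> t / \<beta>" using that beta_gt_1 by (simp_all add: divide_right_mono)
    moreover have "of_int m \<le> real_of_int a" "real_of_int a \<le> of_int M" using that by auto
    moreover have "gal \<alpha> * y = y / \<beta> \<and> s = of_int m + s / \<beta> \<and> t = of_int M + t / \<beta> \<or>
        gal \<alpha> * y = - (y / \<beta>) \<and> s = of_int m - t / \<beta> \<and> t = of_int M - s / \<beta>"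
    proof -
      have "gal \<alpha> * y = y / \<beta>" if "gal \<alpha> = 1 / \<beta>" using that by simp
      moreover have "gal \<alpha> * y = - (y / \<beta>)" if "gal \<alpha> = - 1 / \<beta>" using that by simp
      ultimately show ?thesis using win unfolding is_window_def by blast
    qed
    ultimately show ?thesis by linarith
  qed
  have "x \<in> L \<and> s \<le> gal x \<and> gal x \<le> t" using x
  proof (induction rule: spectrum_induct)
    case (digit a)
    then show ?case using digit_step[of a 0] st by (simp add: L_of_int gal_of_int)
  next
    case (shift a y)
    then have "gal (of_int a + \<alpha> * y) = of_int a + gal \<alpha> * gal y"
      using L_base[OF \<alpha>] by (simp add: gal_add gal_mult gal_of_int L_of_int L_mult)
    moreover have "s \<le> of_int a + gal \<alpha> * gal y \<and> of_int a + gal \<alpha> * gal y \<le> t"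
      using shift by (intro digit_step) auto
    ultimately show ?case using shift L_base[OF \<alpha>] by (simp add: L_add L_mult L_of_int)
  qed
  then show ?thesis by simp
qed

lemma window_digit:
  assumes "is_window \<alpha> m M s t" "m \<le> M" "t - s > \<beta>" "s < y" "y < t"
  shows "\<exists>a\<in>{m..M}. s < (y - of_int a) / gal \<alpha> \<and> (y - of_int a) / gal \<alpha> < t"
proof (cases "gal \<alpha> = 1 / \<beta>")
  case True
  have "(t - s) / \<beta> > 1" using assms beta_gt_1 by simp
  moreover have "s = of_int m + s / \<beta>" "t = of_int M + t / \<beta>"
    using assms(1) True beta_gt_1 unfolding is_window_def by auto
  then have "of_int m + s / \<beta> < y" "y < of_int M + s / \<beta> + (t - s) / \<beta>"
    using assms(4,5) unfolding diff_divide_distrib by linarith+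
  ultimately obtain a where "a \<in> {m..M}" "s / \<beta> < y - of_int a" "y - of_int a < s / \<beta> + (t - s) / \<beta>"
    using exists_digit_open[OF assms(2)] by blast
  then have "a \<in> {m..M}" "s < (y - of_int a) * \<beta>" "(y - of_int a) * \<beta> < t"
    using beta_gt_1 by (simp_all add: diff_divide_distrib pos_divide_less_eq pos_less_divide_eq)
  moreover have "z / gal \<alpha> = z * \<beta>" for z using True by simp
  ultimately show ?thesis by auto
next
  case False
  then have g: "gal \<alpha> = - (1 / \<beta>)" and st: "s = of_int m - t / \<beta>" "t = of_int M - s / \<beta>"
    using assms(1) unfolding is_window_def minus_divide_left by blast+
  have "(t - s) / \<beta> > 1" using assms beta_gt_1 by simp
  moreover have "of_int m + - t / \<beta> < y" "y < of_int M + - t / \<beta> + (t - s) / \<beta>"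
    using st assms(4,5) unfolding diff_divide_distrib minus_divide_left[symmetric] by linarith+
  ultimately obtain a where "a \<in> {m..M}" "- t / \<beta> < y - of_int a" "y - of_int a < - t / \<beta> + (t - s) / \<beta>"
    using exists_digit_open[OF assms(2)] by blast
  then have "a \<in> {m..M}" "- t / \<beta> < y - of_int a" "y - of_int a < - s / \<beta>"
    by (simp_all add: diff_divide_distrib)
  moreover have "\<beta> > 0" using beta_gt_1 by simp
  ultimately have "a \<in> {m..M}" "- t < (y - of_int a) * \<beta>" "(y - of_int a) * \<beta> < - s"
    by (simp_all only: pos_divide_less_eq pos_less_divide_eq)
  moreover have "z / gal \<alpha> = - (z * \<beta>)" for z using g by simp
  ultimately show ?thesis by (intro bexI[of _ a]) auto
qed

lemma attractor_contracts:
  assumes "is_attractor \<alpha> m M c d" "a \<in> {m..M}" and defect: "\<And>z. defect z = max 0 (max (c - z) (z - d))"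
  shows "defect ((x - of_int a) / \<alpha>) \<le> defect x / \<beta>"
proof -
  have a: "of_int m \<le> real_of_int a" "real_of_int a \<le> of_int M" using assms by auto
  have d: "0 \<le> defect x" "c - x \<le> defect x" "x - d \<le> defect x" by (auto simp: defect)
  define y where "y = (x - of_int a) / \<alpha>"
  have "0 \<le> defect x / \<beta>" using d beta_gt_1 by simp
  moreover have "(c - y) * \<beta> \<le> defect x \<and> (y - d) * \<beta> \<le> defect x"
    using assms(1) unfolding is_attractor_def
  proof (elim disjE conjE)
    assume h: "\<alpha> = \<beta>" "d * \<beta> = d - of_int m" "c * \<beta> = c - of_int M"
    then have "y * \<beta> = x - of_int a" using beta_gt_1 by (simp add: y_def)
    then show ?thesis using h a d by (simp add: left_diff_distrib)
  next
    assume h: "\<alpha> = -\<beta>" "d * \<beta> = of_int M - c" "c * \<beta> = of_int m - d"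
    then have "y * \<beta> = of_int a - x" using beta_gt_1 by (simp add: y_def)
    then show ?thesis using h a d by (simp add: left_diff_distrib)
  qed
  then have "c - y \<le> defect x / \<beta>" "y - d \<le> defect x / \<beta>" using beta_gt_1 by (simp_all add: pos_le_divide_eq)
  ultimately have "defect y \<le> defect x / \<beta>" unfolding defect[of y] by simp
  then show ?thesis by (simp add: y_def)
qed

text \<open>The principle behind all expansions.  H is a region in which some digit can always be split off without leaving it.
Points of H outside the spectrum would then lead to such points inside the attractor.\<close>

lemma in_spectrum_by_descent:
  assumes \<alpha>: "\<alpha> \<in> {\<beta>, -\<beta>}" and attr: "is_attractor \<alpha> m M c d"
    and bounded: "\<And>z. z \<in> L \<Longrightarrow> H z \<Longrightarrow> \<bar>gal z\<bar> \<le> K"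
    and step: "\<And>z. z \<in> L \<Longrightarrow> H z \<Longrightarrow> \<exists>a\<in>{m..M}. H ((z - of_int a) / \<alpha>)"
    and attractor: "\<And>z. z \<in> L \<Longrightarrow> H z \<Longrightarrow> c \<le> z \<Longrightarrow> z \<le> d \<Longrightarrow> z \<in> spectrum {m..M} \<alpha>"
    and x: "x \<in> L" "H x"
  shows "x \<in> spectrum {m..M} \<alpha>"
proof (rule ccontr)
  assume "x \<notin> spectrum {m..M} \<alpha>"
  define B where "B = {z \<in> L. H z \<and> z \<notin> spectrum {m..M} \<alpha>}"
  define defect where "defect z = max 0 (max (c - z) (z - d))" for z
  have "\<exists>z\<in>B. c \<le> z \<and> z \<le> d"
  proof (rule descent_to_attractor[where defect = defect and K = K])
    fix z assume z: "z \<in> B"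
    then have "z \<in> L" "H z" by (auto simp: B_def)
    from step[OF this] obtain a where a: "a \<in> {m..M}" "H ((z - of_int a) / \<alpha>)" by blast
    let ?y = "(z - of_int a) / \<alpha>"
    have "of_int a + \<alpha> * ?y = z" using \<alpha> beta_gt_1 by auto
    then have "?y \<notin> spectrum {m..M} \<alpha>" using spectrum_shift[OF a(1), of ?y \<alpha>] z by (auto simp: B_def)
    then have "?y \<in> B" using z a L_unshift[OF \<alpha>] by (auto simp: B_def)
    then show "\<exists>y\<in>B. defect y \<le> defect z / \<beta>"
      using attractor_contracts[OF attr a(1) defect_def] by blast
  qed (use \<open>x \<notin> _\<close> x bounded in \<open>auto simp: B_def defect_def\<close>)
  then show False using attractor by (auto simp: B_def)
qed

end

section \<open>Lattice points in the product of attractor and window\<close>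

context quadratic_unit begin

lemma beta_bounds_norm_one: assumes "e = -1" shows "\<beta> > 2" "of_int p - 1 < \<beta>" "\<beta> < of_int p"
proof -
  have "\<beta>' = 1 / \<beta>" using beta'_eq assms by simp
  then have "0 < \<beta>'" "\<beta>' < 1" using beta_gt_1 by auto
  then show "of_int p - 1 < \<beta>" "\<beta> < of_int p" using trace by linarith+
  moreover have "p \<ge> 3" using cases_e assms by auto
  ultimately show "\<beta> > 2" by linarith
qed

lemma beta_bounds_norm_minus_one: assumes "e = 1" shows "of_int p < \<beta>" "\<beta> < of_int p + 1"
proof -
  have "\<beta>' = - (1 / \<beta>)" using beta'_eq assms by simp
  then have "\<beta>' < 0" "- 1 < \<beta>'" using beta_gt_1 by auto
  then show "of_int p < \<beta>" "\<beta> < of_int p + 1" using trace by linarith+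
qed

lemma gal_base_eq: "gal \<beta> = - of_int e / \<beta>" "gal (- \<beta>) = of_int e / \<beta>"
  using gal_beta gal_uminus[OF L_beta] beta'_eq by simp_all

lemma window_pos_conjugate:
  assumes "is_window \<alpha> m M s t" "gal \<alpha> = 1 / \<beta>"
  shows "s * (\<beta> - 1) = of_int m * \<beta>" "t * (\<beta> - 1) = of_int M * \<beta>"
proof -
  have "gal \<alpha> \<noteq> - 1 / \<beta>" using assms(2) beta_gt_1 by simp
  then have st: "s = of_int m + s / \<beta>" "t = of_int M + t / \<beta>" using assms unfolding is_window_def by blast+
  have "s * \<beta> = (of_int m + s / \<beta>) * \<beta>" "t * \<beta> = (of_int M + t / \<beta>) * \<beta>" using st by simp_all
  moreover have "s / \<beta> * \<beta> = s" "t / \<beta> * \<beta> = t" using beta_gt_1 by simp_all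
  ultimately show "s * (\<beta> - 1) = of_int m * \<beta>" "t * (\<beta> - 1) = of_int M * \<beta>"
    unfolding distrib_right right_diff_distrib by linarith+
qed

lemma window_neg_conjugate:
  assumes "is_window \<alpha> m M s t" "gal \<alpha> = - 1 / \<beta>"
  shows "s * \<beta> = of_int m * \<beta> - t" "t * \<beta> = of_int M * \<beta> - s"
proof -
  have "gal \<alpha> \<noteq> 1 / \<beta>" using assms(2) beta_gt_1 by simp
  then have st: "s = of_int m - t / \<beta>" "t = of_int M - s / \<beta>" using assms unfolding is_window_def by blast+
  have "s * \<beta> = (of_int m - t / \<beta>) * \<beta>" "t * \<beta> = (of_int M - s / \<beta>) * \<beta>" using st by simp_all
  moreover have "s / \<beta> * \<beta> = s" "t / \<beta> * \<beta> = t" using beta_gt_1 by simp_all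
  ultimately show "s * \<beta> = of_int m * \<beta> - t" "t * \<beta> = of_int M * \<beta> - s"
    unfolding left_diff_distrib by linarith+
qed

text \<open>The next three lemmas compare \<kappa> with the bound D on x - x', or on x' - x, that attractor and window impose.
Since x - x' is a multiple of \<kappa>, this pins down the second coordinate of a lattice point.\<close>

lemma bound_norm_minus_one:
  assumes "e = 1" "k \<le> p - 1" "D * (\<beta> * \<beta> - 1) = \<beta> * \<beta> - 1 + of_int k * (\<beta> * \<beta> + 1)"
  shows "D < \<kappa>"
proof (rule ccontr)
  assume "\<not> D < \<kappa>"
  define B where "B = \<beta> * \<beta>"
  have B: "B > 1" using beta_sq_gt_1 by (simp add: B_def)
  have "\<beta> * \<kappa> = B + 1" using norm assms(1) by (simp add: \<kappa>_def algebra_simps B_def)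
  have "B + 1 \<le> \<beta> * D" using \<open>\<not> D < \<kappa>\<close> \<open>\<beta> * \<kappa> = B + 1\<close> beta_gt_1 by (metis linorder_not_less mult_left_mono less_eq_real_def less_trans zero_less_one)
  then have "(B + 1) * (B - 1) \<le> \<beta> * D * (B - 1)" using B by (intro mult_right_mono) auto
  also have "\<dots> = \<beta> * (D * (B - 1))" by simp
  also have "\<dots> = \<beta> * (B - 1 + of_int k * (B + 1))" using assms(3) by (simp add: B_def)
  also have "\<dots> = \<beta> * (B - 1) + (\<beta> * of_int k) * (B + 1)" by (simp add: algebra_simps)
  also have "\<beta> * of_int k \<le> \<beta> * (of_int p - 1)" using assms(2) beta_gt_1 by simp
  also have "\<beta> * (of_int p - 1) = B - 1 - \<beta>" using beta_sq assms(1) by (simp add: B_def algebra_simps)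
  finally have "(B + 1) * (B - 1) \<le> \<beta> * (B - 1) + (B - 1 - \<beta>) * (B + 1)" using B by (simp add: mult_right_mono)
  then have "\<beta> \<le> 0" by (simp add: algebra_simps)
  then show False using beta_gt_1 by simp
qed

lemma bound_norm_one_pos_base:
  assumes "e = -1" "k \<le> p - 2" "D * (\<beta> - 1) = of_int k * (\<beta> + 1)"
  shows "D \<le> \<kappa>"
proof -
  have bk: "\<beta> * \<kappa> = \<beta> * \<beta> - 1" using norm assms(1) by (simp add: \<kappa>_def algebra_simps)
  have "\<beta> * of_int k \<le> \<beta> * (of_int p - 2)" using assms(2) beta_gt_1 by simp
  also have "\<dots> = (\<beta> - 1) * (\<beta> - 1)" using beta_sq assms(1) by (simp add: algebra_simps)
  finally have "\<beta> * of_int k * (\<beta> + 1) \<le> (\<beta> - 1) * (\<beta> - 1) * (\<beta> + 1)" using beta_gt_1 by (intro mult_right_mono) auto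
  also have "\<dots> = (\<beta> * \<kappa>) * (\<beta> - 1)" unfolding bk by (simp add: algebra_simps)
  finally have "(\<beta> * D) * (\<beta> - 1) \<le> (\<beta> * \<kappa>) * (\<beta> - 1)" using assms(3) by (simp add: mult.assoc)
  then have "\<beta> * D \<le> \<beta> * \<kappa>" by (rule mult_right_le_imp_le) (use beta_gt_1 in simp)
  then show ?thesis by (rule mult_left_le_imp_le) (use beta_gt_1 in simp)
qed

lemma bound_norm_one_neg_base:
  assumes "e = -1" "k \<le> p - 2"
    "D * (\<beta> * \<beta> - 1) = 2 * (of_int p - 1) * \<beta> + of_int k * ((\<beta> - 1) * (\<beta> - 1))"
  shows "D \<le> \<kappa>"
proof -
  define B where "B = \<beta> * \<beta>"
  define G where "G = \<beta> - 1"
  have bk: "\<beta> * \<kappa> = B - 1" using norm assms(1) by (simp add: \<kappa>_def algebra_simps B_def)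
  have bp: "\<beta> * of_int p = B + 1" using beta_sq assms(1) by (simp add: B_def algebra_simps)
  have "p \<ge> 3" using cases_e assms(1) by auto
  then have "3 * \<beta> \<le> of_int p * \<beta>" using beta_gt_1 by (intro mult_right_mono) auto
  then have q: "B + 1 \<ge> 3 * \<beta>" using bp by (simp add: mult.commute)
  have GB: "G * G = B + 1 - 2 * \<beta>" by (simp add: G_def B_def algebra_simps)
  have "\<beta> * of_int k \<le> \<beta> * (of_int p - 2)" using assms(2) beta_gt_1 by simp
  also have "\<dots> = G * G" using bp by (simp add: GB algebra_simps)
  finally have k: "\<beta> * of_int k * (G * G) \<le> (G * G) * (G * G)" by (rule mult_right_mono) simp
  have "\<beta> * D * (B - 1) = 2 * (\<beta> * of_int p) * \<beta> - 2 * B + \<beta> * of_int k * (G * G)"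
    using arg_cong[OF assms(3), of "\<lambda>z. \<beta> * z"] by (simp add: B_def G_def algebra_simps)
  also have "\<dots> \<le> 2 * (B + 1) * \<beta> - 2 * B + (G * G) * (G * G)" using k unfolding bp by simp
  also have "\<dots> \<le> (B - 1) * (B - 1)"
  proof -
    have BB: "\<beta> * \<beta> = B" by (simp add: B_def)
    have "(B - 1) * (B - 1) - (2 * (B + 1) * \<beta> - 2 * B + (G * G) * (G * G)) = 2 * \<beta> * (B + 1 - 3 * \<beta>)"
      unfolding GB B_def by (simp add: algebra_simps)
    moreover have "0 \<le> 2 * \<beta> * (B + 1 - 3 * \<beta>)" using q beta_gt_1 by simp
    ultimately show ?thesis by linarith
  qed
  finally have "(\<beta> * D) * (B - 1) \<le> (\<beta> * \<kappa>) * (B - 1)" by (simp add: bk)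
  then have "\<beta> * D \<le> \<beta> * \<kappa>" by (rule mult_right_le_imp_le) (use beta_sq_gt_1 in \<open>simp add: B_def\<close>)
  then show ?thesis by (rule mult_left_le_imp_le) (use beta_gt_1 in simp)
qed

lemma coord_zero:
  fixes v :: int
  assumes "x - t = of_int v * \<kappa>" "x - t < \<kappa>" "t - x < \<kappa>"
  shows "v = 0"
proof -
  have "of_int v * \<kappa> < 1 * \<kappa>" "-1 * \<kappa> < of_int v * \<kappa>" using assms by simp_all
  then have "real_of_int v < 1" "-1 < real_of_int v" by (simp_all only: mult_less_cancel_right_pos[OF kappa_pos])
  then show ?thesis by linarith
qed

lemma coord_zero_or_minus_one:
  fixes v :: int
  assumes "x - t = of_int v * \<kappa>" "x - t < \<kappa>" "t - x < 2 * \<kappa>"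
  shows "v = 0 \<or> v = -1"
proof -
  have "of_int v * \<kappa> < 1 * \<kappa>" "-2 * \<kappa> < of_int v * \<kappa>" using assms by simp_all
  then have "real_of_int v < 1" "-2 < real_of_int v" by (simp_all only: mult_less_cancel_right_pos[OF kappa_pos])
  then show ?thesis by linarith
qed

text \<open>The point c is excluded: for m = 0 it is -1 - 1/\<beta>, an element of \<int>[\<beta>] whose
conjugate lies in the window, and the digit M maps it to itself.\<close>

lemma attractor_points_norm_minus_one_pos_base:
  assumes e: "e = 1" and attr: "is_attractor \<beta> m M c d" and win: "is_window \<beta> m M w0 w1"
    and mM: "M - m = p" "1 \<le> M" "M \<le> p"
    and x: "x \<in> L" "c < x" "x \<le> d" "w0 < gal x" "gal x < w1"
  shows "x = 0"
proof -
  obtain u v where uv: "x = of_int u + of_int v * \<beta>" "gal x = of_int u + of_int v * \<beta>'"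
    "x - gal x = of_int v * \<kappa>" using x(1) by (rule L_E)
  define B where "B = \<beta> * \<beta>"
  have B: "B = of_int p * \<beta> + 1" "B > 1" using beta_sq beta_sq_gt_1 e by (simp_all add: B_def)
  have m: "of_int m = of_int M - real_of_int p" using mM(1) by simp
  then have Mm: "of_int M = of_int m + real_of_int p" by simp
  have pB: "\<beta> * of_int p = \<beta> * \<beta> - 1" using B(1) by (simp add: B_def)
  have cd: "d * \<beta> = d - of_int m" "c * \<beta> = c - of_int M" using attr beta_gt_1 unfolding is_attractor_def by auto
  have g: "gal \<beta> = - 1 / \<beta>" using gal_base_eq e by simp
  note w = window_neg_conjugate[OF win g]
  have wB: "w0 * (B - 1) = \<beta> * (of_int m * \<beta> - of_int M)" "w1 * (B - 1) = \<beta> * (of_int M * \<beta> - of_int m)"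
  proof -
    have "w0 * B = of_int m * B - w1 * \<beta>" using arg_cong[OF w(1), of "\<lambda>z. z * \<beta>"] by (simp add: B_def algebra_simps)
    then show "w0 * (B - 1) = \<beta> * (of_int m * \<beta> - of_int M)" using w(2) by (simp add: B_def algebra_simps)
    have "w1 * B = of_int M * B - w0 * \<beta>" using arg_cong[OF w(2), of "\<lambda>z. z * \<beta>"] by (simp add: B_def algebra_simps)
    then show "w1 * (B - 1) = \<beta> * (of_int M * \<beta> - of_int m)" using w(1) by (simp add: B_def algebra_simps)
  qed
  have cdB: "d * (B - 1) = - of_int m * (\<beta> + 1)" "c * (B - 1) = - of_int M * (\<beta> + 1)"
  proof -
    have "d * (\<beta> - 1) = - of_int m" "c * (\<beta> - 1) = - of_int M" using cd by (simp_all add: algebra_simps)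
    then have "d * (\<beta> - 1) * (\<beta> + 1) = - of_int m * (\<beta> + 1)" "c * (\<beta> - 1) * (\<beta> + 1) = - of_int M * (\<beta> + 1)" by simp_all
    then show "d * (B - 1) = - of_int m * (\<beta> + 1)" "c * (B - 1) = - of_int M * (\<beta> + 1)"
      by (simp_all add: B_def algebra_simps)
  qed
  have "(d - w0) * (B - 1) = d * (B - 1) - w0 * (B - 1)" by (simp add: algebra_simps)
  also have "\<dots> = B - 1 + of_int (- m) * (B + 1)"
    unfolding wB cdB by (simp add: Mm pB B_def algebra_simps)
  finally have up: "x - gal x < \<kappa>"
    using bound_norm_minus_one[OF e, of "- m" "d - w0"] mM x by (simp add: B_def)
  have lo: "(w1 - c) * (B - 1) = B - 1 + of_int M * (B + 1)"
  proof -
    have "(w1 - c) * (B - 1) = w1 * (B - 1) - c * (B - 1)" by (simp add: algebra_simps)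
    also have "\<dots> = B - 1 + of_int M * (B + 1)"
      unfolding wB cdB by (simp add: m pB B_def algebra_simps)
    finally show ?thesis .
  qed
  have d1: "d < 1"
  proof -
    have "d * (\<beta> - 1) = - of_int m" using cd by (simp add: algebra_simps)
    also have "\<dots> \<le> of_int p - 1" using m mM by simp
    also have "\<dots> < 1 * (\<beta> - 1)" using beta_bounds_norm_minus_one[OF e] by simp
    finally show ?thesis by (rule mult_right_less_imp_less) (use beta_gt_1 in simp)
  qed
  show "x = 0"
  proof (cases "M = p")
    case False
    then have "w1 - c < \<kappa>" using bound_norm_minus_one[OF e _ lo[unfolded B_def]] mM by simp
    then have "v = 0" using coord_zero[OF uv(3) up] x by simp
    have "- 1 < c"
    proof -
      have "c * (\<beta> - 1) = - of_int M" using cd by (simp add: algebra_simps)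
      moreover have "M \<le> p - 1" using False mM by simp
      then have "of_int M \<le> real_of_int p - 1" by linarith
      ultimately have "-1 * (\<beta> - 1) < c * (\<beta> - 1)" using beta_bounds_norm_minus_one[OF e] by simp
      then show ?thesis by (rule mult_right_less_imp_less) (use beta_gt_1 in simp)
    qed
    then have "u = 0" using uv(1) x d1 \<open>v = 0\<close> by simp
    then show ?thesis using uv \<open>v = 0\<close> by simp
  next
    case True
    then have m0: "m = 0" using mM by simp
    have inv: "1 / \<beta> = - \<beta>'" using beta'_eq e by simp
    have d0: "d = 0" using cd m0 beta_gt_1 by simp
    have w1: "w1 = \<beta>"
    proof -
      have "w1 * (B - 1) = \<beta> * (B - 1)" unfolding wB using True m0 B by (simp add: algebra_simps)
      then show ?thesis using B(2) by simp
    qed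
    have w0: "w0 = -1" using w(2) w1 True m0 B by (simp add: B_def)
    have c: "c = \<beta>' - 1"
    proof -
      have "c * (\<beta> - 1) = - of_int p" using cd True by (simp add: algebra_simps)
      also have "\<dots> = (\<beta>' - 1) * (\<beta> - 1)" using trace norm e by (simp add: algebra_simps)
      finally show ?thesis using beta_gt_1 by simp
    qed
    have "gal x - x < 2 * \<kappa>" using x w1 c beta_gt_1 abs_beta' inv by (simp add: \<kappa>_def)
    then consider "v = 0" | "v = -1" using coord_zero_or_minus_one[OF uv(3) up] by blast
    then show ?thesis
    proof cases
      case 1
      then have "u = 0" using uv x d0 w0 by simp
      then show ?thesis using uv 1 by simp
    next
      case 2
      \<comment> \<open>With second coordinate \<open>-1\<close>, attractor and window leave no integer for the first one.\<close>
      then have "real_of_int u - \<beta> > \<beta>' - 1" "of_int u - \<beta>' < \<beta>" using uv x w1 c by simp_all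
      then have "real_of_int u > of_int p - 1" "of_int u < real_of_int p" using trace by linarith+
      then have "real_of_int (p - 1) < real_of_int u" "u < p" by simp_all
      then have "p - 1 < u" "u < p" by (simp_all only: of_int_less_iff)
      then show ?thesis by simp
    qed
  qed
qed

text \<open>For m = 0 the points 1 and \<beta>' form a cycle, under the digits 0 and p; it is harmless because both lie in
the spectrum, 1 as a digit and \<beta>' = p - \<beta> * 1.\<close>

lemma attractor_points_norm_minus_one_neg_base:
  assumes e: "e = 1" and attr: "is_attractor (-\<beta>) m M c d" and win: "is_window (-\<beta>) m M w0 w1"
    and mM: "M - m = p" "1 \<le> M" "M \<le> p"
    and x: "x \<in> L" "c \<le> x" "x \<le> d" "w0 < gal x" "gal x < w1"
  shows "x = 0 \<or> x = 1 \<or> (x = \<beta>' \<and> M = p)"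
proof -
  obtain u v where uv: "x = of_int u + of_int v * \<beta>" "gal x = of_int u + of_int v * \<beta>'"
    "x - gal x = of_int v * \<kappa>" using x(1) by (rule L_E)
  define B where "B = \<beta> * \<beta>"
  have B: "B = of_int p * \<beta> + 1" "B > 1" using beta_sq beta_sq_gt_1 e by (simp_all add: B_def)
  have m: "of_int m = of_int M - real_of_int p" using mM(1) by simp
  then have Mm: "of_int M = of_int m + real_of_int p" by simp
  have pB: "\<beta> * of_int p = \<beta> * \<beta> - 1" using B(1) by (simp add: B_def)
  have cd: "d * \<beta> = of_int M - c" "c * \<beta> = of_int m - d" using attr beta_gt_1 unfolding is_attractor_def by auto
  have g: "gal (- \<beta>) = 1 / \<beta>" using gal_base_eq e by simp
  note w = window_pos_conjugate[OF win g]
  have cdB: "d * (B - 1) = of_int M * \<beta> - of_int m" "c * (B - 1) = of_int m * \<beta> - of_int M"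
  proof -
    have "d * B = of_int M * \<beta> - c * \<beta>" using arg_cong[OF cd(1), of "\<lambda>z. z * \<beta>"] by (simp add: B_def algebra_simps)
    then show "d * (B - 1) = of_int M * \<beta> - of_int m" using cd(2) by (simp add: algebra_simps)
    have "c * B = of_int m * \<beta> - d * \<beta>" using arg_cong[OF cd(2), of "\<lambda>z. z * \<beta>"] by (simp add: B_def algebra_simps)
    then show "c * (B - 1) = of_int m * \<beta> - of_int M" using cd(1) by (simp add: algebra_simps)
  qed
  have wB: "w0 * (B - 1) = of_int m * \<beta> * (\<beta> + 1)" "w1 * (B - 1) = of_int M * \<beta> * (\<beta> + 1)"
  proof -
    have "w0 * (\<beta> - 1) * (\<beta> + 1) = of_int m * \<beta> * (\<beta> + 1)" "w1 * (\<beta> - 1) * (\<beta> + 1) = of_int M * \<beta> * (\<beta> + 1)"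
      using w by simp_all
    then show "w0 * (B - 1) = of_int m * \<beta> * (\<beta> + 1)" "w1 * (B - 1) = of_int M * \<beta> * (\<beta> + 1)"
      by (simp_all add: B_def algebra_simps)
  qed
  have up: "(d - w0) * (B - 1) = B - 1 + of_int (- m) * (B + 1)"
  proof -
    have "(d - w0) * (B - 1) = d * (B - 1) - w0 * (B - 1)" by (simp add: algebra_simps)
    also have "\<dots> = B - 1 + of_int (- m) * (B + 1)"
      unfolding wB cdB by (simp add: Mm pB B_def algebra_simps)
    finally show ?thesis .
  qed
  then have up: "x - gal x < \<kappa>"
    using bound_norm_minus_one[OF e, of "- m" "d - w0"] mM x by (simp add: B_def)
  have lo: "(w1 - c) * (B - 1) = B - 1 + of_int M * (B + 1)"
  proof -
    have "(w1 - c) * (B - 1) = w1 * (B - 1) - c * (B - 1)" by (simp add: algebra_simps)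
    also have "\<dots> = B - 1 + of_int M * (B + 1)"
      unfolding wB cdB by (simp add: m pB B_def algebra_simps)
    finally show ?thesis .
  qed
  have d1: "d \<le> 1"
  proof -
    have "of_int m * 1 \<ge> of_int m * \<beta>" using mM beta_gt_1 by (intro mult_left_mono_neg) auto
    then have "d * (B - 1) \<le> 1 * (B - 1)" unfolding cdB using m B(1) by (simp add: algebra_simps)
    then show ?thesis using B(2) by simp
  qed
  have c1: "- 1 < c"
  proof -
    have "(real_of_int p - of_int M) * (\<beta> - 1) < of_int p * (\<beta> - 1)" using mM beta_gt_1 by simp
    then have "- 1 * (B - 1) < c * (B - 1)" unfolding cdB m using B(1) by (simp add: algebra_simps)
    then show ?thesis by (rule mult_right_less_imp_less) (use B(2) in simp)
  qed
  have v0: ?thesis if "v = 0"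
  proof -
    have "u = 0 \<or> u = 1" using uv(1) x d1 c1 that by auto
    then show ?thesis using uv that by auto
  qed
  show ?thesis
  proof (cases "M = p")
    case False
    then have "w1 - c < \<kappa>" using bound_norm_minus_one[OF e _ lo[unfolded B_def]] mM by simp
    then have "v = 0" using coord_zero[OF uv(3) up] x by simp
    then show ?thesis by (rule v0)
  next
    case True
    then have m0: "m = 0" using mM by simp
    have inv: "1 / \<beta> = - \<beta>'" using beta'_eq e by simp
    have w1: "w1 = \<beta> + 1"
    proof -
      have "w1 * (\<beta> - 1) = (\<beta> + 1) * (\<beta> - 1)" unfolding w using True B by (simp add: B_def algebra_simps)
      then show ?thesis using beta_gt_1 by simp
    qed
    have d: "d = 1"
    proof -
      have "d * (B - 1) = 1 * (B - 1)" unfolding cdB using True m0 B by simp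
      then show ?thesis using B(2) by simp
    qed
    have c: "c = \<beta>'" using cd(1) d True trace by simp
    have "gal x - x < 2 * \<kappa>" using x w1 c beta_gt_1 abs_beta' inv by (simp add: \<kappa>_def)
    then consider "v = 0" | "v = -1" using coord_zero_or_minus_one[OF uv(3) up] by blast
    then show ?thesis
    proof cases
      case 1
      then show ?thesis by (rule v0)
    next
      case 2
      then have "real_of_int u - \<beta> \<ge> \<beta>'" "of_int u - \<beta>' < \<beta> + 1" using uv x w1 c by simp_all
      then have "real_of_int u \<ge> of_int p" "of_int u < real_of_int p + 1" using trace by linarith+
      then have "u = p" by linarith
      then show ?thesis using uv(1) 2 True trace by simp
    qed
  qed
qed

text \<open>The alphabets {0,...,p-1} and {-(p-1),...,0} are excluded.  For the first one
z = 1/\<beta> - 1 is a bad point: it has conjugate \<beta> - 1 in the window, is fixed by the digit p - 2, and is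
negative although the spectrum is not.\<close>

lemma attractor_points_norm_one_pos_base:
  assumes e: "e = -1" and attr: "is_attractor \<beta> m M c d" and win: "is_window \<beta> m M w0 w1"
    and mM: "M - m = p - 1" "1 \<le> M" "M \<le> p - 2"
    and x: "x \<in> L" "c \<le> x" "x \<le> d" "w0 < gal x" "gal x < w1"
  shows "x = 0"
proof -
  obtain u v where uv: "x = of_int u + of_int v * \<beta>" "gal x = of_int u + of_int v * \<beta>'"
    "x - gal x = of_int v * \<kappa>" using x(1) by (rule L_E)
  have cd: "d * (\<beta> - 1) = - of_int m" "c * (\<beta> - 1) = - of_int M"
    using attr beta_gt_1 unfolding is_attractor_def by (auto simp: algebra_simps)
  have g: "gal \<beta> = 1 / \<beta>" using gal_base_eq e by simp
  note w = window_pos_conjugate[OF win g]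
  have "(d - w0) * (\<beta> - 1) = of_int (- m) * (\<beta> + 1)" "(w1 - c) * (\<beta> - 1) = of_int M * (\<beta> + 1)"
    unfolding left_diff_distrib[of _ _ "\<beta> - 1"] w cd by (simp_all add: algebra_simps)
  then have "d - w0 \<le> \<kappa>" "w1 - c \<le> \<kappa>" 
    using bound_norm_one_pos_base[OF e, of "- m" "d - w0"] bound_norm_one_pos_base[OF e, of M "w1 - c"] mM by simp_all
  then have "v = 0" using coord_zero[OF uv(3)] x by simp
  have "d * (\<beta> - 1) < 1 * (\<beta> - 1)" "-1 * (\<beta> - 1) < c * (\<beta> - 1)"
  proof -
    have "real_of_int m = of_int M - of_int p + 1" "real_of_int M \<le> of_int p - 2" "1 \<le> real_of_int M"
      using mM by linarith+
    then show "d * (\<beta> - 1) < 1 * (\<beta> - 1)" "-1 * (\<beta> - 1) < c * (\<beta> - 1)"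
      unfolding cd using beta_bounds_norm_one[OF e] by simp_all
  qed
  moreover have "0 < \<beta> - 1" using beta_gt_1 by simp
  ultimately have "d < 1" "-1 < c" by (simp_all only: mult_less_cancel_right_pos)
  then have "u = 0" using uv(1) x \<open>v = 0\<close> by simp
  then show ?thesis using uv \<open>v = 0\<close> by simp
qed

text \<open>For M = p - 1 the general bound fails when p = 3, so the second coordinate -1 is excluded directly.\<close>

lemma attractor_points_norm_one_neg_base:
  assumes e: "e = -1" and attr: "is_attractor (-\<beta>) m M c d" and win: "is_window (-\<beta>) m M w0 w1"
    and mM: "M - m = p - 1" "1 \<le> M" "M \<le> p - 1"
    and x: "x \<in> L" "c \<le> x" "x \<le> d" "w0 < gal x" "gal x < w1"
  shows "x = 0"
proof -
  obtain u v where uv: "x = of_int u + of_int v * \<beta>" "gal x = of_int u + of_int v * \<beta>'"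
    "x - gal x = of_int v * \<kappa>" using x(1) by (rule L_E)
  define B where "B = \<beta> * \<beta>"
  have B: "B = of_int p * \<beta> - 1" "B > 1" using beta_sq beta_sq_gt_1 e by (simp_all add: B_def)
  have b2: "\<beta> > 2" using beta_bounds_norm_one[OF e] by auto
  have B2: "B > 2 * \<beta>" unfolding B_def using b2 by (intro mult_strict_right_mono) auto
  have m: "of_int m = of_int M - real_of_int p + 1" using mM(1) by linarith
  then have Mm: "of_int M = of_int m + real_of_int p - 1" by simp
  have cd: "d * \<beta> = of_int M - c" "c * \<beta> = of_int m - d" using attr beta_gt_1 unfolding is_attractor_def by auto
  have g: "gal (- \<beta>) = - 1 / \<beta>" using gal_base_eq e by simp
  note w = window_neg_conjugate[OF win g]
  have wB: "w0 * (B - 1) = \<beta> * (of_int m * \<beta> - of_int M)" "w1 * (B - 1) = \<beta> * (of_int M * \<beta> - of_int m)"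
  proof -
    have "w0 * B = of_int m * B - w1 * \<beta>" using arg_cong[OF w(1), of "\<lambda>z. z * \<beta>"] by (simp add: B_def algebra_simps)
    then show "w0 * (B - 1) = \<beta> * (of_int m * \<beta> - of_int M)" using w(2) by (simp add: B_def algebra_simps)
    have "w1 * B = of_int M * B - w0 * \<beta>" using arg_cong[OF w(2), of "\<lambda>z. z * \<beta>"] by (simp add: B_def algebra_simps)
    then show "w1 * (B - 1) = \<beta> * (of_int M * \<beta> - of_int m)" using w(1) by (simp add: B_def algebra_simps)
  qed
  have cdB: "d * (B - 1) = of_int M * \<beta> - of_int m" "c * (B - 1) = of_int m * \<beta> - of_int M"
  proof -
    have "d * B = of_int M * \<beta> - c * \<beta>" using arg_cong[OF cd(1), of "\<lambda>z. z * \<beta>"] by (simp add: B_def algebra_simps)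
    then show "d * (B - 1) = of_int M * \<beta> - of_int m" using cd(2) by (simp add: algebra_simps)
    have "c * B = of_int m * \<beta> - d * \<beta>" using arg_cong[OF cd(2), of "\<lambda>z. z * \<beta>"] by (simp add: B_def algebra_simps)
    then show "c * (B - 1) = of_int m * \<beta> - of_int M" using cd(1) by (simp add: algebra_simps)
  qed
  have G: "(\<beta> - 1) * (\<beta> - 1) = B - 2 * \<beta> + 1" by (simp add: B_def algebra_simps)
  have up: "(d - w0) * (B - 1) = 2 * (of_int p - 1) * \<beta> + of_int (- m) * ((\<beta> - 1) * (\<beta> - 1))"
  proof -
    have "(d - w0) * (B - 1) = d * (B - 1) - w0 * (B - 1)" by (simp add: algebra_simps)
    also have "\<dots> = 2 * (of_int p - 1) * \<beta> + of_int (- m) * ((\<beta> - 1) * (\<beta> - 1))"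
      unfolding wB cdB G by (simp add: Mm B_def algebra_simps)
    finally show ?thesis .
  qed
  then have "d - w0 \<le> \<kappa>" using bound_norm_one_neg_base[OF e, of "- m" "d - w0"] mM by (simp add: B_def)
  then have up: "x - gal x < \<kappa>" using x by simp
  have lo: "(w1 - c) * (B - 1) = 2 * (of_int p - 1) * \<beta> + of_int M * ((\<beta> - 1) * (\<beta> - 1))"
  proof -
    have "(w1 - c) * (B - 1) = w1 * (B - 1) - c * (B - 1)" by (simp add: algebra_simps)
    also have "\<dots> = 2 * (of_int p - 1) * \<beta> + of_int M * ((\<beta> - 1) * (\<beta> - 1))"
      unfolding wB cdB G by (simp add: m B_def algebra_simps)
    finally show ?thesis .
  qed
  have pB: "(of_int p - 1) * \<beta> = B + 1 - \<beta>" using B by (simp add: algebra_simps)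
  have d1: "d < 1"
  proof -
    have "of_int M * (\<beta> - 1) \<le> (of_int p - 1) * (\<beta> - 1)" using mM beta_gt_1 by (intro mult_right_mono) auto
    then have "d * (B - 1) < 1 * (B - 1)" unfolding cdB using m pB b2 by (simp add: algebra_simps)
    then show ?thesis using B(2) by simp
  qed
  have c1: "- 1 < c"
  proof -
    have "2 * (\<beta> - 1) \<le> (of_int M + 1) * (\<beta> - 1)" using mM beta_gt_1 by (intro mult_right_mono) auto
    then have "1 < (of_int M + 1) * (\<beta> - 1)" using b2 by simp
    then have "- 1 * (B - 1) < c * (B - 1)" unfolding cdB m using pB by (simp add: algebra_simps)
    then show ?thesis by (rule mult_right_less_imp_less) (use B(2) in simp)
  qed
  have v0: ?thesis if "v = 0"
  proof -
    have "u = 0" using uv(1) x d1 c1 that by auto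
    then show ?thesis using uv that by auto
  qed
  show ?thesis
  proof (cases "M = p - 1")
    case False
    then have "w1 - c \<le> \<kappa>" using bound_norm_one_neg_base[OF e _ lo[unfolded B_def]] mM by simp
    then have "v = 0" using coord_zero[OF uv(3) up] x by simp
    then show ?thesis by (rule v0)
  next
    case True
    then have m0: "m = 0" using mM by simp
    have inv: "1 / \<beta> = \<beta>'" using beta'_eq e by simp
    have cd': "c * \<beta> = - d" "w1 = d * \<beta>"
    proof -
      show "c * \<beta> = - d" using cd m0 by simp
      have "w1 * (B - 1) = d * \<beta> * (B - 1)" unfolding wB using arg_cong[OF cdB(1), of "\<lambda>z. z * \<beta>"] by (simp add: algebra_simps)
      then show "w1 = d * \<beta>" using B(2) by simp
    qed
    have w1: "w1 < \<beta>" using cd' d1 beta_gt_1 by simp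
    have c: "c > - \<beta>'"
    proof -
      have "- \<beta>' * \<beta> < c * \<beta>" unfolding cd' using d1 norm e by (simp add: mult.commute)
      then show ?thesis by (rule mult_right_less_imp_less) (use beta_gt_1 in simp)
    qed
    have b': "0 < \<beta>'" "\<beta>' < 1" using inv beta_gt_1 by (auto simp flip: inv)
    have half: "2 * \<beta>' < 1"
    proof -
      have "2 * \<beta>' < \<beta> * \<beta>'" using b2 b' by simp
      then show ?thesis using norm e by simp
    qed
    have "gal x - x < 2 * \<kappa>" using x w1 c b2 half by (simp add: \<kappa>_def)
    then consider "v = 0" | "v = -1" using coord_zero_or_minus_one[OF uv(3) up] by blast
    then show ?thesis
    proof cases
      case 1
      then show ?thesis by (rule v0)
    next
      case 2
      then have u: "real_of_int u - \<beta> > - \<beta>'" "of_int u - \<beta>' < \<beta>" using uv x w1 c by simp_all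
      then have "real_of_int u > of_int p - 1" "of_int u < real_of_int p" using trace u half by linarith+
      then have "real_of_int (p - 1) < real_of_int u" "u < p" by simp_all
      then have "p - 1 < u" "u < p" by (simp_all only: of_int_less_iff)
      then show ?thesis by simp
    qed
  qed
qed

end

section \<open>The spectrum fills its window\<close>

context quadratic_unit begin

text \<open>The least M - m for which an alphabet {m,...,M} has more than \<beta> elements.\<close>

definition least_span :: int where "least_span = (if e = 1 then p else p - 1)"

lemma least_span_norm_minus_one: "e = 1 \<Longrightarrow> least_span = p" and least_span_norm_one: "e = -1 \<Longrightarrow> least_span = p - 1"
  unfolding least_span_def by auto

lemma least_span_pos: "least_span \<ge> 1" and least_span_gt: "\<beta> - 1 < of_int least_span"
  and least_span_le: "\<beta> < of_int k + 1 \<Longrightarrow> least_span \<le> k"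
proof -
  show "least_span \<ge> 1" using cases_e by (auto simp: least_span_def)
  show "\<beta> - 1 < of_int least_span" using cases_e beta_bounds_norm_minus_one beta_bounds_norm_one by (auto simp: least_span_def)
  assume h: "\<beta> < of_int k + 1"
  show "least_span \<le> k"
  proof (cases "e = 1")
    case True
    then have "real_of_int p < of_int (k + 1)" using beta_bounds_norm_minus_one h by simp
    then have "p < k + 1" by (simp only: of_int_less_iff)
    then show ?thesis unfolding least_span_def using True by simp
  next
    case False
    then have "real_of_int (p - 1) < of_int (k + 1)" using beta_bounds_norm_one cases_e h by auto
    then have "p - 1 < k + 1" by (simp only: of_int_less_iff)
    then show ?thesis unfolding least_span_def using False by simp
  qed
qed

lemma window_longer_than_base:
  assumes "is_window \<alpha> m M s t" "\<beta> - 1 < of_int (M - m)"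
  shows "t - s > \<beta>"
proof -
  have "\<beta> * (\<beta> - 1) < (t - s) * (\<beta> - 1)"
    unfolding window_length[OF assms(1)] using assms(2) beta_gt_1 by (subst mult.commute) (rule mult_strict_right_mono, auto)
  then show ?thesis by (rule mult_right_less_imp_less) (use beta_gt_1 in simp)
qed

text \<open>For norm 1 the greedy digit keeps nonnegative points nonnegative.  If the second coordinate v is
nonnegative, then x \<ge> x'.  A point with x \<ge> 0 and x' < \<beta> with
negative v would need \<bar>v\<bar>\<kappa> < \<beta>, so v = -1; but then x' \<ge> p - \<beta>' = \<beta>.\<close>

lemma greedy_nonneg:
  assumes e: "e = -1" and z: "z \<in> L" "0 \<le> z" "gal z < \<beta>"
  shows "of_int \<lfloor>gal z\<rfloor> \<le> z"
proof -
  obtain u v where uv: "z = of_int u + of_int v * \<beta>" "gal z = of_int u + of_int v * \<beta>'"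
    "z - gal z = of_int v * \<kappa>" using z(1) by (rule L_E)
  have b2: "\<beta> > 2" "of_int p - 1 < \<beta>" using beta_bounds_norm_one[OF e] by auto
  have b': "\<beta>' = 1 / \<beta>" using beta'_eq e by simp
  then have b'1: "0 < \<beta>'" "\<beta>' < 1" using beta_gt_1 by auto
  consider "v \<ge> 0" | "v = -1" | "v \<le> -2" by linarith
  then show ?thesis
  proof cases
    case 1
    then have "z - gal z \<ge> 0" unfolding uv(3) using kappa_pos by simp
    then show ?thesis by linarith
  next
    case 2
    then have "real_of_int u > of_int (p - 1)" using uv z b2 by simp
    then have "u > p - 1" by (simp only: of_int_less_iff)
    then have "real_of_int u \<ge> of_int p" by simp
    then have "gal z \<ge> \<beta>" using 2 uv trace by simp
    then show ?thesis using z by simp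
  next
    case 3
    then have "of_int v * \<kappa> \<le> - 2 * \<kappa>" using kappa_pos by (intro mult_right_mono) auto
    then have "2 * \<kappa> < \<beta>" using uv(3) z by simp
    then show ?thesis using b'1 b2 by (simp add: \<kappa>_def)
  qed
qed

text \<open>For a shortest alphabet, all points (for the base \<beta>, all from 1 on) with conjugate in some
interval of length at least \<beta> have expansions.  In general any closed interval inside the open window will do.
In the case of norm 1, base \<beta> and m = 0 the bad point 1/\<beta> - 1 must be avoided, so the smaller interval [0,\<beta>] and the greedy digits are used.\<close>

lemma core_interval:
  assumes \<alpha>: "\<alpha> \<in> {\<beta>, -\<beta>}" and mM: "M - m = least_span" "1 \<le> M" "M \<le> least_span"
  shows "\<exists>s t. \<beta> \<le> t - s \<and>
    (\<forall>x\<in>L. (\<alpha> = \<beta> \<longrightarrow> 1 \<le> x) \<longrightarrow> s \<le> gal x \<longrightarrow> gal x \<le> t \<longrightarrow> x \<in> spectrum {m..M} \<alpha>)"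
proof -
  obtain c d where attr: "is_attractor \<alpha> m M c d" using attractor_exists[OF \<alpha>] by blast
  obtain w0 w1 where win: "is_window \<alpha> m M w0 w1" using window_exists[OF \<alpha>] by blast
  have len: "w1 - w0 > \<beta>" using window_longer_than_base[OF win] least_span_gt mM by simp
  have digits: "of_int a \<in> spectrum {m..M} \<alpha>" if "m \<le> a" "a \<le> M" for a
    using that by (intro spectrum_of_digit) simp
  have le: "m \<le> M" using mM least_span_pos by simp
  have zero: "0 \<in> spectrum {m..M} \<alpha>" using digits[of 0] mM by simp
  note step = window_digit[OF win le len]
  define K where "K = \<bar>w0\<bar> + \<bar>w1\<bar>"
  have shrink: ?thesis
    if core: "\<And>x. x \<in> L \<Longrightarrow> (\<alpha> = \<beta> \<longrightarrow> 1 \<le> x) \<Longrightarrow> w0 < gal x \<Longrightarrow> gal x < w1 \<Longrightarrow> x \<in> spectrum {m..M} \<alpha>"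
  proof (rule exI[of _ "w0 + (w1 - w0 - \<beta>) / 2"], rule exI[of _ "w1 - (w1 - w0 - \<beta>) / 2"], intro conjI ballI impI)
    fix x assume h: "x \<in> L" "\<alpha> = \<beta> \<longrightarrow> 1 \<le> x" "w0 + (w1 - w0 - \<beta>) / 2 \<le> gal x" "gal x \<le> w1 - (w1 - w0 - \<beta>) / 2"
    have "(w1 - w0 - \<beta>) / 2 > 0" using len by simp
    then have "w0 < gal x" "gal x < w1" using h(3,4) by linarith+
    then show "x \<in> spectrum {m..M} \<alpha>" by (rule core[OF h(1,2)])
  qed (simp add: field_simps)
  have shrink': ?thesis
    if attractor: "\<And>z. z \<in> L \<Longrightarrow> w0 < gal z \<Longrightarrow> gal z < w1 \<Longrightarrow> c \<le> z \<Longrightarrow> z \<le> d \<Longrightarrow> z \<in> spectrum {m..M} \<alpha>"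
  proof (rule shrink, rule in_spectrum_by_descent[OF \<alpha> attr, where H = "\<lambda>z. w0 < gal z \<and> gal z < w1" and K = K])
    fix z assume z: "z \<in> L" "w0 < gal z \<and> gal z < w1"
    show "\<exists>a\<in>{m..M}. w0 < gal ((z - of_int a) / \<alpha>) \<and> gal ((z - of_int a) / \<alpha>) < w1"
      using step z gal_unshift[OF \<alpha> z(1)] by simp
  qed (use attractor in \<open>auto simp: K_def\<close>)
  consider "e = 1" "\<alpha> = \<beta>" | "e = 1" "\<alpha> = -\<beta>" | "e = -1" "\<alpha> = \<beta>" "M = p - 1"
    | "e = -1" "\<alpha> = \<beta>" "M \<le> p - 2" | "e = -1" "\<alpha> = -\<beta>"
  proof -
    have "M = p - 1 \<or> M \<le> p - 2" if "e = -1" using mM(3) that unfolding least_span_def by auto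
    moreover have "e = 1 \<or> e = -1" "\<alpha> = \<beta> \<or> \<alpha> = -\<beta>" using cases_e \<alpha> by auto
    ultimately show ?thesis using that by blast
  qed
  then show ?thesis
  proof cases
    case 1
    note attr' = attr[unfolded 1(2)] and win' = win[unfolded 1(2)] and mM' = mM[unfolded least_span_norm_minus_one[OF 1(1)]]
    have cd: "c * \<beta> = c - of_int M" using attr' beta_gt_1 unfolding is_attractor_def by auto
    then have "c * (\<beta> - 1) < 0 * (\<beta> - 1)" using mM by (simp add: algebra_simps)
    then have c: "c < 0" by (rule mult_right_less_imp_less) (use beta_gt_1 in simp)
    show ?thesis
    proof (rule shrink, rule in_spectrum_by_descent[OF \<alpha> attr, where H = "\<lambda>z. c < z \<and> w0 < gal z \<and> gal z < w1" and K = K])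
      fix z assume z: "z \<in> L" "c < z \<and> w0 < gal z \<and> gal z < w1"
      then obtain a where a: "a \<in> {m..M}" "w0 < (gal z - of_int a) / gal \<alpha> \<and> (gal z - of_int a) / gal \<alpha> < w1"
        using step by blast
      have "real_of_int a \<le> of_int M" using a by simp
      then have "c * \<beta> < z - of_int a" using cd z by linarith
      then have "c < (z - of_int a) / \<alpha>" using 1 beta_gt_1 by (simp add: pos_less_divide_eq)
      then show "\<exists>a\<in>{m..M}. c < (z - of_int a) / \<alpha> \<and> w0 < gal ((z - of_int a) / \<alpha>) \<and> gal ((z - of_int a) / \<alpha>) < w1"
        using a gal_unshift[OF \<alpha> z(1)] by auto
    next
      fix z assume "z \<in> L" "c < z \<and> w0 < gal z \<and> gal z < w1" "z \<le> d"
      then have "z = 0" using attractor_points_norm_minus_one_pos_base[OF 1(1) attr' win' mM'] by blast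
      then show "z \<in> spectrum {m..M} \<alpha>" using zero by simp
    qed (use c 1 in \<open>auto simp: K_def\<close>)
  next
    case 2
    note attr' = attr[unfolded 2(2)] and win' = win[unfolded 2(2)] and mM' = mM[unfolded least_span_norm_minus_one[OF 2(1)]]
    show ?thesis
    proof (rule shrink')
      fix z assume "z \<in> L" "w0 < gal z" "gal z < w1" "c \<le> z" "z \<le> d"
      then have "z = 0 \<or> z = 1 \<or> (z = \<beta>' \<and> M = p)"
        using attractor_points_norm_minus_one_neg_base[OF 2(1) attr' win' mM'] by blast
      moreover have one: "1 \<in> spectrum {m..M} \<alpha>" using digits[of 1] mM by simp
      moreover have "\<beta>' \<in> spectrum {m..M} \<alpha>" if "M = p"
      proof -
        have "of_int p + \<alpha> * 1 \<in> spectrum {m..M} \<alpha>" by (rule spectrum_shift) (use one that mM le in auto)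
        moreover have "of_int p + \<alpha> * 1 = \<beta>'" using 2 trace by simp
        ultimately show ?thesis by simp
      qed
      ultimately show "z \<in> spectrum {m..M} \<alpha>" using zero by auto
    qed
  next
    case 4
    note attr' = attr[unfolded 4(2)] and win' = win[unfolded 4(2)] and mM' = mM[unfolded least_span_norm_one[OF 4(1)]]
    show ?thesis
    proof (rule shrink')
      fix z assume "z \<in> L" "w0 < gal z" "gal z < w1" "c \<le> z" "z \<le> d"
      then have "z = 0" using attractor_points_norm_one_pos_base[OF 4(1) attr' win' mM'(1,2) 4(3)] by blast
      then show "z \<in> spectrum {m..M} \<alpha>" using zero by simp
    qed
  next
    case 5
    note attr' = attr[unfolded 5(2)] and win' = win[unfolded 5(2)] and mM' = mM[unfolded least_span_norm_one[OF 5(1)]]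
    show ?thesis
    proof (rule shrink')
      fix z assume "z \<in> L" "w0 < gal z" "gal z < w1" "c \<le> z" "z \<le> d"
      then have "z = 0" using attractor_points_norm_one_neg_base[OF 5(1) attr' win' mM'] by blast
      then show "z \<in> spectrum {m..M} \<alpha>" using zero by simp
    qed
  next
    case 3
    have m0: "m = 0" using mM(1) least_span_norm_one[OF 3(1)] 3(3) by simp
    have "d * \<beta> = d" using attr 3 m0 beta_gt_1 unfolding is_attractor_def by auto
    then have d0: "d = 0" using beta_gt_1 by simp
    have ga: "gal \<alpha> = 1 / \<beta>" using gal_base_eq 3 by simp
    have b': "\<beta>' < 1" using abs_beta'_less_1 by simp
    show ?thesis
    proof (rule exI[of _ 0], rule exI[of _ \<beta>], intro conjI ballI impI)
      fix x assume x: "x \<in> L" "\<alpha> = \<beta> \<longrightarrow> 1 \<le> x" "0 \<le> gal x" "gal x \<le> \<beta>"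
      \<comment> \<open>The only point with conjugate \<open>\<beta>\<close> is \<open>\<beta>' = 1 / \<beta>\<close>, which is smaller than \<open>1\<close>.\<close>
      have "gal x \<noteq> \<beta>" using gal_inj[OF x(1) L_beta'] gal_beta' b' x 3 by auto
      then have xb: "gal x < \<beta>" using x by simp
      show "x \<in> spectrum {m..M} \<alpha>"
      proof (rule in_spectrum_by_descent[OF \<alpha> attr, where H = "\<lambda>z. 0 \<le> z \<and> 0 \<le> gal z \<and> gal z < \<beta>" and K = \<beta>])
        fix z assume z: "z \<in> L" "0 \<le> z \<and> 0 \<le> gal z \<and> gal z < \<beta>"
        let ?a = "\<lfloor>gal z\<rfloor>"
        have "gal z < of_int p" using z beta_bounds_norm_one[OF 3(1)] by linarith
        then have "?a < p" by (simp add: floor_less_iff)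
        then have a: "?a \<in> {m..M}" using z 3 m0 by simp
        have "0 \<le> (z - of_int ?a) / \<alpha>" using greedy_nonneg[OF 3(1) z(1)] z 3 beta_gt_1 by simp
        moreover have g: "gal ((z - of_int ?a) / \<alpha>) = (gal z - of_int ?a) * \<beta>"
          using gal_unshift[OF \<alpha> z(1)] ga by simp
        moreover have "0 \<le> (gal z - of_int ?a) * \<beta>" using beta_gt_1 by simp
        moreover have "(gal z - of_int ?a) * \<beta> < 1 * \<beta>"
          using beta_gt_1 by (intro mult_strict_right_mono) linarith+
        ultimately show "\<exists>a\<in>{m..M}. 0 \<le> (z - of_int a) / \<alpha> \<and> 0 \<le> gal ((z - of_int a) / \<alpha>) \<and> gal ((z - of_int a) / \<alpha>) < \<beta>"
          using a by (intro bexI[of _ ?a]) auto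
      next
        fix z assume "z \<in> L" "0 \<le> z \<and> 0 \<le> gal z \<and> gal z < \<beta>" "z \<le> d"
        then have "z = 0" using d0 by simp
        then show "z \<in> spectrum {m..M} \<alpha>" using zero by simp
      qed (use x xb 3 in auto)
    qed simp
  qed
qed

text \<open>A spectrum for the base \<beta> may be bounded below, so only large x are asked for; for the base -\<beta> it
is unbounded in both directions.\<close>

definition eventually_filled :: "real \<Rightarrow> real set \<Rightarrow> real \<Rightarrow> real \<Rightarrow> bool" where
  "eventually_filled \<alpha> X s t \<longleftrightarrow>
     (\<exists>C. \<forall>x\<in>L. (\<alpha> = \<beta> \<longrightarrow> C \<le> x) \<longrightarrow> s \<le> gal x \<longrightarrow> gal x \<le> t \<longrightarrow> x \<in> X)"

text \<open>One more digit turns a filled interval [s,t] into the filled set A + \<alpha>'[s,t].  This is again an interval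
because t - s \<ge> \<beta>, and its end points are nearer to those of the window by the factor \<beta>.\<close>

lemma filled_interval_grows:
  assumes \<alpha>: "\<alpha> \<in> {\<beta>, -\<beta>}" and win: "is_window \<alpha> m M w0 w1" and mM: "\<beta> - 1 < of_int (M - m)"
    and fill: "eventually_filled \<alpha> (spectrum {m..M} \<alpha>) s t" "\<beta> \<le> t - s"
    and D: "s \<le> w0 + D" "w1 - D \<le> t"
  shows "\<exists>s' t'. eventually_filled \<alpha> (spectrum {m..M} \<alpha>) s' t' \<and> \<beta> \<le> t' - s' \<and>
    s' \<le> w0 + D / \<beta> \<and> w1 - D / \<beta> \<le> t'"
proof -
  obtain C where C: "\<And>x. x \<in> L \<Longrightarrow> (\<alpha> = \<beta> \<longrightarrow> C \<le> x) \<Longrightarrow> s \<le> gal x \<Longrightarrow> gal x \<le> t \<Longrightarrow> x \<in> spectrum {m..M} \<alpha>"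
    using fill(1) unfolding eventually_filled_def by blast
  have "real_of_int (M - m) > 0" using mM beta_gt_1 by linarith
  then have le: "m \<le> M" by simp
  define f where "f = (if gal \<alpha> = 1 / \<beta> then s / \<beta> else - t / \<beta>)"
  define w where "w = (t - s) / \<beta>"
  have w: "w \<ge> 1" unfolding w_def using fill(2) beta_gt_1 by simp
  have "eventually_filled \<alpha> (spectrum {m..M} \<alpha>) (of_int m + f) (of_int M + f + w)"
    unfolding eventually_filled_def
  proof (intro exI[of _ "\<beta> * C + of_int M"] ballI impI)
    fix x assume x: "x \<in> L" "\<alpha> = \<beta> \<longrightarrow> \<beta> * C + of_int M \<le> x" "of_int m + f \<le> gal x" "gal x \<le> of_int M + f + w"
    obtain a where a: "a \<in> {m..M}" "f \<le> gal x - of_int a" "gal x - of_int a \<le> f + w"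
      using exists_digit_closed[OF le w x(3,4)] by blast
    let ?y = "(x - of_int a) / \<alpha>"
    have gy: "gal ?y = (gal x - of_int a) / gal \<alpha>" by (rule gal_unshift[OF \<alpha> x(1)])
    have b: "\<beta> > 0" using beta_gt_1 by simp
    have "s \<le> gal ?y \<and> gal ?y \<le> t"
    proof (cases "gal \<alpha> = 1 / \<beta>")
      case True
      have "s / \<beta> \<le> gal x - of_int a" "gal x - of_int a \<le> t / \<beta>"
        using a True by (simp_all add: f_def w_def diff_divide_distrib)
      then show ?thesis unfolding gy True using b by (simp add: pos_divide_le_eq pos_le_divide_eq)
    next
      case False
      then have g: "gal \<alpha> = - 1 / \<beta>" using abs_gal_base[OF \<alpha>] by auto
      have "- t / \<beta> \<le> gal x - of_int a" "gal x - of_int a \<le> - s / \<beta>"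
        using a False by (simp_all add: f_def w_def diff_divide_distrib)
      then have "- t \<le> (gal x - of_int a) * \<beta>" "(gal x - of_int a) * \<beta> \<le> - s"
        by (simp_all only: pos_divide_le_eq[OF b] pos_le_divide_eq[OF b])
      then show ?thesis unfolding gy g by simp
    qed
    moreover have "\<alpha> = \<beta> \<longrightarrow> C \<le> ?y"
    proof
      assume "\<alpha> = \<beta>"
      moreover have "real_of_int a \<le> of_int M" using a by simp
      ultimately have "C * \<beta> \<le> x - of_int a" using x(2) by (simp add: mult.commute)
      then show "C \<le> ?y" using \<open>\<alpha> = \<beta>\<close> b by (simp add: pos_le_divide_eq)
    qed
    ultimately have "?y \<in> spectrum {m..M} \<alpha>" using C[OF L_unshift[OF \<alpha> x(1)]] by blast
    then have "of_int a + \<alpha> * ?y \<in> spectrum {m..M} \<alpha>" using a by (intro spectrum_shift)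
    moreover have "of_int a + \<alpha> * ?y = x" using \<alpha> beta_gt_1 by auto
    ultimately show "x \<in> spectrum {m..M} \<alpha>" by simp
  qed
  moreover have "\<beta> \<le> (of_int M + f + w) - (of_int m + f)" using w mM by simp
  moreover have "of_int m + f \<le> w0 + D / \<beta> \<and> w1 - D / \<beta> \<le> of_int M + f + w"
  proof -
    have b: "\<beta> \<ge> 0" using beta_gt_1 by simp
    have D': "s / \<beta> \<le> w0 / \<beta> + D / \<beta>" "w1 / \<beta> - D / \<beta> \<le> t / \<beta>"
      using divide_right_mono[OF D(1) b] divide_right_mono[OF D(2) b]
      by (simp_all add: add_divide_distrib diff_divide_distrib)
    show ?thesis
    proof (cases "gal \<alpha> = 1 / \<beta>")
      case True
      then have "gal \<alpha> \<noteq> - 1 / \<beta>" using beta_gt_1 by simp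
      then have "w0 = of_int m + w0 / \<beta>" "w1 = of_int M + w1 / \<beta>" "f = s / \<beta>"
        using win True unfolding is_window_def f_def by (blast, blast, simp)
      then show ?thesis using D' unfolding w_def diff_divide_distrib by linarith
    next
      case False
      then have "w0 = of_int m - w1 / \<beta>" "w1 = of_int M - w0 / \<beta>" "f = - (t / \<beta>)"
        using win unfolding is_window_def f_def by (blast, blast, simp)
      then show ?thesis using D' unfolding w_def diff_divide_distrib by linarith
    qed
  qed
  ultimately show ?thesis by blast
qed

theorem spectrum_fills_window:
  assumes \<alpha>: "\<alpha> \<in> {\<beta>, -\<beta>}" and win: "is_window \<alpha> m M w0 w1" and mM: "\<beta> - 1 < of_int (M - m)"
    and zero: "m \<le> 0" "1 \<le> M" and eps: "\<epsilon> > 0"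
  shows "eventually_filled \<alpha> (spectrum {m..M} \<alpha>) (w0 + \<epsilon>) (w1 - \<epsilon>)"
proof -
  have "least_span \<le> M - m" using least_span_le[of "M - m"] mM by simp
  \<comment> \<open>A shortest subalphabet that contains \<open>0\<close> and a positive digit.\<close>
  define M' where "M' = min M least_span"
  have M': "1 \<le> M'" "M' \<le> least_span" "M' \<le> M" "m \<le> M' - least_span" using zero least_span_pos \<open>least_span \<le> M - m\<close> by (auto simp: M'_def)
  obtain s t where st: "\<beta> \<le> t - s"
    "\<forall>x\<in>L. (\<alpha> = \<beta> \<longrightarrow> 1 \<le> x) \<longrightarrow> s \<le> gal x \<longrightarrow> gal x \<le> t \<longrightarrow> x \<in> spectrum {M' - least_span..M'} \<alpha>"
    using core_interval[OF \<alpha>, of M' "M' - least_span"] M' by auto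
  have "spectrum {M' - least_span..M'} \<alpha> \<subseteq> spectrum {m..M} \<alpha>" using M' by (intro spectrum_mono) auto
  then have fill0: "eventually_filled \<alpha> (spectrum {m..M} \<alpha>) s t"
    unfolding eventually_filled_def using st(2) by blast
  define D where "D = max 0 (max (s - w0) (w1 - t))"
  have iter: "\<exists>s t. eventually_filled \<alpha> (spectrum {m..M} \<alpha>) s t \<and> \<beta> \<le> t - s \<and>
    s \<le> w0 + D / \<beta> ^ n \<and> w1 - D / \<beta> ^ n \<le> t" for n
  proof (induction n)
    case 0
    have "s \<le> w0 + D" "w1 - D \<le> t" by (auto simp: D_def)
    then show ?case using fill0 st(1) by auto
  next
    case (Suc n)
    then obtain s t where "eventually_filled \<alpha> (spectrum {m..M} \<alpha>) s t" "\<beta> \<le> t - s"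
      "s \<le> w0 + D / \<beta> ^ n" "w1 - D / \<beta> ^ n \<le> t" by blast
    from filled_interval_grows[OF \<alpha> win mM this] show ?case by (simp add: mult.commute)
  qed
  have "\<exists>n. D / \<beta> ^ n < \<epsilon>"
  proof -
    obtain n where n: "D / \<epsilon> < \<beta> ^ n" using real_arch_pow[OF beta_gt_1] by blast
    then have "D < \<epsilon> * \<beta> ^ n" using eps by (simp add: pos_divide_less_eq mult.commute)
    then show ?thesis using beta_gt_1 by (intro exI[of _ n]) (simp add: pos_divide_less_eq)
  qed
  then obtain n where n: "D / \<beta> ^ n < \<epsilon>" by blast
  obtain s t where "eventually_filled \<alpha> (spectrum {m..M} \<alpha>) s t" "s \<le> w0 + D / \<beta> ^ n" "w1 - D / \<beta> ^ n \<le> t"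
    using iter by blast
  then have *: "eventually_filled \<alpha> (spectrum {m..M} \<alpha>) s t" "s \<le> w0 + \<epsilon>" "w1 - \<epsilon> \<le> t" using n by linarith+
  then obtain C where "\<And>x. x \<in> L \<Longrightarrow> (\<alpha> = \<beta> \<longrightarrow> C \<le> x) \<Longrightarrow> s \<le> gal x \<Longrightarrow> gal x \<le> t \<Longrightarrow> x \<in> spectrum {m..M} \<alpha>"
    unfolding eventually_filled_def by blast
  then show ?thesis unfolding eventually_filled_def using *(2,3) by (intro exI[of _ C]) auto
qed

end

section \<open>Densities and frequencies\<close>

definition locally_finite :: "real set \<Rightarrow> bool" where
  "locally_finite X \<longleftrightarrow> (\<forall>a b. finite (X \<inter> {a..b}))"

lemma locally_finite_subset: "locally_finite X \<Longrightarrow> Y \<subseteq> X \<Longrightarrow> locally_finite Y"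
  unfolding locally_finite_def by (meson Int_mono finite_subset subset_refl)

lemma locally_finite_finite:
  assumes "locally_finite X" "S \<subseteq> X" "S \<subseteq> {a..b}" shows "finite S"
  using assms finite_subset[of S "X \<inter> {a..b}"] unfolding locally_finite_def by blast

lemma right_neighbour_consecutive:
  assumes "locally_finite X" "\<not> bdd_above X" "x \<in> X"
  shows "consecutive X x (right_neighbour X x)"
proof -
  obtain y\<^sub>0 where y0: "y\<^sub>0 \<in> X" "x < y\<^sub>0" using assms(2) by (meson bdd_above.I linorder_not_less)
  define S where "S = X \<inter> {x<..y\<^sub>0}"
  have S: "finite S"
    unfolding S_def by (rule locally_finite_finite[OF assms(1), of _ x "y\<^sub>0"]) auto
  have S: "finite S" "S \<noteq> {}" using S y0 by (auto simp: S_def)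
  have least: "Min S \<le> y" if "y \<in> X" "x < y" for y
  proof (cases "y \<le> y\<^sub>0")
    case True
    then show ?thesis using that S by (intro Min_le) (auto simp: S_def)
  next
    case False
    then show ?thesis using Min_in[OF S] by (auto simp: S_def)
  qed
  have mem: "Min S \<in> X" "x < Min S" using Min_in[OF S] by (auto simp: S_def)
  have "right_neighbour X x = Min S"
    unfolding right_neighbour_def by (rule Least_equality) (use mem least in auto)
  moreover have "consecutive X x (Min S)"
    unfolding consecutive_def using assms(3) mem least by fastforce
  ultimately show ?thesis by simp
qed

lemma consecutive_unique:
  assumes "consecutive X x y" "consecutive X x z" shows "y = z"
proof (rule ccontr)
  assume "y \<noteq> z"
  then consider "y < z" | "z < y" by linarith
  then show False using assms unfolding consecutive_def by cases auto
qed

definition has_density :: "real set \<Rightarrow> real \<Rightarrow> bool" where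
  "has_density Y d \<longleftrightarrow> ((\<lambda>R. real (card (Y \<inter> {0<..R})) / R) \<longlongrightarrow> d) at_top"

lemma card_diff_le:
  assumes "finite A" "finite B" "finite E" "A \<subseteq> B \<union> E" "B \<subseteq> A \<union> E"
  shows "\<bar>real (card A) - real (card B)\<bar> \<le> real (card E)"
proof -
  have "card A \<le> card B + card E" "card B \<le> card A + card E"
    using assms card_mono[of "B \<union> E" A] card_mono[of "A \<union> E" B] card_Un_le[of B E] card_Un_le[of A E]
    by (auto intro: order_trans)
  then show ?thesis by linarith
qed

lemma const_over_tendsto_0: "((\<lambda>R. c / R) \<longlongrightarrow> (0::real)) at_top"
  by (rule tendsto_divide_0[OF tendsto_const filterlim_at_top_imp_at_infinity[OF filterlim_ident]])

lemma null_comparison: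
  fixes f g :: "'a \<Rightarrow> real"
  assumes "\<forall>\<^sub>F x in F. norm (f x) \<le> g x" "(g \<longlongrightarrow> 0) F"
  shows "(f \<longlongrightarrow> 0) F"
  by (rule tendsto_0_le[OF assms(2), where K = 1]) (use assms(1) in eventually_elim, auto)

lemma density_bounded_perturbation:
  assumes "has_density Y d" "\<And>R. R > 0 \<Longrightarrow> \<bar>f R - real (card (Y \<inter> {0<..R}))\<bar> \<le> C"
  shows "((\<lambda>R. f R / R) \<longlongrightarrow> d) at_top"
proof -
  have "((\<lambda>R. f R / R - real (card (Y \<inter> {0<..R})) / R) \<longlongrightarrow> 0) at_top"
  proof (rule null_comparison[OF _ const_over_tendsto_0[of C]])
    show "\<forall>\<^sub>F R in at_top. norm (f R / R - real (card (Y \<inter> {0<..R})) / R) \<le> C / R"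
      using eventually_gt_at_top[of 0]
    proof eventually_elim
      case (elim R)
      then have "\<bar>f R - real (card (Y \<inter> {0<..R}))\<bar> / R \<le> C / R" using assms(2) by (intro divide_right_mono) auto
      then show ?case using elim by (simp add: diff_divide_distrib[symmetric])
    qed
  qed
  from tendsto_add[OF this assms(1)[unfolded has_density_def]] show ?thesis by simp
qed

lemma density_finite_change:
  assumes "has_density Y d" "locally_finite Y" "locally_finite Z" "\<And>x. x > C \<Longrightarrow> x \<in> Y \<longleftrightarrow> x \<in> Z"
  shows "has_density Z d"
  unfolding has_density_def
proof (rule density_bounded_perturbation[OF assms(1)])
  fix R :: real assume "R > 0"
  show "\<bar>real (card (Z \<inter> {0<..R})) - real (card (Y \<inter> {0<..R}))\<bar> \<le> real (card ((Y \<inter> {0..C}) \<union> (Z \<inter> {0..C})))"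
  proof (rule card_diff_le)
    show "finite (Z \<inter> {0<..R})" by (rule locally_finite_finite[OF assms(3), of _ 0 R]) auto
    show "finite (Y \<inter> {0<..R})" by (rule locally_finite_finite[OF assms(2), of _ 0 R]) auto
    show "finite ((Y \<inter> {0..C}) \<union> (Z \<inter> {0..C}))" using assms(2,3) by (simp add: locally_finite_def)
    have "x \<le> C" if "x \<in> Y \<longleftrightarrow> x \<notin> Z" for x using assms(4)[of x] that by (cases "C < x") auto
    then show "Z \<inter> {0<..R} \<subseteq> Y \<inter> {0<..R} \<union> (Y \<inter> {0..C} \<union> Z \<inter> {0..C})"
      "Y \<inter> {0<..R} \<subseteq> Z \<inter> {0<..R} \<union> (Y \<inter> {0..C} \<union> Z \<inter> {0..C})" by auto
  qed
qed

lemma density_Diff: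
  assumes "has_density X d" "has_density Y d'" "Y \<subseteq> X" "locally_finite X"
  shows "has_density (X - Y) (d - d')"
proof -
  have "real (card ((X - Y) \<inter> {0<..R})) / R = real (card (X \<inter> {0<..R})) / R - real (card (Y \<inter> {0<..R})) / R" for R
  proof -
    have fin: "finite (X \<inter> {0<..R})" by (rule locally_finite_finite[OF assms(4), of _ 0 R]) auto
    have sub: "Y \<inter> {0<..R} \<subseteq> X \<inter> {0<..R}" using assms(3) by auto
    have "(X - Y) \<inter> {0<..R} = (X \<inter> {0<..R}) - (Y \<inter> {0<..R})" by auto
    then have "card ((X - Y) \<inter> {0<..R}) = card (X \<inter> {0<..R}) - card (Y \<inter> {0<..R})"
      using card_Diff_subset[OF finite_subset[OF sub fin] sub] by simp
    then show ?thesis using card_mono[OF fin sub] by (simp add: of_nat_diff diff_divide_distrib)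
  qed
  then show ?thesis using tendsto_diff[OF assms(1,2)[unfolded has_density_def]] unfolding has_density_def by simp
qed

lemma density_pos_unbounded:
  assumes "has_density X d" "d > 0" "locally_finite X"
  shows "\<not> bdd_above X"
proof
  assume "bdd_above X"
  then obtain C where C: "\<And>x. x \<in> X \<Longrightarrow> x \<le> C" by (auto simp: bdd_above_def)
  have "has_density {} 0" by (simp add: has_density_def)
  moreover have "locally_finite {}" by (simp add: locally_finite_def)
  moreover have "x \<in> {} \<longleftrightarrow> x \<in> X" if "x > C" for x using C[of x] that by auto
  ultimately have "has_density X 0" using density_finite_change assms(3) by blast
  then have "d = 0" using assms(1) unfolding has_density_def by (meson tendsto_unique trivial_limit_at_top_linorder)
  then show False using assms(2) by simp
qed

text \<open>Listing the points of X to the right of x_0 as s_0 < s_1 < ..., the number of points of a set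
Z \<subseteq> X among the first n is the number of points of Z below s_n, that is d_Z s_n asymptotically.  The quotient
for Z = Y and Z = X is the frequency.\<close>

lemma frequency_from_density:
  assumes fin: "locally_finite X" and x0: "x\<^sub>0 \<in> X"
    and dX: "has_density X dX" "dX > 0" and dY: "has_density Y dY" "Y \<subseteq> X"
    and gap: "\<And>x. x \<in> X \<Longrightarrow> x > C \<Longrightarrow> right_neighbour X x - x = g \<longleftrightarrow> x \<in> Y"
  shows "has_frequency (gap_word X x\<^sub>0) g (dY / dX)"
proof -
  have unb: "\<not> bdd_above X" by (rule density_pos_unbounded[OF dX fin])
  define s where "s i = (right_neighbour X ^^ i) x\<^sub>0" for i
  have word: "gap_word X x\<^sub>0 i = right_neighbour X (s i) - s i" for i
    using unb by (simp add: gap_word_def s_def)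
  have sX: "s i \<in> X" for i
    by (induction i) (use x0 right_neighbour_consecutive[OF fin unb] in \<open>auto simp: s_def consecutive_def\<close>)
  have cons: "consecutive X (s i) (s (Suc i))" for i
    using right_neighbour_consecutive[OF fin unb sX[of i]] by (simp add: s_def)
  have smono: "strict_mono s" by (rule strict_mono_Suc_iff[THEN iffD2]) (use cons in \<open>auto simp: consecutive_def\<close>)
  have range: "X \<inter> {x\<^sub>0..<s n} = s ` {..<n}" for n
  proof (induction n)
    case 0
    then show ?case by (auto simp: s_def)
  next
    case (Suc n)
    have "x\<^sub>0 \<le> s n" using strict_mono_less_eq[OF smono, of 0 n] by (simp add: s_def)
    then have "X \<inter> {x\<^sub>0..<s (Suc n)} = X \<inter> {x\<^sub>0..<s n} \<union> {s n}"
      using cons[of n] unfolding consecutive_def by fastforce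
    then show ?case using Suc by (auto simp: lessThan_Suc)
  qed
  have count: "card {i. i < n \<and> s i \<in> Z} = card (Z \<inter> {x\<^sub>0..<s n})" if "Z \<subseteq> X" for n Z
  proof -
    have "Z \<inter> {x\<^sub>0..<s n} = Z \<inter> (X \<inter> {x\<^sub>0..<s n})" using that by auto
    also have "\<dots> = s ` {i. i < n \<and> s i \<in> Z}" unfolding range by auto
    finally have "Z \<inter> {x\<^sub>0..<s n} = s ` {i. i < n \<and> s i \<in> Z}" .
    moreover have "inj_on s {i. i < n \<and> s i \<in> Z}"
      by (rule strict_mono_imp_inj_on[OF smono])
    ultimately show ?thesis by (simp add: card_image)
  qed
  have s_top: "filterlim s at_top sequentially"
    unfolding filterlim_at_top
  proof
    fix Z :: real
    have "\<exists>n. Z \<le> s n"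
    proof (rule ccontr)
      assume "\<nexists>n. Z \<le> s n"
      then have "range s \<subseteq> X \<inter> {x\<^sub>0..Z}"
        using sX strict_mono_less_eq[OF smono, of 0] by (auto simp: s_def not_le less_imp_le)
      then have "finite (range s)" using fin finite_subset unfolding locally_finite_def by blast
      then have "finite (UNIV :: nat set)" by (rule finite_imageD) (rule strict_mono_imp_inj_on[OF smono])
      then show False by simp
    qed
    then obtain n where "Z \<le> s n" by blast
    then show "\<forall>\<^sub>F i in sequentially. Z \<le> s i"
      unfolding eventually_sequentially using strict_mono_less_eq[OF smono] by (meson order_trans)
  qed
  have lim: "(\<lambda>n. real (card {i. i < n \<and> s i \<in> Z}) / s n) \<longlonglongrightarrow> d" if "has_density Z d" "Z \<subseteq> X" for Z d
  proof -
    have finZ: "locally_finite Z" by (rule locally_finite_subset[OF fin that(2)])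
    have "((\<lambda>R. real (card (Z \<inter> {x\<^sub>0..<R})) / R) \<longlongrightarrow> d) at_top"
    proof (rule density_bounded_perturbation[OF that(1)])
      fix R :: real assume "R > 0"
      have E: "finite (Z \<inter> {-\<bar>x\<^sub>0\<bar>..\<bar>x\<^sub>0\<bar>})" using finZ by (simp add: locally_finite_def)
      have "\<bar>real (card (Z \<inter> {x\<^sub>0..<R})) - real (card (Z \<inter> {0<..R}))\<bar> \<le> real (card (insert R (Z \<inter> {-\<bar>x\<^sub>0\<bar>..\<bar>x\<^sub>0\<bar>})))"
      proof (rule card_diff_le)
        show "finite (Z \<inter> {x\<^sub>0..<R})" by (rule locally_finite_finite[OF finZ, of _ "x\<^sub>0" R]) auto
        show "finite (Z \<inter> {0<..R})" by (rule locally_finite_finite[OF finZ, of _ 0 R]) auto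
      qed (use E in auto)
      also have "\<dots> \<le> real (Suc (card (Z \<inter> {-\<bar>x\<^sub>0\<bar>..\<bar>x\<^sub>0\<bar>})))" using E by (simp add: card_insert_if)
      finally show "\<bar>real (card (Z \<inter> {x\<^sub>0..<R})) - real (card (Z \<inter> {0<..R}))\<bar> \<le> real (Suc (card (Z \<inter> {-\<bar>x\<^sub>0\<bar>..\<bar>x\<^sub>0\<bar>})))" .
    qed
    from filterlim_compose[OF this s_top] show ?thesis by (simp add: count[OF that(2)])
  qed
  have "(\<lambda>n. real n / s n) \<longlonglongrightarrow> dX" using lim[OF dX(1) subset_refl] sX by simp
  then have "(\<lambda>n. (real (card {i. i < n \<and> s i \<in> Y}) / s n) / (real n / s n)) \<longlonglongrightarrow> dY / dX"
    by (intro tendsto_divide lim dY) (use dX in auto)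
  moreover have "\<forall>\<^sub>F n in sequentially. (real (card {i. i < n \<and> s i \<in> Y}) / s n) / (real n / s n) = real (card {i. i < n \<and> s i \<in> Y}) / real n"
    using filterlim_at_top_dense[THEN iffD1, OF s_top, rule_format, of 0] by eventually_elim simp
  ultimately have limY: "(\<lambda>n. real (card {i. i < n \<and> s i \<in> Y}) / real n) \<longlonglongrightarrow> dY / dX"
    by (rule Lim_transform_eventually)
  obtain n0 where n0: "\<And>i. i \<ge> n0 \<Longrightarrow> s i > C"
    using filterlim_at_top_dense[THEN iffD1, OF s_top] unfolding eventually_sequentially by blast
  have "(\<lambda>n. real (card {i. i < n \<and> gap_word X x\<^sub>0 i = g}) / real n - real (card {i. i < n \<and> s i \<in> Y}) / real n) \<longlonglongrightarrow> 0"
  proof (rule null_comparison)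
    show "\<forall>\<^sub>F n in sequentially. norm (real (card {i. i < n \<and> gap_word X x\<^sub>0 i = g}) / real n - real (card {i. i < n \<and> s i \<in> Y}) / real n) \<le> real n0 / real n"
    proof (rule always_eventually, rule allI)
      fix n
      have "\<bar>real (card {i. i < n \<and> gap_word X x\<^sub>0 i = g}) - real (card {i. i < n \<and> s i \<in> Y})\<bar> \<le> real (card {..<n0})"
      proof (rule card_diff_le)
        have iff: "gap_word X x\<^sub>0 i = g \<longleftrightarrow> s i \<in> Y" if "\<not> i < n0" for i
          using gap[OF sX n0] that by (simp add: word)
        show "{i. i < n \<and> gap_word X x\<^sub>0 i = g} \<subseteq> {i. i < n \<and> s i \<in> Y} \<union> {..<n0}"
          "{i. i < n \<and> s i \<in> Y} \<subseteq> {i. i < n \<and> gap_word X x\<^sub>0 i = g} \<union> {..<n0}" using iff by auto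
      qed auto
      then have "\<bar>real (card {i. i < n \<and> gap_word X x\<^sub>0 i = g}) - real (card {i. i < n \<and> s i \<in> Y})\<bar> / real n \<le> real n0 / real n"
        by (intro divide_right_mono) auto
      then show "norm (real (card {i. i < n \<and> gap_word X x\<^sub>0 i = g}) / real n - real (card {i. i < n \<and> s i \<in> Y}) / real n) \<le> real n0 / real n"
        by (simp add: diff_divide_distrib[symmetric])
    qed
    show "(\<lambda>n. real n0 / real n) \<longlonglongrightarrow> 0" by (rule lim_const_over_n)
  qed
  from tendsto_add[OF this limY] show ?thesis by (simp add: has_frequency_def)
qed

section \<open>Gaps of a set that fills a strip\<close>

lemma limit_of_linear_error:
  fixes f :: "real \<Rightarrow> real"
  assumes "\<And>\<delta>. \<delta> > 0 \<Longrightarrow> \<exists>C. \<forall>R\<ge>0. \<bar>f R - d * R\<bar> \<le> \<delta> * R + C"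
  shows "((\<lambda>R. f R / R) \<longlongrightarrow> d) at_top"
proof (rule tendstoI)
  fix \<eta> :: real assume eta: "\<eta> > 0"
  then obtain C where C: "\<And>R. R \<ge> 0 \<Longrightarrow> \<bar>f R - d * R\<bar> \<le> \<eta> / 2 * R + C" using assms[of "\<eta> / 2"] by auto
  have "\<forall>\<^sub>F R in at_top. C / R < \<eta> / 2" 
    using order_tendstoD(2)[OF const_over_tendsto_0[of C], of "\<eta> / 2"] eta by simp
  then show "\<forall>\<^sub>F R in at_top. dist (f R / R) d < \<eta>" using eventually_gt_at_top[of 0]
  proof eventually_elim
    case (elim R)
    have "f R / R - d = (f R - d * R) / R" using elim by (simp add: diff_divide_distrib)
    then have "dist (f R / R) d = \<bar>f R - d * R\<bar> / R" using elim by (simp add: dist_real_def abs_divide)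
    also have "\<dots> \<le> (\<eta> / 2 * R + C) / R" using C elim by (intro divide_right_mono) auto
    also have "\<dots> = \<eta> / 2 + C / R" using elim by (simp add: add_divide_distrib)
    finally show ?case using elim by linarith
  qed
qed

context quadratic_unit begin

lemma strip_density: "s \<le> t \<Longrightarrow> has_density (strip s t) ((t - s) / \<kappa>)"
  unfolding has_density_def by (rule limit_of_linear_error) (rule card_strip)

lemma locally_finite_strip: "locally_finite (strip s t)"
  unfolding locally_finite_def using finite_strip by blast

text \<open>Multiplying conjugates by the sign \<tau> allows \<Delta>_1 to have a positive conjugate for every l.\<close>

definition signed_strip :: "real \<Rightarrow> real \<Rightarrow> real \<Rightarrow> real set" where
  "signed_strip \<tau> s t = {z \<in> L. s \<le> \<tau> * gal z \<and> \<tau> * gal z \<le> t}"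

lemma signed_strip_eq:
  assumes "\<tau> = 1 \<or> \<tau> = -1"
  shows "signed_strip \<tau> s t = (if \<tau> = 1 then strip s t else strip (- t) (- s))"
  using assms by (auto simp: signed_strip_def strip_def)

lemma signed_strip_density:
  assumes "\<tau> = 1 \<or> \<tau> = -1" "s \<le> t"
  shows "has_density (signed_strip \<tau> s t) ((t - s) / \<kappa>)"
  using strip_density[of s t] strip_density[of "- t" "- s"] assms by (auto simp: signed_strip_eq)

lemma locally_finite_signed_strip:
  assumes "\<tau> = 1 \<or> \<tau> = -1" shows "locally_finite (signed_strip \<tau> s t)"
  using locally_finite_strip by (simp add: signed_strip_eq[OF assms])

text \<open>Missing points near the boundary of the strip do not affect the density: strips narrower by
2\<epsilon> are contained in the set up to finitely many points, and their density tends to that of the full strip.\<close>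

lemma density_of_almost_strip:
  assumes tau: "\<tau> = 1 \<or> \<tau> = -1" and st: "s < t" and sub: "Y \<subseteq> signed_strip \<tau> s t"
    and fill: "\<And>\<epsilon>. \<epsilon> > 0 \<Longrightarrow> \<exists>C. \<forall>x \<in> signed_strip \<tau> (s + \<epsilon>) (t - \<epsilon>). C \<le> x \<longrightarrow> x \<in> Y"
  shows "has_density Y ((t - s) / \<kappa>)"
  unfolding has_density_def
proof (rule order_tendstoI)
  have finS: "finite (signed_strip \<tau> s t \<inter> {0<..R})" for s t R
    by (rule locally_finite_finite[OF locally_finite_signed_strip[OF tau], of _ s t 0 R]) auto
  {
    fix a assume a: "(t - s) / \<kappa> < a"
    have "\<forall>\<^sub>F R in at_top. real (card (signed_strip \<tau> s t \<inter> {0<..R})) / R < a"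
      using order_tendstoD(2)[OF signed_strip_density[OF tau less_imp_le[OF st], unfolded has_density_def] a] .
    then show "\<forall>\<^sub>F R in at_top. real (card (Y \<inter> {0<..R})) / R < a" using eventually_gt_at_top[of 0]
    proof eventually_elim
      case (elim R)
      have "card (Y \<inter> {0<..R}) \<le> card (signed_strip \<tau> s t \<inter> {0<..R})" by (rule card_mono[OF finS]) (use sub in auto)
      then have "real (card (Y \<inter> {0<..R})) / R \<le> real (card (signed_strip \<tau> s t \<inter> {0<..R})) / R"
        using elim by (intro divide_right_mono) auto
      then show ?case using elim by simp
    qed
  next
    fix a assume a: "a < (t - s) / \<kappa>"
    then have "t - s - a * \<kappa> > 0" using kappa_pos by (simp add: pos_less_divide_eq)
    define \<epsilon> where "\<epsilon> = min (t - s) (t - s - a * \<kappa>) / 4"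
    have eps: "\<epsilon> > 0" "2 * \<epsilon> < t - s" "2 * \<epsilon> < t - s - a * \<kappa>"
      using st \<open>t - s - a * \<kappa> > 0\<close> by (auto simp: \<epsilon>_def min_def)
    let ?S = "signed_strip \<tau> (s + \<epsilon>) (t - \<epsilon>)"
    obtain C where C: "\<And>x. x \<in> ?S \<Longrightarrow> C \<le> x \<Longrightarrow> x \<in> Y" using fill[OF eps(1)] by blast
    have finC: "finite (?S \<inter> {0..C})" using locally_finite_signed_strip[OF tau] by (simp add: locally_finite_def)
    have "((t - \<epsilon>) - (s + \<epsilon>)) / \<kappa> > a" using eps(3) kappa_pos by (simp add: pos_less_divide_eq)
    moreover have "has_density ?S (((t - \<epsilon>) - (s + \<epsilon>)) / \<kappa>)" by (rule signed_strip_density[OF tau]) (use eps in simp)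
    then have "((\<lambda>R. real (card (?S \<inter> {0<..R})) / R - real (card (?S \<inter> {0..C})) / R) \<longlongrightarrow> ((t - \<epsilon>) - (s + \<epsilon>)) / \<kappa> - 0) at_top"
      unfolding has_density_def by (rule tendsto_diff[OF _ const_over_tendsto_0])
    ultimately have "\<forall>\<^sub>F R in at_top. a < real (card (?S \<inter> {0<..R})) / R - real (card (?S \<inter> {0..C})) / R"
      by (intro order_tendstoD(1)) auto
    then show "\<forall>\<^sub>F R in at_top. a < real (card (Y \<inter> {0<..R})) / R" using eventually_gt_at_top[of 0]
    proof eventually_elim
      case (elim R)
      have finY: "finite (Y \<inter> {0<..R})" by (rule finite_subset[OF _ finS[of s t R]]) (use sub in auto)
      have "card (?S \<inter> {0<..R}) \<le> card (Y \<inter> {0<..R} \<union> ?S \<inter> {0..C})"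
        by (rule card_mono) (use finY finC C in \<open>auto simp: not_le less_imp_le\<close>)
      also have "\<dots> \<le> card (Y \<inter> {0<..R}) + card (?S \<inter> {0..C})" by (rule card_Un_le)
      finally have "real (card (?S \<inter> {0<..R})) - real (card (?S \<inter> {0..C})) \<le> real (card (Y \<inter> {0<..R}))" by simp
      then have "(real (card (?S \<inter> {0<..R})) - real (card (?S \<inter> {0..C}))) / R \<le> real (card (Y \<inter> {0<..R})) / R"
        using elim by (intro divide_right_mono) auto
      then show ?case using elim by (simp add: diff_divide_distrib)
    qed
  }
qed

end

text \<open>Two steps whose (signed) conjugates a > 0 and -b < 0 are shorter than the window, but together at least as long.\<close>

locale three_gap_model = quadratic_unit +
  fixes \<tau> \<Delta>\<^sub>1 \<Delta>\<^sub>2 a b o\<^sub>0 o\<^sub>1 :: real and X :: "real set"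
  assumes tau: "\<tau> = 1 \<or> \<tau> = -1"
    and D1: "\<Delta>\<^sub>1 \<in> L" "0 < \<Delta>\<^sub>1" "\<tau> * gal \<Delta>\<^sub>1 = a"
    and D2: "\<Delta>\<^sub>2 \<in> L" "0 < \<Delta>\<^sub>2" "\<tau> * gal \<Delta>\<^sub>2 = - b"
    and gen: "\<And>z. z \<in> L \<Longrightarrow> \<exists>r s :: int. z = of_int r * \<Delta>\<^sub>1 + of_int s * \<Delta>\<^sub>2"
    and ab: "0 < a" "0 < b" "a < o\<^sub>1 - o\<^sub>0" "b < o\<^sub>1 - o\<^sub>0" "o\<^sub>1 - o\<^sub>0 \<le> a + b"
    and X_strip: "X \<subseteq> signed_strip \<tau> o\<^sub>0 o\<^sub>1"
begin

definition h :: "real \<Rightarrow> real" where "h x = \<tau> * gal x"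

lemma in_signed_strip: "x \<in> signed_strip \<tau> s t \<longleftrightarrow> x \<in> L \<and> s \<le> h x \<and> h x \<le> t"
  by (simp add: signed_strip_def h_def)

lemma X_L: "x \<in> X \<Longrightarrow> x \<in> L" and X_h: "x \<in> X \<Longrightarrow> o\<^sub>0 \<le> h x \<and> h x \<le> o\<^sub>1"
  using X_strip in_signed_strip by blast+

lemma h_add: "x \<in> L \<Longrightarrow> y \<in> L \<Longrightarrow> h (x + y) = h x + h y"
  by (simp add: h_def gal_add algebra_simps)

lemma h_diff: "x \<in> L \<Longrightarrow> y \<in> L \<Longrightarrow> h (x - y) = h x - h y"
  by (simp add: h_def gal_diff algebra_simps)

lemma h_comb: "h (of_int r * \<Delta>\<^sub>1 + of_int s * \<Delta>\<^sub>2) = of_int r * a - of_int s * b"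
proof -
  have "gal (of_int r * \<Delta>\<^sub>1 + of_int s * \<Delta>\<^sub>2) = of_int r * gal \<Delta>\<^sub>1 + of_int s * gal \<Delta>\<^sub>2"
    by (simp add: gal_add gal_mult gal_of_int L_of_int L_mult D1 D2)
  then have "h (of_int r * \<Delta>\<^sub>1 + of_int s * \<Delta>\<^sub>2) = of_int r * (\<tau> * gal \<Delta>\<^sub>1) + of_int s * (\<tau> * gal \<Delta>\<^sub>2)"
    by (simp add: h_def algebra_simps)
  then show ?thesis unfolding D1 D2 by simp
qed

lemma h_inj: "x \<in> L \<Longrightarrow> y \<in> L \<Longrightarrow> h x = h y \<Longrightarrow> x = y"
  using tau gal_inj by (auto simp: h_def)

lemma X_locally_finite: "locally_finite X"
  by (rule locally_finite_subset[OF locally_finite_signed_strip[OF tau] X_strip])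

text \<open>Conjugation is injective, so each end point of the window is the conjugate of at most one point.\<close>

lemma inner_far: "\<exists>C. \<forall>x\<in>X. C < \<bar>x\<bar> \<longrightarrow> o\<^sub>0 < h x \<and> h x < o\<^sub>1"
proof -
  have one: "\<exists>C. \<forall>x\<in>X. C < \<bar>x\<bar> \<longrightarrow> h x \<noteq> w" for w
  proof (cases "\<exists>y\<in>X. h y = w")
    case True
    then obtain y where "y \<in> X" "h y = w" by blast
    then show ?thesis using h_inj X_L by (intro exI[of _ "\<bar>y\<bar>"]) (metis less_irrefl)
  next
    case False
    then show ?thesis by blast
  qed
  obtain C0 C1 where "\<And>x. x \<in> X \<Longrightarrow> C0 < \<bar>x\<bar> \<Longrightarrow> h x \<noteq> o\<^sub>0" "\<And>x. x \<in> X \<Longrightarrow> C1 < \<bar>x\<bar> \<Longrightarrow> h x \<noteq> o\<^sub>1"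
    using one[of "o\<^sub>0"] one[of "o\<^sub>1"] by blast
  then show ?thesis using X_h by (intro exI[of _ "max C0 C1"]) (metis less_eq_real_def max_less_iff_conj)
qed

text \<open>Steps of opposite signs would move the conjugate by at least a + b, hence out of the window.\<close>

lemma step_coordinates:
  assumes "x \<in> L" "y \<in> L" "x < y" "o\<^sub>0 < h x" "h x < o\<^sub>1" "o\<^sub>0 < h y" "h y < o\<^sub>1"
  shows "\<exists>r s :: int. r \<ge> 0 \<and> s \<ge> 0 \<and> y = x + of_int r * \<Delta>\<^sub>1 + of_int s * \<Delta>\<^sub>2 \<and> h y = h x + of_int r * a - of_int s * b"
proof -
  obtain r s :: int where rs: "y - x = of_int r * \<Delta>\<^sub>1 + of_int s * \<Delta>\<^sub>2" using gen[OF L_diff] assms by blast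
  then have hd: "h y - h x = of_int r * a - of_int s * b" using h_comb[of r s] h_diff[OF assms(2,1)] by simp
  have nonpos: "of_int k * c \<le> 0" if "k \<le> 0" "0 < c" for k :: int and c :: real
    using that by (simp add: mult_nonpos_nonneg)
  have ge: "of_int k * c \<ge> c" if "k \<ge> 1" "0 < c" for k :: int and c :: real
    using that mult_right_mono[of 1 "of_int k" c] by simp
  have le: "of_int k * c \<le> - c" if "k \<le> -1" "0 < c" for k :: int and c :: real
    using that mult_right_mono[of "of_int k" "-1" c] by simp
  have "\<not> (r \<ge> 1 \<and> s \<le> -1)"
  proof
    assume "r \<ge> 1 \<and> s \<le> -1"
    then have "of_int r * a \<ge> a" "of_int s * b \<le> - b" using ge[of r a] le[of s b] ab by auto
    then show False using hd ab assms by linarith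
  qed
  moreover have "\<not> (r \<le> -1 \<and> s \<ge> 1)"
  proof
    assume "r \<le> -1 \<and> s \<ge> 1"
    then have "of_int r * a \<le> - a" "of_int s * b \<ge> b" using le[of r a] ge[of s b] ab by auto
    then show False using hd ab assms by linarith
  qed
  moreover have "\<not> (r \<le> 0 \<and> s \<le> 0)"
    using nonpos[of r "\<Delta>\<^sub>1"] nonpos[of s "\<Delta>\<^sub>2"] D1 D2 rs assms by linarith
  ultimately have "r \<ge> 0 \<and> s \<ge> 0" by linarith
  moreover have "y = x + of_int r * \<Delta>\<^sub>1 + of_int s * \<Delta>\<^sub>2" using rs by linarith
  moreover have "h y = h x + of_int r * a - of_int s * b" using hd by linarith
  ultimately show ?thesis by blast
qed

text \<open>Chosen so that a move of length a or b away from an end of the window, starting within this distance of that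
end, lands at no less than this distance from both ends.\<close>

definition margin :: real where
  "margin = min (min a b) (min ((o\<^sub>1 - o\<^sub>0 - a) / 2) ((o\<^sub>1 - o\<^sub>0 - b) / 2))"

lemma margin: "margin > 0" "margin \<le> a" "margin \<le> b" "2 * margin \<le> o\<^sub>1 - o\<^sub>0 - a" "2 * margin \<le> o\<^sub>1 - o\<^sub>0 - b"
proof -
  show "margin > 0" "margin \<le> a" "margin \<le> b" using ab by (auto simp: margin_def)
  have "margin \<le> (o\<^sub>1 - o\<^sub>0 - a) / 2" "margin \<le> (o\<^sub>1 - o\<^sub>0 - b) / 2"
    unfolding margin_def by (simp_all only: min_le_iff_disj order_refl simp_thms)
  then show "2 * margin \<le> o\<^sub>1 - o\<^sub>0 - a" "2 * margin \<le> o\<^sub>1 - o\<^sub>0 - b" by simp_all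
qed

text \<open>Let the move from x to y be other than the three listed ones.  If only one kind of step occurs in it, the first step
lands in the inner part of the window.  Otherwise all of x + \<Delta>_1, x + \<Delta>_2, x + \<Delta>_1 + \<Delta>_2 lie
before y.  If the first is not in the inner part, it is too high, and if the second is not, it is too low; but then
the third is.\<close>

lemma gap_values:
  assumes "x \<in> L" "y \<in> L" "x < y" "o\<^sub>0 < h x" "h x < o\<^sub>1" "o\<^sub>0 < h y" "h y < o\<^sub>1"
    and none: "\<And>z. z \<in> L \<Longrightarrow> x < z \<Longrightarrow> z < y \<Longrightarrow> o\<^sub>0 + margin \<le> h z \<Longrightarrow> h z \<le> o\<^sub>1 - margin \<Longrightarrow> False"
  shows "y - x \<in> {\<Delta>\<^sub>1, \<Delta>\<^sub>2, \<Delta>\<^sub>1 + \<Delta>\<^sub>2}"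
proof -
  obtain r s :: int where rs: "r \<ge> 0" "s \<ge> 0" "y = x + of_int r * \<Delta>\<^sub>1 + of_int s * \<Delta>\<^sub>2" "h y = h x + of_int r * a - of_int s * b"
    using step_coordinates assms by blast
  have mono: "of_int k * c \<le> of_int k' * c" if "k \<le> k'" "0 < c" for k k' :: int and c :: real
    using that by (simp add: mult_right_mono)
  have h1: "h (x + \<Delta>\<^sub>1) = h x + a" "x + \<Delta>\<^sub>1 \<in> L" and h2: "h (x + \<Delta>\<^sub>2) = h x - b" "x + \<Delta>\<^sub>2 \<in> L"
    and h3: "h (x + (\<Delta>\<^sub>1 + \<Delta>\<^sub>2)) = h x + a - b" "x + (\<Delta>\<^sub>1 + \<Delta>\<^sub>2) \<in> L"
    using h_add assms(1) D1 D2 L_add by (auto simp: h_def)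
  note m = margin
  consider "r = 0" "s = 0" | "r = 1" "s = 0" | "r = 0" "s = 1" | "r = 1" "s = 1"
    | "r \<ge> 2" "s = 0" | "r = 0" "s \<ge> 2" | "r \<ge> 1" "s \<ge> 1" "r \<ge> 2 \<or> s \<ge> 2"
    using rs(1,2) by linarith
  then show ?thesis
  proof cases
    case 5
    then have "2 * \<Delta>\<^sub>1 \<le> of_int r * \<Delta>\<^sub>1" "2 * a \<le> of_int r * a"
      using mono[of 2 r "\<Delta>\<^sub>1"] mono[of 2 r a] D1 ab by auto
    moreover have "of_int s * \<Delta>\<^sub>2 = 0" "of_int s * b = 0" using 5 by simp_all
    ultimately have "x + \<Delta>\<^sub>1 < y" "o\<^sub>0 + margin \<le> h x + a" "h x + a \<le> o\<^sub>1 - margin"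
      using rs(3,4) D1(2) assms(4-7) m by linarith+
    then have False using none[OF h1(2)] h1(1) D1(2) by simp
    then show ?thesis ..
  next
    case 6
    then have "2 * \<Delta>\<^sub>2 \<le> of_int s * \<Delta>\<^sub>2" "2 * b \<le> of_int s * b"
      using mono[of 2 s "\<Delta>\<^sub>2"] mono[of 2 s b] D2 ab by auto
    moreover have "of_int r * \<Delta>\<^sub>1 = 0" "of_int r * a = 0" using 6 by simp_all
    ultimately have "x + \<Delta>\<^sub>2 < y" "o\<^sub>0 + margin \<le> h x - b" "h x - b \<le> o\<^sub>1 - margin"
      using rs(3,4) D2(2) assms(4-7) m by linarith+
    then have False using none[OF h2(2)] h2(1) D2(2) by simp
    then show ?thesis ..
  next
    case 1 then show ?thesis using rs assms by simp
  next
    case 2 then show ?thesis using rs by simp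
  next
    case 3 then show ?thesis using rs by simp
  next
    case 4 then show ?thesis using rs by simp
  next
    case 7
    then have "1 * \<Delta>\<^sub>2 \<le> of_int s * \<Delta>\<^sub>2" "1 * \<Delta>\<^sub>1 \<le> of_int r * \<Delta>\<^sub>1"
      using mono[of 1 s "\<Delta>\<^sub>2"] mono[of 1 r "\<Delta>\<^sub>1"] D1 D2 by auto
    moreover have "2 * \<Delta>\<^sub>1 \<le> of_int r * \<Delta>\<^sub>1 \<or> 2 * \<Delta>\<^sub>2 \<le> of_int s * \<Delta>\<^sub>2"
      using 7(3) mono[of 2 s "\<Delta>\<^sub>2"] mono[of 2 r "\<Delta>\<^sub>1"] D1 D2 by auto
    ultimately have y: "x + (\<Delta>\<^sub>1 + \<Delta>\<^sub>2) < y" using rs(3) D1 D2 by linarith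
    have "h x + a > o\<^sub>1 - margin" using none[OF h1(2)] h1(1) y D1(2) D2(2) assms(4) m by force
    moreover have "h x - b < o\<^sub>0 + margin" using none[OF h2(2)] h2(1) y D1(2) D2(2) assms(5) m by force
    ultimately have False using none[OF h3(2)] h3(1) y D1(2) D2(2) m by force
    then show ?thesis ..
  qed
qed

definition fills_right :: bool where
  "fills_right \<longleftrightarrow> (\<forall>\<epsilon>>0. \<exists>C. \<forall>x \<in> signed_strip \<tau> (o\<^sub>0 + \<epsilon>) (o\<^sub>1 - \<epsilon>). C \<le> x \<longrightarrow> x \<in> X)"

definition fills_left :: bool where
  "fills_left \<longleftrightarrow> (\<forall>\<epsilon>>0. \<exists>C. \<forall>x \<in> signed_strip \<tau> (o\<^sub>0 + \<epsilon>) (o\<^sub>1 - \<epsilon>). x \<le> C \<longrightarrow> x \<in> X)"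

lemma gaps_right:
  assumes "fills_right"
  shows "\<exists>C. \<forall>x y. consecutive X x y \<longrightarrow> C < x \<longrightarrow> y - x \<in> {\<Delta>\<^sub>1, \<Delta>\<^sub>2, \<Delta>\<^sub>1 + \<Delta>\<^sub>2}"
proof -
  obtain C0 where C0: "\<And>x. x \<in> X \<Longrightarrow> C0 < \<bar>x\<bar> \<Longrightarrow> o\<^sub>0 < h x \<and> h x < o\<^sub>1" using inner_far by blast
  obtain C1 where C1: "\<And>x. x \<in> signed_strip \<tau> (o\<^sub>0 + margin) (o\<^sub>1 - margin) \<Longrightarrow> C1 \<le> x \<Longrightarrow> x \<in> X"
    using assms margin(1) unfolding fills_right_def by blast
  have "y - x \<in> {\<Delta>\<^sub>1, \<Delta>\<^sub>2, \<Delta>\<^sub>1 + \<Delta>\<^sub>2}" if "consecutive X x y" "max C0 C1 < x" for x y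
  proof (rule gap_values)
    have xy: "x \<in> X" "y \<in> X" "x < y" "X \<inter> {x<..<y} = {}" using that(1) by (auto simp: consecutive_def)
    show "x \<in> L" "y \<in> L" "x < y" using xy X_L by auto
    have "C0 < \<bar>x\<bar>" "C0 < \<bar>y\<bar>" using that(2) xy(3) by linarith+
    then show "o\<^sub>0 < h x" "h x < o\<^sub>1" "o\<^sub>0 < h y" "h y < o\<^sub>1" using C0 xy by auto
    fix z assume z: "z \<in> L" "x < z" "z < y" "o\<^sub>0 + margin \<le> h z" "h z \<le> o\<^sub>1 - margin"
    have "z \<in> X" by (rule C1) (use z that(2) in \<open>auto simp: in_signed_strip\<close>)
    then show False using xy z by auto
  qed
  then show ?thesis by blast
qed

lemma gaps_left:
  assumes "fills_left"
  shows "\<exists>C. \<forall>x y. consecutive X x y \<longrightarrow> y < C \<longrightarrow> y - x \<in> {\<Delta>\<^sub>1, \<Delta>\<^sub>2, \<Delta>\<^sub>1 + \<Delta>\<^sub>2}"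
proof -
  obtain C0 where C0: "\<And>x. x \<in> X \<Longrightarrow> C0 < \<bar>x\<bar> \<Longrightarrow> o\<^sub>0 < h x \<and> h x < o\<^sub>1" using inner_far by blast
  obtain C1 where C1: "\<And>x. x \<in> signed_strip \<tau> (o\<^sub>0 + margin) (o\<^sub>1 - margin) \<Longrightarrow> x \<le> C1 \<Longrightarrow> x \<in> X"
    using assms margin(1) unfolding fills_left_def by blast
  have "y - x \<in> {\<Delta>\<^sub>1, \<Delta>\<^sub>2, \<Delta>\<^sub>1 + \<Delta>\<^sub>2}" if "consecutive X x y" "y < min (- C0) C1" for x y
  proof (rule gap_values)
    have xy: "x \<in> X" "y \<in> X" "x < y" "X \<inter> {x<..<y} = {}" using that(1) by (auto simp: consecutive_def)
    show "x \<in> L" "y \<in> L" "x < y" using xy X_L by auto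
    have "C0 < \<bar>x\<bar>" "C0 < \<bar>y\<bar>" using that(2) xy(3) by linarith+
    then show "o\<^sub>0 < h x" "h x < o\<^sub>1" "o\<^sub>0 < h y" "h y < o\<^sub>1" using C0 xy by auto
    fix z assume z: "z \<in> L" "x < z" "z < y" "o\<^sub>0 + margin \<le> h z" "h z \<le> o\<^sub>1 - margin"
    have "z \<in> X" by (rule C1) (use z that(2) in \<open>auto simp: in_signed_strip\<close>)
    then show False using xy z by auto
  qed
  then show ?thesis by blast
qed

lemma finitely_many_exceptional_gaps:
  assumes "fills_right" and left: "fills_left \<or> bdd_below X"
  shows "finite {(x, y). consecutive X x y \<and> y - x \<notin> {\<Delta>\<^sub>1, \<Delta>\<^sub>2, \<Delta>\<^sub>1 + \<Delta>\<^sub>2}}" (is "finite ?E")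
proof -
  obtain C where C: "\<And>x y. consecutive X x y \<Longrightarrow> C < x \<Longrightarrow> y - x \<in> {\<Delta>\<^sub>1, \<Delta>\<^sub>2, \<Delta>\<^sub>1 + \<Delta>\<^sub>2}"
    using gaps_right[OF assms(1)] by blast
  have "\<exists>B. \<forall>x y. consecutive X x y \<longrightarrow> y < B \<longrightarrow> y - x \<in> {\<Delta>\<^sub>1, \<Delta>\<^sub>2, \<Delta>\<^sub>1 + \<Delta>\<^sub>2}"
    using left
  proof
    assume "bdd_below X"
    then obtain B where "\<And>x. x \<in> X \<Longrightarrow> B \<le> x" by (auto simp: bdd_below_def)
    then show ?thesis by (intro exI[of _ B]) (fastforce simp: consecutive_def)
  qed (rule gaps_left)
  then obtain B where B: "\<And>x y. consecutive X x y \<Longrightarrow> y < B \<Longrightarrow> y - x \<in> {\<Delta>\<^sub>1, \<Delta>\<^sub>2, \<Delta>\<^sub>1 + \<Delta>\<^sub>2}" by blast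
  \<comment> \<open>At most one gap straddles \<open>B\<close>.\<close>
  define S where "S = {x. \<exists>y. consecutive X x y \<and> x < B \<and> B \<le> y}"
  have S: "finite S"
  proof (cases "S = {}")
    case False
    then obtain x0 y0 where x0: "consecutive X x0 y0" "x0 < B" "B \<le> y0" by (auto simp: S_def)
    have "x = x0" if xS: "x \<in> S" for x
    proof -
      obtain y where y: "consecutive X x y" "x < B" "B \<le> y" using xS unfolding S_def by blast
      show ?thesis
      proof (rule ccontr)
        assume "x \<noteq> x0"
        then consider "x < x0" | "x0 < x" by linarith
        then show False
        proof cases
          case 1
          then have "x0 \<in> X \<inter> {x<..<y}" using x0 y by (auto simp: consecutive_def)
          then show False using y by (auto simp: consecutive_def)
        next
          case 2
          then have "x \<in> X \<inter> {x0<..<y0}" using x0 y by (auto simp: consecutive_def)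
          then show False using x0 by (auto simp: consecutive_def)
        qed
      qed
    qed
    then have "S \<subseteq> {x0}" by blast
    then show ?thesis by (rule finite_subset) simp
  qed simp
  have "fst ` ?E \<subseteq> (X \<inter> {B..C}) \<union> S"
  proof clarsimp
    fix x y assume h: "consecutive X x y" "y - x \<noteq> \<Delta>\<^sub>1" "y - x \<noteq> \<Delta>\<^sub>2" "y - x \<noteq> \<Delta>\<^sub>1 + \<Delta>\<^sub>2" "x \<notin> S"
    have "x \<le> C" "B \<le> y" using B[OF h(1)] C[OF h(1)] h(2-4) by (auto simp: not_less[symmetric])
    then show "x \<in> X \<and> B \<le> x \<and> x \<le> C" using h(1,5) unfolding S_def consecutive_def by (auto simp: not_less[symmetric])
  qed
  moreover have "finite ((X \<inter> {B..C}) \<union> S)" using S X_locally_finite by (simp add: locally_finite_def)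
  ultimately have "finite (fst ` ?E)" by (rule finite_subset)
  moreover have "inj_on fst ?E" by (auto simp: inj_on_def dest: consecutive_unique)
  ultimately show ?thesis by (rule finite_imageD)
qed

lemma density_X: "fills_right \<Longrightarrow> has_density X ((o\<^sub>1 - o\<^sub>0) / \<kappa>)"
  using ab X_strip unfolding fills_right_def by (intro density_of_almost_strip[OF tau]) auto

text \<open>The points x for which x and x + \<Delta> both belong to X have conjugates in the intersection of the window with its
translate by -w.\<close>

lemma shifted_density:
  assumes "fills_right" and D: "\<Delta> \<in> L" "\<Delta> > 0" "h \<Delta> = w"
    and s: "s = max (o\<^sub>0) (o\<^sub>0 - w)" "t = min (o\<^sub>1) (o\<^sub>1 - w)" "s < t"
  shows "has_density {x \<in> X. x + \<Delta> \<in> X} ((t - s) / \<kappa>)"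
proof (rule density_of_almost_strip[OF tau s(3)])
  show "{x \<in> X. x + \<Delta> \<in> X} \<subseteq> signed_strip \<tau> s t"
    using X_h X_L h_add[OF _ D(1)] unfolding s D(3)[symmetric] by (fastforce simp: in_signed_strip)
  fix \<epsilon> :: real assume "\<epsilon> > 0"
  then obtain C where C: "\<And>x. x \<in> signed_strip \<tau> (o\<^sub>0 + \<epsilon>) (o\<^sub>1 - \<epsilon>) \<Longrightarrow> C \<le> x \<Longrightarrow> x \<in> X"
    using assms(1) unfolding fills_right_def by blast
  show "\<exists>C. \<forall>x\<in>signed_strip \<tau> (s + \<epsilon>) (t - \<epsilon>). C \<le> x \<longrightarrow> x \<in> {x \<in> X. x + \<Delta> \<in> X}"
  proof (intro exI[of _ C] ballI impI CollectI conjI)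
    fix x assume x: "x \<in> signed_strip \<tau> (s + \<epsilon>) (t - \<epsilon>)" "C \<le> x"
    then have xL: "x \<in> L" and hx: "s + \<epsilon> \<le> h x" "h x \<le> t - \<epsilon>" by (auto simp: in_signed_strip)
    have b: "s \<ge> o\<^sub>0" "s \<ge> o\<^sub>0 - w" "t \<le> o\<^sub>1" "t \<le> o\<^sub>1 - w" by (auto simp: s)
    show "x \<in> X" using x xL hx b by (intro C) (auto simp: in_signed_strip)
    show "x + \<Delta> \<in> X"
      using x xL hx b D h_add[OF xL D(1)] L_add[OF xL D(1)] by (intro C) (auto simp: in_signed_strip)
  qed
qed

theorem gap_frequencies:
  assumes fill: "fills_right" and x0: "x\<^sub>0 \<in> X"
  shows "has_frequency (gap_word X x\<^sub>0) \<Delta>\<^sub>1 (1 - a / (o\<^sub>1 - o\<^sub>0))"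
    and "has_frequency (gap_word X x\<^sub>0) \<Delta>\<^sub>2 (1 - b / (o\<^sub>1 - o\<^sub>0))"
    and "has_frequency (gap_word X x\<^sub>0) (\<Delta>\<^sub>1 + \<Delta>\<^sub>2) (- 1 + (a + b) / (o\<^sub>1 - o\<^sub>0))"
proof -
  define W where "W = o\<^sub>1 - o\<^sub>0"
  have W: "W > 0" using ab by (simp add: W_def)
  define Y1 where "Y1 = {x \<in> X. x + \<Delta>\<^sub>1 \<in> X}"
  define Y2 where "Y2 = {x \<in> X. x + \<Delta>\<^sub>2 \<in> X}"
  have dX: "has_density X (W / \<kappa>)" using density_X[OF fill] by (simp add: W_def)
  have unb: "\<not> bdd_above X" by (rule density_pos_unbounded[OF dX _ X_locally_finite]) (use W kappa_pos in simp)
  have hD: "h \<Delta>\<^sub>1 = a" "h \<Delta>\<^sub>2 = - b" using D1 D2 by (simp_all add: h_def)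
  have d1: "has_density Y1 ((W - a) / \<kappa>)"
    unfolding Y1_def by (rule back_subst[where P = "has_density _", OF shifted_density[OF fill D1(1,2) hD(1) refl refl]]) (use ab in \<open>auto simp: W_def\<close>)
  have d2: "has_density Y2 ((W - b) / \<kappa>)"
    unfolding Y2_def by (rule back_subst[where P = "has_density _", OF shifted_density[OF fill D2(1,2) hD(2) refl refl]]) (use ab in \<open>auto simp: W_def\<close>)
  obtain C0 where C0: "\<And>x. x \<in> X \<Longrightarrow> C0 < \<bar>x\<bar> \<Longrightarrow> o\<^sub>0 < h x \<and> h x < o\<^sub>1" using inner_far by blast
  obtain C1 where C1: "\<And>x y. consecutive X x y \<Longrightarrow> C1 < x \<Longrightarrow> y - x \<in> {\<Delta>\<^sub>1, \<Delta>\<^sub>2, \<Delta>\<^sub>1 + \<Delta>\<^sub>2}"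
    using gaps_right[OF fill] by blast
  define C where "C = max (max C0 0) C1"
  have sub: "Y1 \<subseteq> X" "Y2 \<subseteq> X" by (auto simp: Y1_def Y2_def)
  have ne: "\<Delta>\<^sub>1 \<noteq> \<Delta>\<^sub>2" using hD ab by auto
  \<comment> \<open>Both steps from one point would need a window longer than \<open>a + b\<close>.\<close>
  have disj: False if "x \<in> Y1" "x \<in> Y2" "C < x" for x
  proof -
    have x: "x \<in> X" "x + \<Delta>\<^sub>1 \<in> X" "x + \<Delta>\<^sub>2 \<in> X" using that by (auto simp: Y1_def Y2_def)
    have "C0 < \<bar>x + \<Delta>\<^sub>1\<bar>" "C0 < \<bar>x + \<Delta>\<^sub>2\<bar>" using that(3) D1 D2 by (auto simp: C_def)
    then have "h (x + \<Delta>\<^sub>1) < o\<^sub>1" "o\<^sub>0 < h (x + \<Delta>\<^sub>2)" using C0 x by auto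
    then show False using h_add[OF X_L[OF x(1)]] D1(1) D2(1) hD ab by auto
  qed
  have gap: "(right_neighbour X x - x = \<Delta>\<^sub>1 \<longleftrightarrow> x \<in> Y1) \<and> (right_neighbour X x - x = \<Delta>\<^sub>2 \<longleftrightarrow> x \<in> Y2) \<and>
      (right_neighbour X x - x = \<Delta>\<^sub>1 + \<Delta>\<^sub>2 \<longleftrightarrow> x \<notin> Y1 \<and> x \<notin> Y2)" if x: "x \<in> X" "x > C" for x
  proof -
    define y where "y = right_neighbour X x"
    have cons: "consecutive X x y" unfolding y_def by (rule right_neighbour_consecutive[OF X_locally_finite unb x(1)])
    have val: "y - x \<in> {\<Delta>\<^sub>1, \<Delta>\<^sub>2, \<Delta>\<^sub>1 + \<Delta>\<^sub>2}" using C1[OF cons] x by (simp add: C_def)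
    have y: "y \<in> X" "\<And>z. z \<in> X \<Longrightarrow> x < z \<Longrightarrow> y \<le> z" using cons unfolding consecutive_def by (auto simp: not_less[symmetric])
    have i1: "x \<in> Y1 \<Longrightarrow> y - x \<le> \<Delta>\<^sub>1" using y(2)[of "x + \<Delta>\<^sub>1"] D1 by (auto simp: Y1_def)
    have i2: "x \<in> Y2 \<Longrightarrow> y - x \<le> \<Delta>\<^sub>2" using y(2)[of "x + \<Delta>\<^sub>2"] D2 by (auto simp: Y2_def)
    have j1: "y - x = \<Delta>\<^sub>1 \<Longrightarrow> x \<in> Y1" using y(1) x(1) by (auto simp: Y1_def diff_eq_eq add.commute)
    have j2: "y - x = \<Delta>\<^sub>2 \<Longrightarrow> x \<in> Y2" using y(1) x(1) by (auto simp: Y2_def diff_eq_eq add.commute)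
    have "\<not> (x \<in> Y1 \<and> x \<in> Y2)" using disj x by blast
    then have "(y - x = \<Delta>\<^sub>1 \<longleftrightarrow> x \<in> Y1) \<and> (y - x = \<Delta>\<^sub>2 \<longleftrightarrow> x \<in> Y2) \<and> (y - x = \<Delta>\<^sub>1 + \<Delta>\<^sub>2 \<longleftrightarrow> x \<notin> Y1 \<and> x \<notin> Y2)"
      using val i1 i2 j1 j2 D1(2) D2(2) ne by auto
    then show ?thesis by (simp add: y_def)
  qed
  have dX0: "W / \<kappa> > 0" using W kappa_pos by simp
  note freq = frequency_from_density[OF X_locally_finite x0 dX dX0]
  have "has_frequency (gap_word X x\<^sub>0) \<Delta>\<^sub>1 ((W - a) / \<kappa> / (W / \<kappa>))" by (rule freq[OF d1 sub(1)]) (use gap in blast)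
  moreover have "(W - a) / \<kappa> / (W / \<kappa>) = 1 - a / W" using W kappa_pos by (simp add: field_simps)
  ultimately show "has_frequency (gap_word X x\<^sub>0) \<Delta>\<^sub>1 (1 - a / (o\<^sub>1 - o\<^sub>0))" by (simp add: W_def)
  have "has_frequency (gap_word X x\<^sub>0) \<Delta>\<^sub>2 ((W - b) / \<kappa> / (W / \<kappa>))" by (rule freq[OF d2 sub(2)]) (use gap in blast)
  moreover have "(W - b) / \<kappa> / (W / \<kappa>) = 1 - b / W" using W kappa_pos by (simp add: field_simps)
  ultimately show "has_frequency (gap_word X x\<^sub>0) \<Delta>\<^sub>2 (1 - b / (o\<^sub>1 - o\<^sub>0))" by (simp add: W_def)
  define Y2' where "Y2' = Y2 \<inter> {C<..}"
  have d2': "has_density Y2' ((W - b) / \<kappa>)"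
  proof (rule density_finite_change[OF d2, where C = C])
    show "locally_finite Y2" by (rule locally_finite_subset[OF X_locally_finite sub(2)])
    show "locally_finite Y2'" by (rule locally_finite_subset[OF X_locally_finite]) (use sub in \<open>auto simp: Y2'_def\<close>)
  qed (simp add: Y2'_def)
  have d3: "has_density (X - Y1 - Y2') (W / \<kappa> - (W - a) / \<kappa> - (W - b) / \<kappa>)"
    by (intro density_Diff dX d1 d2' sub locally_finite_subset[OF X_locally_finite]) (use sub disj in \<open>auto simp: Y2'_def\<close>)
  have "has_frequency (gap_word X x\<^sub>0) (\<Delta>\<^sub>1 + \<Delta>\<^sub>2) ((W / \<kappa> - (W - a) / \<kappa> - (W - b) / \<kappa>) / (W / \<kappa>))"
    by (rule freq[OF d3]) (use gap in \<open>auto simp: Y2'_def\<close>)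
  moreover have "(W / \<kappa> - (W - a) / \<kappa> - (W - b) / \<kappa>) / (W / \<kappa>) = - 1 + (a + b) / W"
    using W kappa_pos by (simp add: field_simps)
  ultimately show "has_frequency (gap_word X x\<^sub>0) (\<Delta>\<^sub>1 + \<Delta>\<^sub>2) (- 1 + (a + b) / (o\<^sub>1 - o\<^sub>0))" by (simp add: W_def)
qed

end

section \<open>Spectra of quadratic Pisot units\<close>

lemma pisot_unit_locale:
  assumes "quadratic_Pisot_unit_with_conjugate \<beta> \<beta>'"
  shows "\<exists>p e. quadratic_unit \<beta> \<beta>' p e"
proof -
  have b: "1 < \<beta>" "\<beta>' < \<beta>" using assms unfolding quadratic_Pisot_unit_with_conjugate_def by auto
  have vieta: "\<beta> + \<beta>' = of_int p \<and> \<beta> * \<beta>' = - of_int e"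
    if "{x :: real. x\<^sup>2 - of_int p * x - of_int e = 0} = {\<beta>, \<beta>'}" for p e :: int
  proof -
    have "\<beta> \<in> {x :: real. x\<^sup>2 - of_int p * x - of_int e = 0}" "\<beta>' \<in> {x :: real. x\<^sup>2 - of_int p * x - of_int e = 0}"
      unfolding that by auto
    then have r: "\<beta> * \<beta> - of_int p * \<beta> - of_int e = 0" "\<beta>' * \<beta>' - of_int p * \<beta>' - of_int e = 0"
      by (simp_all add: power2_eq_square)
    then have "(\<beta> - \<beta>') * (\<beta> + \<beta>' - of_int p) = 0" by (simp add: algebra_simps)
    then have s: "\<beta> + \<beta>' = of_int p" using b by simp
    have "\<beta> * \<beta>' = \<beta> * of_int p - \<beta> * \<beta>" unfolding s[symmetric] by (simp add: algebra_simps)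
    then have "\<beta> * \<beta>' = - of_int e" using r(1) by (simp add: algebra_simps)
    with s show ?thesis by simp
  qed
  obtain p :: int where p: "(p \<ge> 1 \<and> {x :: real. x\<^sup>2 - of_int p * x - 1 = 0} = {\<beta>, \<beta>'}) \<or>
      (p \<ge> 3 \<and> {x :: real. x\<^sup>2 - of_int p * x + 1 = 0} = {\<beta>, \<beta>'})"
    using assms unfolding quadratic_Pisot_unit_with_conjugate_def by blast
  then show ?thesis
  proof
    assume h: "p \<ge> 1 \<and> {x :: real. x\<^sup>2 - of_int p * x - 1 = 0} = {\<beta>, \<beta>'}"
    then have "quadratic_unit \<beta> \<beta>' p 1" using vieta[of p 1] b by unfold_locales auto
    then show ?thesis by blast
  next
    assume h: "p \<ge> 3 \<and> {x :: real. x\<^sup>2 - of_int p * x + 1 = 0} = {\<beta>, \<beta>'}"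
    then have "quadratic_unit \<beta> \<beta>' p (-1)" using vieta[of p "-1"] b by unfold_locales auto
    then show ?thesis by blast
  qed
qed

lemma locally_finite_uminus:
  assumes "locally_finite X"
  shows "locally_finite (uminus ` X)"
  unfolding locally_finite_def
proof (intro allI)
  fix a b
  have "uminus ` X \<inter> {a..b} = uminus ` (X \<inter> {-b..-a})" by force
  then show "finite (uminus ` X \<inter> {a..b})" using assms by (simp add: locally_finite_def)
qed

lemma consecutive_uminus: "consecutive (uminus ` X) (- y) (- x) \<longleftrightarrow> consecutive X x y"
proof -
  have "(uminus ` X) \<inter> {- y<..<- x} = uminus ` (X \<inter> {x<..<y})" by auto
  then show ?thesis unfolding consecutive_def by (auto simp: image_iff)
qed

lemma left_neighbour_mirror:
  assumes "locally_finite X" "\<not> bdd_below X" "x \<in> X"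
  shows "left_neighbour X x = - right_neighbour (uminus ` X) (- x)"
proof -
  let ?y = "- right_neighbour (uminus ` X) (- x)"
  have "locally_finite (uminus ` X)" by (rule locally_finite_uminus[OF assms(1)])
  moreover have "\<not> bdd_above (uminus ` X)" using assms(2) by simp
  ultimately have "consecutive (uminus ` X) (- x) (- ?y)"
    using right_neighbour_consecutive assms(3) by simp
  then have c: "consecutive X ?y x" by (simp only: consecutive_uminus)
  show ?thesis
    unfolding left_neighbour_def by (rule Greatest_equality) (use c in \<open>auto simp: consecutive_def not_less[symmetric]\<close>)
qed

text \<open>Reduces the listing to the left to the listing to the right.\<close>

lemma gap_word_mirror:
  assumes fin: "locally_finite X" and "bdd_above X" "\<not> bdd_below X" and x: "x \<in> X"
  shows "gap_word X x = gap_word (uminus ` X) (- x)"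
proof -
  have unb: "\<not> bdd_above (uminus ` X)" using assms by simp
  have iter: "(left_neighbour X ^^ i) x = - (right_neighbour (uminus ` X) ^^ i) (- x) \<and> (left_neighbour X ^^ i) x \<in> X" for i
  proof (induction i)
    case 0
    then show ?case using x by simp
  next
    case (Suc i)
    let ?z = "(left_neighbour X ^^ i) x"
    have "left_neighbour X ?z = - right_neighbour (uminus ` X) (- ?z)"
      by (rule left_neighbour_mirror) (use assms Suc in auto)
    moreover have "left_neighbour X ?z \<in> X"
    proof -
      have "locally_finite (uminus ` X)" by (rule locally_finite_uminus[OF fin])
      then have "right_neighbour (uminus ` X) (- ?z) \<in> uminus ` X"
        using right_neighbour_consecutive[OF _ unb, of "- ?z"] Suc unfolding consecutive_def by blast
      then show ?thesis using calculation by auto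
    qed
    ultimately show ?case using Suc by simp
  qed
  show ?thesis
  proof
    fix i
    show "gap_word X x i = gap_word (uminus ` X) (- x) i"
      using iter[of i] iter[of "Suc i"] assms(2) unb by (simp add: gap_word_def del: funpow.simps)
  qed
qed

context quadratic_unit begin

lemma is_window_mirror:
  assumes "is_window \<alpha> m M s t"
  shows "is_window \<alpha> (- M) (- m) (- t) (- s)"
proof -
  have neg: "- t / \<beta> = - (t / \<beta>)" "- s / \<beta> = - (s / \<beta>)" by simp_all
  consider "gal \<alpha> = 1 / \<beta>" "s = of_int m + s / \<beta>" "t = of_int M + t / \<beta>"
    | "gal \<alpha> = - 1 / \<beta>" "s = of_int m - t / \<beta>" "t = of_int M - s / \<beta>"
    using assms unfolding is_window_def by blast
  then show ?thesis
  proof cases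
    case 1
    from 1(2,3) have "- t = of_int (- M) + - t / \<beta>" "- s = of_int (- m) + - s / \<beta>"
      unfolding neg of_int_minus by linarith+
    then show ?thesis using 1(1) unfolding is_window_def by blast
  next
    case 2
    from 2(2,3) have "- t = of_int (- M) - - s / \<beta>" "- s = of_int (- m) - - t / \<beta>"
      unfolding neg of_int_minus by linarith+
    then show ?thesis using 2(1) unfolding is_window_def by blast
  qed
qed

lemma spectrum_fills_window_left:
  assumes \<alpha>: "\<alpha> \<in> {\<beta>, -\<beta>}" and win: "is_window \<alpha> m M w0 w1" and mM: "\<beta> - 1 < of_int (M - m)"
    and zero: "m \<le> -1" "0 \<le> M" and eps: "\<epsilon> > 0"
  shows "\<exists>C. \<forall>x\<in>L. (\<alpha> = \<beta> \<longrightarrow> x \<le> C) \<longrightarrow> w0 + \<epsilon> \<le> gal x \<longrightarrow> gal x \<le> w1 - \<epsilon> \<longrightarrow> x \<in> spectrum {m..M} \<alpha>"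
proof -
  obtain C where C: "\<And>x. x \<in> L \<Longrightarrow> (\<alpha> = \<beta> \<longrightarrow> C \<le> x) \<Longrightarrow> - w1 + \<epsilon> \<le> gal x \<Longrightarrow> gal x \<le> - w0 - \<epsilon> \<Longrightarrow>
      x \<in> spectrum {- M..- m} \<alpha>"
    using spectrum_fills_window[OF \<alpha> is_window_mirror[OF win], of \<epsilon>] mM zero eps
    unfolding eventually_filled_def by auto
  have "x \<in> spectrum {m..M} \<alpha>" if x: "x \<in> L" "\<alpha> = \<beta> \<longrightarrow> x \<le> - C" "w0 + \<epsilon> \<le> gal x" "gal x \<le> w1 - \<epsilon>" for x
  proof -
    have "- x \<in> spectrum {- M..- m} \<alpha>" by (rule C) (use x gal_uminus[OF x(1)] L_uminus in auto)
    moreover have "{- M..- m} = uminus ` {m..M}" by simp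
    ultimately have "- x \<in> uminus ` spectrum {m..M} \<alpha>" by (simp only: spectrum_uminus)
    then show ?thesis by auto
  qed
  then show ?thesis by blast
qed

text \<open>A positive digit fills the right side, a negative digit the left one.  For the base -\<beta> either of them
fills both sides at once.\<close>

lemma spectrum_fills:
  assumes \<alpha>: "\<alpha> \<in> {\<beta>, -\<beta>}" and win: "is_window \<alpha> m M w0 w1" and mM: "\<beta> - 1 < of_int (M - m)"
    and zero: "m \<le> 0" "0 \<le> M" and eps: "\<epsilon> > 0"
  shows "\<alpha> = -\<beta> \<or> 1 \<le> M \<Longrightarrow> \<exists>C. \<forall>x\<in>L. C \<le> x \<longrightarrow> w0 + \<epsilon> \<le> gal x \<longrightarrow> gal x \<le> w1 - \<epsilon> \<longrightarrow> x \<in> spectrum {m..M} \<alpha>"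
    and "\<alpha> = -\<beta> \<or> m \<le> -1 \<Longrightarrow> \<exists>C. \<forall>x\<in>L. x \<le> C \<longrightarrow> w0 + \<epsilon> \<le> gal x \<longrightarrow> gal x \<le> w1 - \<epsilon> \<longrightarrow> x \<in> spectrum {m..M} \<alpha>"
proof -
  have "real_of_int (M - m) > 0" using mM beta_gt_1 by linarith
  then have "1 \<le> M \<or> m \<le> -1" using zero by auto
  have pos: "1 \<le> M \<Longrightarrow> \<exists>C. \<forall>x\<in>L. (\<alpha> = \<beta> \<longrightarrow> C \<le> x) \<longrightarrow> w0 + \<epsilon> \<le> gal x \<longrightarrow> gal x \<le> w1 - \<epsilon> \<longrightarrow> x \<in> spectrum {m..M} \<alpha>"
    using spectrum_fills_window[OF \<alpha> win mM zero(1) _ eps] unfolding eventually_filled_def by blast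
  have neg: "m \<le> -1 \<Longrightarrow> \<exists>C. \<forall>x\<in>L. (\<alpha> = \<beta> \<longrightarrow> x \<le> C) \<longrightarrow> w0 + \<epsilon> \<le> gal x \<longrightarrow> gal x \<le> w1 - \<epsilon> \<longrightarrow> x \<in> spectrum {m..M} \<alpha>"
    using spectrum_fills_window_left[OF \<alpha> win mM _ zero(2) eps] by blast
  have ne: "- \<beta> \<noteq> \<beta>" using beta_gt_1 by simp
  have both: "\<forall>x\<in>L. w0 + \<epsilon> \<le> gal x \<longrightarrow> gal x \<le> w1 - \<epsilon> \<longrightarrow> x \<in> spectrum {m..M} \<alpha>" if "\<alpha> = -\<beta>"
    using \<open>1 \<le> M \<or> m \<le> -1\<close> pos neg that ne by metis
  show "\<exists>C. \<forall>x\<in>L. C \<le> x \<longrightarrow> w0 + \<epsilon> \<le> gal x \<longrightarrow> gal x \<le> w1 - \<epsilon> \<longrightarrow> x \<in> spectrum {m..M} \<alpha>"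
    if "\<alpha> = -\<beta> \<or> 1 \<le> M" using that both pos by metis
  show "\<exists>C. \<forall>x\<in>L. x \<le> C \<longrightarrow> w0 + \<epsilon> \<le> gal x \<longrightarrow> gal x \<le> w1 - \<epsilon> \<longrightarrow> x \<in> spectrum {m..M} \<alpha>"
    if "\<alpha> = -\<beta> \<or> m \<le> -1" using that both neg by metis
qed

text \<open>1 and j - \<beta>' = \<beta> + (j - p) generate \<int>[\<beta>], and \<beta>^n is a unit.\<close>

lemma generators:
  assumes "z \<in> L"
  shows "\<exists>r s :: int. z = of_int r * (1 / \<beta> ^ n) + of_int s * (1 / \<beta> ^ n * (of_int j - \<beta>'))"
proof -
  have pos: "\<beta> ^ n > 0" using beta_gt_1 by simp
  have "z * \<beta> ^ n \<in> L" using assms by (intro L_mult L_power L_beta)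
  then obtain u v where uv: "z * \<beta> ^ n = of_int u + of_int v * \<beta>" by (rule L_E)
  have b: "\<beta> = of_int p - \<beta>'" using trace by simp
  have "of_int u + of_int v * (of_int p - \<beta>') = of_int (u + v * p - v * j) + of_int v * (of_int j - \<beta>')"
    by (simp add: algebra_simps)
  then have "z * \<beta> ^ n = of_int (u + v * p - v * j) + of_int v * (of_int j - \<beta>')" using uv b by metis
  then have "z = (of_int (u + v * p - v * j) + of_int v * (of_int j - \<beta>')) / \<beta> ^ n"
    by (rule eq_divide_imp[OF less_imp_neq[OF pos, symmetric]])
  then have "z = of_int (u + v * p - v * j) * (1 / \<beta> ^ n) + of_int v * (1 / \<beta> ^ n * (of_int j - \<beta>'))"
    by (simp add: add_divide_distrib)
  then show ?thesis by blast
qed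

lemma step_conjugates:
  fixes n :: nat and j :: int
  defines "\<tau> \<equiv> (- of_int e) ^ n :: real"
  shows "\<tau> = 1 \<or> \<tau> = -1"
    and "1 / \<beta> ^ n \<in> L" and "\<tau> * gal (1 / \<beta> ^ n) = \<beta> ^ n"
    and "1 / \<beta> ^ n * (of_int j - \<beta>') \<in> L" and "\<tau> * gal (1 / \<beta> ^ n * (of_int j - \<beta>')) = - (\<beta> ^ n * (\<beta> - of_int j))"
proof -
  show tau: "\<tau> = 1 \<or> \<tau> = -1" unfolding \<tau>_def using cases_e by (cases "even n") auto
  then have tt: "\<tau> * \<tau> = 1" by auto
  have eq: "1 / \<beta> ^ n = (1 / \<beta>) ^ n" by (simp add: power_divide)
  show l1: "1 / \<beta> ^ n \<in> L" unfolding eq by (rule L_power[OF L_inverse_beta])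
  have "gal (1 / \<beta> ^ n) = (1 / \<beta>') ^ n" unfolding eq using gal_power[OF L_inverse_beta] gal_inverse_beta by simp
  also have "\<dots> = \<tau> * \<beta> ^ n" unfolding inverse_beta \<tau>_def by (rule power_mult_distrib)
  finally have g: "gal (1 / \<beta> ^ n) = \<tau> * \<beta> ^ n" .
  show "\<tau> * gal (1 / \<beta> ^ n) = \<beta> ^ n" unfolding g using tt by (simp add: mult.assoc[symmetric])
  have d: "of_int j - \<beta>' \<in> L" "gal (of_int j - \<beta>') = of_int j - \<beta>"
    using L_diff[OF L_of_int L_beta'] gal_diff[OF L_of_int L_beta'] gal_of_int gal_beta' by auto
  show "1 / \<beta> ^ n * (of_int j - \<beta>') \<in> L" by (rule L_mult[OF l1 d(1)])
  have "\<tau> * gal (1 / \<beta> ^ n * (of_int j - \<beta>')) = (\<tau> * \<tau>) * (\<beta> ^ n * (of_int j - \<beta>))"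
    unfolding gal_mult[OF l1 d(1)] g d(2) by simp
  then show "\<tau> * gal (1 / \<beta> ^ n * (of_int j - \<beta>')) = - (\<beta> ^ n * (\<beta> - of_int j))"
    unfolding tt by (simp add: algebra_simps)
qed

text \<open>The hypotheses lower and upper become max(a,b) < \<bar>\<Omega>\<bar> \<le> a + b after multiplication by
\<beta>/(\<beta> - 1), with a = \<beta>^n and b = \<beta>^n(\<beta> - j).\<close>

theorem spectrum_gaps_rightwards:
  assumes \<alpha>: "\<alpha> \<in> {\<beta>, -\<beta>}" and zero: "m \<le> 0" "0 \<le> M" and right: "\<alpha> = -\<beta> \<or> 1 \<le> M"
    and card: "\<beta> < of_int (M - m) + 1"
    and j: "1 \<le> j" "j \<le> \<lfloor>\<beta>\<rfloor>"
    and lower: "\<beta> ^ n / \<beta> * (\<beta> - 1) * max (\<beta> - of_int j) 1 < of_int (M - m)"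
    and upper: "of_int (M - m) \<le> \<beta> ^ n / \<beta> * (\<beta> - 1) * (\<beta> - of_int j + 1)"
  defines "X \<equiv> spectrum {m..M} \<alpha>" and "\<Delta>\<^sub>1 \<equiv> 1 / \<beta> ^ n" and "\<Delta>\<^sub>2 \<equiv> 1 / \<beta> ^ n * (of_int j - \<beta>')"
    and "\<Delta>\<^sub>3 \<equiv> 1 / \<beta> ^ n * (of_int j + 1 - \<beta>')" and "K \<equiv> of_int (M - m) :: real"
  shows "locally_finite X" and "\<not> bdd_above X"
    and "finite {(x, y). consecutive X x y \<and> y - x \<notin> {\<Delta>\<^sub>1, \<Delta>\<^sub>2, \<Delta>\<^sub>3}}"
    and "x\<^sub>0 \<in> X \<Longrightarrow> has_frequency (gap_word X x\<^sub>0) \<Delta>\<^sub>1 (1 - \<beta> ^ n / \<beta> * (\<beta> - 1) / K)"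
    and "x\<^sub>0 \<in> X \<Longrightarrow> has_frequency (gap_word X x\<^sub>0) \<Delta>\<^sub>2 (1 - \<beta> ^ n / \<beta> * (\<beta> - of_int j) * (\<beta> - 1) / K)"
    and "x\<^sub>0 \<in> X \<Longrightarrow> has_frequency (gap_word X x\<^sub>0) \<Delta>\<^sub>3 (- 1 + \<beta> ^ n / \<beta> * (\<beta> - of_int j + 1) * (\<beta> - 1) / K)"
proof -
  define \<tau> :: real where "\<tau> = (- of_int e) ^ n"
  define q where "q = \<beta> ^ n"
  have q: "q > 0" using beta_gt_1 by (simp add: q_def)
  have tau: "\<tau> = 1 \<or> \<tau> = -1" using step_conjugates(1)[of n] by (simp add: \<tau>_def)
  obtain w0 w1 where win: "is_window \<alpha> m M w0 w1" using window_exists[OF \<alpha>] by blast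
  define o0 where "o0 = (if \<tau> = 1 then w0 else - w1)"
  define o1 where "o1 = (if \<tau> = 1 then w1 else - w0)"
  have W: "o1 - o0 = w1 - w0" by (simp add: o0_def o1_def)
  have strip: "x \<in> signed_strip \<tau> (o0 + \<epsilon>) (o1 - \<epsilon>) \<longleftrightarrow> x \<in> L \<and> w0 + \<epsilon> \<le> gal x \<and> gal x \<le> w1 - \<epsilon>" for x \<epsilon>
    using tau by (auto simp: signed_strip_def o0_def o1_def)
  have len: "(o1 - o0) * (\<beta> - 1) = K * \<beta>" unfolding W K_def by (rule window_length[OF win])
  have bm: "\<beta> - 1 > 0" using beta_gt_1 by simp
  have jb: "of_int j < \<beta>"
  proof -
    have "of_int j \<le> \<beta>" using j by (simp add: le_floor_iff)
    moreover have "of_int j \<noteq> \<beta>" using beta_irrational[of j "-1"] by auto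
    ultimately show ?thesis by simp
  qed
  have scale: "q / \<beta> * (\<beta> - 1) * c * \<beta> = (q * c) * (\<beta> - 1)" for c using beta_gt_1 by simp
  have "q / \<beta> * (\<beta> - 1) * max (\<beta> - of_int j) 1 * \<beta> < K * \<beta>" "K * \<beta> \<le> q / \<beta> * (\<beta> - 1) * (\<beta> - of_int j + 1) * \<beta>"
    using lower upper beta_gt_1 unfolding q_def K_def by (simp_all only: mult_less_cancel_right_pos mult_le_cancel_right_pos order.strict_trans[OF zero_less_one])
  then have "(q * max (\<beta> - of_int j) 1) * (\<beta> - 1) < (o1 - o0) * (\<beta> - 1)" "(o1 - o0) * (\<beta> - 1) \<le> (q * (\<beta> - of_int j + 1)) * (\<beta> - 1)"
    unfolding scale len by simp_all
  then have low: "q * max (\<beta> - of_int j) 1 < o1 - o0" and up: "o1 - o0 \<le> q * (\<beta> - of_int j + 1)"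
    using bm by (simp_all only: mult_less_cancel_right_pos mult_le_cancel_right_pos)
  have "q * (\<beta> - of_int j) \<le> q * max (\<beta> - of_int j) 1" "q * 1 \<le> q * max (\<beta> - of_int j) 1"
    using q by (intro mult_left_mono; simp)+
  then have low': "q * (\<beta> - of_int j) < o1 - o0" "q < o1 - o0" using low by linarith+
  have D3: "\<Delta>\<^sub>1 + \<Delta>\<^sub>2 = \<Delta>\<^sub>3" by (simp add: \<Delta>\<^sub>1_def \<Delta>\<^sub>2_def \<Delta>\<^sub>3_def add_divide_distrib diff_divide_distrib)
  have b'1: "\<beta>' < 1" using abs_beta'_less_1 by simp
  interpret three_gap_model \<beta> \<beta>' p e \<tau> "\<Delta>\<^sub>1" "\<Delta>\<^sub>2" q "q * (\<beta> - of_int j)" o0 o1 X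
  proof unfold_locales
    show "0 < \<Delta>\<^sub>1" "0 < \<Delta>\<^sub>2" using beta_gt_1 b'1 j by (auto simp: \<Delta>\<^sub>1_def \<Delta>\<^sub>2_def)
    show "\<And>z. z \<in> L \<Longrightarrow> \<exists>r s :: int. z = of_int r * \<Delta>\<^sub>1 + of_int s * \<Delta>\<^sub>2"
      unfolding \<Delta>\<^sub>1_def \<Delta>\<^sub>2_def by (rule generators)
    show "o1 - o0 \<le> q + q * (\<beta> - of_int j)" using up by (simp add: algebra_simps)
    show "X \<subseteq> signed_strip \<tau> o0 o1"
      using strip[of _ 0] gal_spectrum_in_window[OF \<alpha> win] spectrum_subset_L[OF \<alpha>] zero unfolding X_def by auto
  qed (use tau q low' jb step_conjugates[of n, folded \<tau>_def] in \<open>auto simp: \<Delta>\<^sub>1_def \<Delta>\<^sub>2_def q_def\<close>)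
  have mM: "\<beta> - 1 < of_int (M - m)" using card by linarith
  have fr: fills_right
    unfolding fills_right_def
  proof (intro allI impI)
    fix \<epsilon> :: real assume "\<epsilon> > 0"
    from spectrum_fills(1)[OF \<alpha> win mM zero this right]
    show "\<exists>C. \<forall>x\<in>signed_strip \<tau> (o0 + \<epsilon>) (o1 - \<epsilon>). C \<le> x \<longrightarrow> x \<in> X"
      unfolding X_def Ball_def strip by blast
  qed
  have fl: "fills_left \<or> bdd_below X"
  proof (cases "\<alpha> = -\<beta> \<or> m \<le> -1")
    case True
    have fills_left
      unfolding fills_left_def
    proof (intro allI impI)
      fix \<epsilon> :: real assume "\<epsilon> > 0"
      from spectrum_fills(2)[OF \<alpha> win mM zero this True]
      show "\<exists>C. \<forall>x\<in>signed_strip \<tau> (o0 + \<epsilon>) (o1 - \<epsilon>). x \<le> C \<longrightarrow> x \<in> X"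
        unfolding X_def Ball_def strip by blast
    qed
    then show ?thesis ..
  next
    case False
    then have h: "\<alpha> = \<beta>" "m = 0" using \<alpha> zero by auto
    have "0 \<le> x" if "x \<in> X" for x
      using that unfolding X_def by (induction rule: spectrum_induct) (use h beta_gt_1 in auto)
    then have "bdd_below X" by (rule bdd_belowI)
    then show ?thesis ..
  qed
  show "locally_finite X" by (rule X_locally_finite)
  show "\<not> bdd_above X" by (rule density_pos_unbounded[OF density_X[OF fr] _ X_locally_finite]) (use low' q kappa_pos in simp)
  show "finite {(x, y). consecutive X x y \<and> y - x \<notin> {\<Delta>\<^sub>1, \<Delta>\<^sub>2, \<Delta>\<^sub>3}}"
    using finitely_many_exceptional_gaps[OF fr fl] unfolding D3 .
  have W0: "o1 - o0 > 0" using low' q by simp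
  have K: "K > 0" unfolding K_def using mM bm by linarith
  have ratio: "q * c / (o1 - o0) = q / \<beta> * c * (\<beta> - 1) / K" for c
  proof -
    have "o1 - o0 = K * \<beta> / (\<beta> - 1)" using len bm by (simp add: field_simps)
    then show ?thesis using bm K beta_gt_1 by simp
  qed
  {
    assume x0: "x\<^sub>0 \<in> X"
    show "has_frequency (gap_word X x\<^sub>0) \<Delta>\<^sub>1 (1 - \<beta> ^ n / \<beta> * (\<beta> - 1) / K)"
      using gap_frequencies(1)[OF fr x0] ratio[of 1] by (simp add: q_def)
    show "has_frequency (gap_word X x\<^sub>0) \<Delta>\<^sub>2 (1 - \<beta> ^ n / \<beta> * (\<beta> - of_int j) * (\<beta> - 1) / K)"
      using gap_frequencies(2)[OF fr x0] ratio[of "\<beta> - of_int j"] by (simp add: q_def)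
    have "q + q * (\<beta> - of_int j) = q * (\<beta> - of_int j + 1)" by (simp add: algebra_simps)
    then show "has_frequency (gap_word X x\<^sub>0) \<Delta>\<^sub>3 (- 1 + \<beta> ^ n / \<beta> * (\<beta> - of_int j + 1) * (\<beta> - 1) / K)"
      using gap_frequencies(3)[OF fr x0] ratio[of "\<beta> - of_int j + 1"] unfolding D3 by (simp only: q_def)
  }
qed

end

theorem theorem21:
  fixes \<beta> \<beta>' \<alpha> :: real and A :: "int set" and l j :: int
  assumes "quadratic_Pisot_unit_with_conjugate \<beta> \<beta>'"
    and "\<exists>m M :: int. A = {m..M}"
    and "0 \<in> A"
    and "real (card A) > \<beta>"
    and "\<alpha> \<in> {\<beta>, -\<beta>}"
    and "l \<ge> 0"
    and "j \<in> {1..\<lfloor>\<beta>\<rfloor>}"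
    and "\<beta> powi (l - 1) * (\<beta> - 1) * max (\<beta> - of_int j) 1 < real (card A) - 1"
    and "real (card A) - 1 \<le> \<beta> powi (l - 1) * (\<beta> - 1) * (\<beta> - of_int j + 1)"
  shows "finite {(x, y). consecutive (spectrum A \<alpha>) x y \<and>
           y - x \<notin> {1 / \<beta> powi l,
                    1 / \<beta> powi l * (of_int j - \<beta>'),
                    1 / \<beta> powi l * (of_int j + 1 - \<beta>')}} \<and>
    (\<forall>x\<^sub>0 \<in> spectrum A \<alpha>.
      has_frequency (gap_word (spectrum A \<alpha>) x\<^sub>0) (1 / \<beta> powi l)
        (1 - \<beta> powi (l - 1) * (\<beta> - 1) / (real (card A) - 1)) \<and>
      has_frequency (gap_word (spectrum A \<alpha>) x\<^sub>0) (1 / \<beta> powi l * (of_int j - \<beta>'))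
        (1 - \<beta> powi (l - 1) * (\<beta> - of_int j) * (\<beta> - 1) / (real (card A) - 1)) \<and>
      has_frequency (gap_word (spectrum A \<alpha>) x\<^sub>0) (1 / \<beta> powi l * (of_int j + 1 - \<beta>'))
        (- 1 + \<beta> powi (l - 1) * (\<beta> - of_int j + 1) * (\<beta> - 1) / (real (card A) - 1)))"
proof -
  obtain p e where "quadratic_unit \<beta> \<beta>' p e" using pisot_unit_locale[OF assms(1)] by blast
  then interpret quadratic_unit \<beta> \<beta>' p e .
  obtain m M where A: "A = {m..M}" using assms(2) by blast
  have zero: "m \<le> 0" "0 \<le> M" using assms(3) A by auto
  have cA: "real (card A) - 1 = of_int (M - m)" using zero by (simp add: A)
  have j: "1 \<le> j" "j \<le> \<lfloor>\<beta>\<rfloor>" using assms(7) by auto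
  define n where "n = nat l"
  have pl: "\<beta> powi l = \<beta> ^ n" using assms(6) by (simp add: n_def power_int_def)
  have pl1: "\<beta> powi (l - 1) = \<beta> ^ n / \<beta>" using beta_gt_1 by (simp add: power_int_diff pl)
  have card: "\<beta> < of_int (M - m) + 1" using assms(4) cA by linarith
  note bounds = assms(8,9)[unfolded cA pl1]
  show ?thesis
  proof (cases "\<alpha> = -\<beta> \<or> 1 \<le> M")
    case True
    note main = spectrum_gaps_rightwards[OF assms(5) zero True card j bounds, folded A]
    show ?thesis unfolding cA pl pl1
      by (intro conjI ballI) (rule main(3) | erule main(4-6))+
  next
    case False
    then have M0: "M = 0" and ab: "\<alpha> = \<beta>" using zero assms(5) by auto
    have "of_int (M - m) > (0::real)" using card beta_gt_1 by linarith
    then have m1: "m \<le> -1" using M0 by simp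
    have diff: "- m - (- M) = M - m" by simp
    have neg: "- M \<le> 0" "0 \<le> - m" "\<alpha> = -\<beta> \<or> 1 \<le> - m" using zero m1 by auto
    let ?X = "spectrum A \<alpha>"
    have X: "spectrum {- M..- m} \<alpha> = uminus ` ?X"
      unfolding A spectrum_uminus[symmetric] by simp
    note main = spectrum_gaps_rightwards[OF assms(5) neg, unfolded diff, OF card j bounds, unfolded X]
    let ?D = "{1 / \<beta> ^ n, 1 / \<beta> ^ n * (of_int j - \<beta>'), 1 / \<beta> ^ n * (of_int j + 1 - \<beta>')}"
    have fin: "locally_finite ?X"
      using locally_finite_uminus[OF main(1)] by (simp add: image_image)
    have below: "\<not> bdd_below ?X" using main(2) by simp
    have above: "bdd_above ?X"
    proof -
      have "x \<le> 0" if "x \<in> ?X" for x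
        using that by (induction rule: spectrum_induct)
          (use ab M0 A beta_gt_1 in \<open>auto simp: add_nonpos_nonpos mult_nonneg_nonpos\<close>)
      then show ?thesis by (rule bdd_aboveI)
    qed
    have word: "gap_word ?X x = gap_word (uminus ` ?X) (- x)" if "x \<in> ?X" for x
      by (rule gap_word_mirror[OF fin above below that])
    have "{(x, y). consecutive ?X x y \<and> y - x \<notin> ?D} \<subseteq>
        (\<lambda>(x, y). (- y, - x)) ` {(x, y). consecutive (uminus ` ?X) x y \<and> y - x \<notin> ?D}"
    proof
      fix z assume "z \<in> {(x, y). consecutive ?X x y \<and> y - x \<notin> ?D}"
      then obtain x y where z: "z = (x, y)" "consecutive ?X x y" "y - x \<notin> ?D" by blast
      then show "z \<in> (\<lambda>(x, y). (- y, - x)) ` {(x, y). consecutive (uminus ` ?X) x y \<and> y - x \<notin> ?D}"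
        by (intro image_eqI[of _ _ "(- y, - x)"]) (auto simp: consecutive_uminus)
    qed
    then have "finite {(x, y). consecutive ?X x y \<and> y - x \<notin> ?D}"
      by (rule finite_subset) (rule finite_imageI[OF main(3)])
    then show ?thesis
      unfolding cA pl pl1
    proof (intro conjI ballI)
      fix x\<^sub>0 assume x0: "x\<^sub>0 \<in> ?X"
      then have "- x\<^sub>0 \<in> uminus ` ?X" by simp
      note freq = main(4-6)[OF this, folded word[OF x0]]
      show "has_frequency (gap_word ?X x\<^sub>0) (1 / \<beta> ^ n)
          (1 - \<beta> ^ n / \<beta> * (\<beta> - 1) / of_int (M - m))" by (rule freq(1))
      show "has_frequency (gap_word ?X x\<^sub>0) (1 / \<beta> ^ n * (of_int j - \<beta>'))
          (1 - \<beta> ^ n / \<beta> * (\<beta> - of_int j) * (\<beta> - 1) / of_int (M - m))" by (rule freq(2))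
      show "has_frequency (gap_word ?X x\<^sub>0) (1 / \<beta> ^ n * (of_int j + 1 - \<beta>'))
          (- 1 + \<beta> ^ n / \<beta> * (\<beta> - of_int j + 1) * (\<beta> - 1) / of_int (M - m))" by (rule freq(3))
    qed
  qed
qed

end
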